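(* Let $\mathcal{A}$ be a finite set, $\mathrm{Des}$ a map with $\mathrm{Des}(T)\subseteq[n-1]$ for $T\in\mathcal{A}$, and $\{\varphi_i\}_{1<i<n}$ a family of involutions on $\mathcal{A}$. Let $\mathcal{G}=(\mathcal{A},\sigma,\Phi)$ be the signed, colored graph of type $(n,n)$ with $\sigma(T)_i=-1$ iff $i\in\mathrm{Des}(T)$, and $\Phi_i=\{\{T,\varphi_i(T)\}: T\in\mathcal{A},\ \varphi_i(T)\ne T\}$. Then $\{\varphi_i\}$ is a dual equivalence for $(\mathcal{A},\mathrm{Des})$ if and only if $\mathcal{G}$ is a dual equivalence graph of type $(n,n)$.
   Context: For $m\ge1$ and $D\subseteq[m-1]$, $Q_D(X)=\sum x_{i_1}\cdots x_{i_m}$ over $i_1\le\dots\le i_m$ with $i_j<i_{j+1}$ for $j\in D$ (fundamental quasisymmetric function of degree $m$); $s_\lambda$ is the Schur function. Dual equivalence. Given $(\mathcal{A},\mathrm{Des})$ and involutions $\varphi_2,\dots,\varphi_{n-1}$, for $1<h\le i<n$ and $T\in\mathcal{A}$ let $[T]_{h,i}$ be the equivalence class of $T$ under the equivalence relation generated by $\varphi_h,\dots,\varphi_i$, and let $\mathrm{Des}_{h,i}(U)=\{d-(h-2): d\in\mathrm{Des}(U)\cap\{h-1,\dots,i\}\}\subseteq[i-h+2]$. The family $\{\varphi_i\}$ is a dual equivalence for $(\mathcal{A},\mathrm{Des})$ if (i) for all $1<h\le i<n$ with $i-h\le3$ and all $T\in\mathcal{A}$ there is a partition $\lambda$ of $i-h+3$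 with $\sum_{U\in[T]_{h,i}}Q_{\mathrm{Des}_{h,i}(U)}(X)=s_\lambda(X)$ (degree $i-h+3$ quasisymmetric functions); and (ii) $\varphi_i\varphi_j=\varphi_j\varphi_i$ whenever $|i-j|\ge3$. A signed, colored graph of type $(n,N)$ is $(V,\sigma,E)$: finite $V$, $\sigma:V\to\{\pm1\}^{N-1}$, for $1<i<n$ sets $E_i$ of $2$-element subsets of $V$. It is a dual equivalence graph of type $(n,N)$ if $n\le N$ and (indices only where defined): (ax1) for $w\in V$, $1<i<n$: $\sigma(w)_{i-1}=-\sigma(w)_i$ iff some $x$ has $\{w,x\}\in E_i$, and such $x$ is unique; (ax2) if $\{w,x\}\in E_i$: $\sigma(w)_j=-\sigma(x)_j$ for $j=i-1,i$ and $\sigma(w)_h=\sigma(x)_h$ for $h<i-2$, $h>i+1$; (ax3) if $\{w,x\}\in E_i$ and $\sigma(w)_{i-2}=-\sigma(x)_{i-2}$ then $\sigma(w)_{i-2}=-\sigma(w)_{i-1}$; if $\sigma(w)_{i+1}=-\sigma(x)_{i+1}$ then $\sigma(w)_{i+1}=-\sigma(w)_i$; (ax4) each component of $(V,E_{i-1}\cup E_i)$ is a single vertex, a path $x,y,z$ with only edges $\{x,y\}\in E_{i-1}$, $\{y,z\}\in E_i$, or two vertices joined by both an $E_{i-1}$- and an $E_i$-edge; each component of $(V,E_{i-2}\cup E_{i-1}\cup E_i)$ is: (a) a single vertex; (b) a path $p,q,r,s$ with only edges $\{p,q\}\in E_{i-2}$, $\{q,r\}\in E_{i-1}$, $\{r,s\}\in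 E_i$; (c) vertices $a,b,c,d,e$ with only edges $\{a,b\}\in E_{i-2}\cap E_{i-1}$, $\{b,c\}\in E_i$, $\{c,d\}\in E_{i-2}$, $\{d,e\}\in E_{i-1}\cap E_i$; (d) vertices $u,v,w,x,y,z$ with only edges $\{u,v\}\in E_{i-1}$, $\{v,w\}\in E_{i-2}$, $\{v,x\}\in E_i$, $\{w,y\}\in E_i$, $\{x,y\}\in E_{i-2}$, $\{y,z\}\in E_{i-1}$; (ax5) if $\{w,x\}\in E_i$, $\{x,y\}\in E_j$, $|i-j|\ge3$, then some $v$ has $\{w,v\}\in E_j$, $\{v,y\}\in E_i$; (ax6) for each $1<i<n$, any two vertices of a component of $(V,E_2\cup\dots\cup E_i)$ are joined by a path in it with at most one $E_i$-edge. *)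

theory Defs
  imports Main "HOL-Library.Multiset" "HOL-Library.FuncSet"
begin

text \<open>A homogeneous formal power series in the variables x_1, x_2, ... is identified with its
coefficient function on monomials; a monomial is a multiset of variable indices (all \<ge> 1).\<close>

text \<open>Coefficient of the monomial M in Q_D of degree m: number of sequences
 i_1 \<le> ... \<le> i_m of positive integers with monomial M and i_j < i_(j+1) for j in D.\<close>
definition fundQ :: "nat \<Rightarrow> nat set \<Rightarrow> nat multiset \<Rightarrow> int" where
  "fundQ m D M = int (card {s. length s = m \<and> sorted s \<and> (\<forall>x\<in>set s. 1 \<le> x) \<and> mset s = M
                          \<and> (\<forall>j\<in>D. s ! (j - 1) < s ! j)})"

definition is_partition :: "nat list \<Rightarrow> nat \<Rightarrow> bool" where
  "is_partition lam k \<longleftrightarrow> sorted_wrt (\<ge>) lam \<and> 0 \<notin> set lam \<and> sum_list lam = k"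

definition cells :: "nat list \<Rightarrow> (nat \<times> nat) set" where
  "cells lam = {(r, c). r < length lam \<and> c < lam ! r}"

definition ssyt :: "nat list \<Rightarrow> nat multiset \<Rightarrow> ((nat \<times> nat) \<Rightarrow> nat) set" where
  "ssyt lam M = {T. T \<in> cells lam \<rightarrow>\<^sub>E set_mset M
      \<and> (\<forall>x\<in>#M. 1 \<le> x)
      \<and> (\<forall>r c. (r, c) \<in> cells lam \<and> (r, Suc c) \<in> cells lam \<longrightarrow> T (r, c) \<le> T (r, Suc c))
      \<and> (\<forall>r c. (r, c) \<in> cells lam \<and> (Suc r, c) \<in> cells lam \<longrightarrow> T (r, c) < T (Suc r, c))
      \<and> image_mset T (mset_set (cells lam)) = M}"

definition schur :: "nat list \<Rightarrow> nat multiset \<Rightarrow> int" where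
  "schur lam M = int (card (ssyt lam M))"

definition deq_class :: "'a set \<Rightarrow> (nat \<Rightarrow> 'a \<Rightarrow> 'a) \<Rightarrow> nat \<Rightarrow> nat \<Rightarrow> 'a \<Rightarrow> 'a set" where
  "deq_class A phi h i T =
     {U. (T, U) \<in> {(U, V). U \<in> A \<and> (\<exists>j. h \<le> j \<and> j \<le> i \<and> V = phi j U)}\<^sup>*}"

definition Des_hi :: "('a \<Rightarrow> nat set) \<Rightarrow> nat \<Rightarrow> nat \<Rightarrow> 'a \<Rightarrow> nat set" where
  "Des_hi Des h i U = (\<lambda>d. d - (h - 2)) ` (Des U \<inter> {h - 1..i})"

definition is_dual_equivalence ::
  "'a set \<Rightarrow> ('a \<Rightarrow> nat set) \<Rightarrow> (nat \<Rightarrow> 'a \<Rightarrow> 'a) \<Rightarrow> nat \<Rightarrow> bool" where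
  "is_dual_equivalence A Des phi n \<longleftrightarrow>
     (\<forall>h i T. 1 < h \<and> h \<le> i \<and> i < n \<and> i - h \<le> 3 \<and> T \<in> A \<longrightarrow>
        (\<exists>lam. is_partition lam (i - h + 3) \<and>
           (\<forall>M. (\<Sum>U\<in>deq_class A phi h i T. fundQ (i - h + 3) (Des_hi Des h i U) M) = schur lam M)))
   \<and> (\<forall>i j. 1 < i \<and> i < n \<and> 1 < j \<and> j < n \<and> (i + 3 \<le> j \<or> j + 3 \<le> i) \<longrightarrow>
        (\<forall>T\<in>A. phi i (phi j T) = phi j (phi i T)))"

definition edge_rel :: "'a set set \<Rightarrow> ('a \<times> 'a) set" where
  "edge_rel F = {(x, y). {x, y} \<in> F}"

definition comp :: "'a set set \<Rightarrow> 'a \<Rightarrow> 'a set" where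
  "comp F v = {u. (v, u) \<in> (edge_rel F)\<^sup>*}"

definition restr :: "'a set \<Rightarrow> 'a set set \<Rightarrow> 'a set set" where
  "restr C F = {e \<in> F. e \<subseteq> C}"

definition signed_colored_graph :: "'a set \<Rightarrow> ('a \<Rightarrow> nat \<Rightarrow> int) \<Rightarrow> (nat \<Rightarrow> 'a set set) \<Rightarrow> nat \<Rightarrow> nat \<Rightarrow> bool" where
  "signed_colored_graph V sigma E n N \<longleftrightarrow> finite V
     \<and> (\<forall>v\<in>V. \<forall>j. 1 \<le> j \<and> j \<le> N - 1 \<longrightarrow> sigma v j \<in> {1, -1})
     \<and> (\<forall>i. 1 < i \<and> i < n \<longrightarrow> (\<forall>e\<in>E i. \<exists>x y. x \<in> V \<and> y \<in> V \<and> x \<noteq> y \<and> e = {x, y}))"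

definition is_deg :: "'a set \<Rightarrow> ('a \<Rightarrow> nat \<Rightarrow> int) \<Rightarrow> (nat \<Rightarrow> 'a set set) \<Rightarrow> nat \<Rightarrow> nat \<Rightarrow> bool" where
  "is_deg V sigma E n N \<longleftrightarrow> signed_colored_graph V sigma E n N \<and> n \<le> N
   \<comment> \<open>ax1\<close>
   \<and> (\<forall>w\<in>V. \<forall>i. 1 < i \<and> i < n \<longrightarrow>
        ((sigma w (i - 1) = - sigma w i) \<longleftrightarrow> (\<exists>x. {w, x} \<in> E i))
        \<and> (\<forall>x y. {w, x} \<in> E i \<and> {w, y} \<in> E i \<longrightarrow> x = y))
   \<comment> \<open>ax2\<close>
   \<and> (\<forall>i w x. 1 < i \<and> i < n \<and> {w, x} \<in> E i \<longrightarrow>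
        sigma w (i - 1) = - sigma x (i - 1) \<and> sigma w i = - sigma x i
        \<and> (\<forall>h. 1 \<le> h \<and> h \<le> N - 1 \<and> (h + 2 < i \<or> i + 1 < h) \<longrightarrow> sigma w h = sigma x h))
   \<comment> \<open>ax3\<close>
   \<and> (\<forall>i w x. 1 < i \<and> i < n \<and> {w, x} \<in> E i \<longrightarrow>
        (3 \<le> i \<and> sigma w (i - 2) = - sigma x (i - 2) \<longrightarrow> sigma w (i - 2) = - sigma w (i - 1))
        \<and> (i + 1 \<le> N - 1 \<and> sigma w (i + 1) = - sigma x (i + 1) \<longrightarrow> sigma w (i + 1) = - sigma w i))
   \<comment> \<open>ax4, first part\<close>
   \<and> (\<forall>i. 2 < i \<and> i < n \<longrightarrow> (\<forall>v\<in>V.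
        let C = comp (E (i - 1) \<union> E i) v; F1 = restr C (E (i - 1)); F2 = restr C (E i) in
        (C = {v} \<and> F1 = {} \<and> F2 = {})
        \<or> (\<exists>x y z. distinct [x, y, z] \<and> C = {x, y, z} \<and> F1 = {{x, y}} \<and> F2 = {{y, z}})
        \<or> (\<exists>x y. x \<noteq> y \<and> C = {x, y} \<and> F1 = {{x, y}} \<and> F2 = {{x, y}})))
   \<comment> \<open>ax4, second part\<close>
   \<and> (\<forall>i. 3 < i \<and> i < n \<longrightarrow> (\<forall>v\<in>V.
        let C = comp (E (i - 2) \<union> E (i - 1) \<union> E i) v;
            F0 = restr C (E (i - 2)); F1 = restr C (E (i - 1)); F2 = restr C (E i) in
        (C = {v} \<and> F0 = {} \<and> F1 = {} \<and> F2 = {})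
        \<or> (\<exists>p q r s. distinct [p, q, r, s] \<and> C = {p, q, r, s}
             \<and> F0 = {{p, q}} \<and> F1 = {{q, r}} \<and> F2 = {{r, s}})
        \<or> (\<exists>a b c d e. distinct [a, b, c, d, e] \<and> C = {a, b, c, d, e}
             \<and> F0 = {{a, b}, {c, d}} \<and> F1 = {{a, b}, {d, e}} \<and> F2 = {{b, c}, {d, e}})
        \<or> (\<exists>u v' w x y z. distinct [u, v', w, x, y, z] \<and> C = {u, v', w, x, y, z}
             \<and> F0 = {{v', w}, {x, y}} \<and> F1 = {{u, v'}, {y, z}} \<and> F2 = {{v', x}, {w, y}})))
   \<comment> \<open>ax5\<close>
   \<and> (\<forall>i j w x y. 1 < i \<and> i < n \<and> 1 < j \<and> j < n \<and> (i + 3 \<le> j \<or> j + 3 \<le> i)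
        \<and> {w, x} \<in> E i \<and> {x, y} \<in> E j \<longrightarrow> (\<exists>v. {w, v} \<in> E j \<and> {v, y} \<in> E i))
   \<comment> \<open>ax6\<close>
   \<and> (\<forall>i. 1 < i \<and> i < n \<longrightarrow> (\<forall>u\<in>V. \<forall>v\<in>comp (\<Union>j\<in>{2..i}. E j) u.
        let R = (edge_rel (\<Union>j\<in>{2..<i}. E j))\<^sup>* in
        (u, v) \<in> R \<or> (\<exists>a b. (u, a) \<in> R \<and> {a, b} \<in> E i \<and> (b, v) \<in> R)))"

definition sigma_of :: "('a \<Rightarrow> nat set) \<Rightarrow> 'a \<Rightarrow> nat \<Rightarrow> int" where
  "sigma_of Des T j = (if j \<in> Des T then -1 else 1)"

definition Phi_of :: "'a set \<Rightarrow> (nat \<Rightarrow> 'a \<Rightarrow> 'a) \<Rightarrow> nat \<Rightarrow> 'a set set" where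
  "Phi_of A phi i = {{T, phi i T} | T. T \<in> A \<and> phi i T \<noteq> T}"

end

theory Submission
  imports Defs
begin

text \<open>A standard Young tableau is encoded by its lattice word, the list of the rows of its entries;
  dual equivalence becomes the Knuth move on three consecutive letters, and \<open>Q\<close>-expansions of Schur
  functions are sums over the lattice words of a fixed content.

  Under axioms 1 to 5, labellings of the classes of \<open>phi 2, \<dots>, phi (i - 1)\<close> by lattice words of
  length \<open>i\<close> extend to length \<open>i + 1\<close>: axiom 3 supplies the new letter, and rigidity of labellings
  together with axiom 4 forces compatibility with \<open>phi i\<close>. Only injectivity on classes is left, and
  it is equivalent to axiom 6. If axiom 6 holds, a class of \<open>phi h, \<dots>, phi i\<close> is therefore a Knuth
  class of words, which crystal operators carry to a class of lattice words, whose generating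
  function is a Schur function. Conversely, Schur classes of degree 3, 4 and 5 yield axioms 1 to 4
  through the finitely many possible families of descent sets; a Schur class of degree 6 is labelled
  injectively, because a Schur function contains a descent set occurring exactly once, and short
  closed walks inside such classes then show that any two adjacent classes are joined directly,
  which is axiom 6.\<close>

section \<open>Lattice words and Knuth moves\<close>

text \<open>A letter is a row index: the word of a standard tableau lists the rows of its entries 1,
  2, 3, ..., so the last letter names the removable corner with the largest entry. Inside a class of
  \<open>phi 2\<close>, ..., \<open>phi i\<close> the classes of \<open>phi 2\<close>, ...,
  \<open>phi (i - 1)\<close> should thus be told apart by one letter; the obstacle is that axioms 1
  to 5 leave open whether several of them share a letter. Up to degree 5 the descent sets of the
  tableaux of one shape are pairwise distinct, and a Schur class can be read off from its descents.
  In degree 6 this fails: the descent set {2, 4} occurs twice in shape (3, 2, 1). Hence degree 6 is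
  reached through labellings. It also suffices: a walk through three classes whose letters are
  corners r < s < t exchanges each pair of corners once, and an exchange needs a witness letter
  between the two. The letters s - 1, t - 1 and s serve as witnesses, and with t - 2 as an auxiliary
  letter the walk lives on the six letters t - 2, s - 1, t - 1, r, s, t, hence in one class of
  \<open>phi (i - 3)\<close>, ..., \<open>phi i\<close>.\<close>

definition wdes :: "nat list \<Rightarrow> nat \<Rightarrow> bool" where
  "wdes w j \<longleftrightarrow> w ! (j - 1) < w ! j"

text \<open>Equal letters are regarded as decreasing from left to right. If three letters are not
  monotone in this order, the middle one stands first or last, and the other two, which are
  adjacent, are exchanged: the elementary Knuth relation. On tableaux this is elementary dual
  equivalence for three consecutive entries.\<close>

definition knuth_triple :: "nat \<Rightarrow> nat \<Rightarrow> nat \<Rightarrow> nat list" where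
  "knuth_triple a b c =
     (if (a < b) = (b < c) then [a, b, c]
      else if b \<le> a \<and> a < c \<or> c \<le> a \<and> a < b then [a, c, b] else [b, a, c])"

definition knuth_move :: "nat \<Rightarrow> nat list \<Rightarrow> nat list" where
  "knuth_move i w = (if 2 \<le> i \<and> i < length w
     then take (i - 2) w @ knuth_triple (w ! (i - 2)) (w ! (i - 1)) (w ! i) @ drop (Suc i) w
     else w)"

text \<open>A multiset of letters stands for a partition, the multiplicity of \<open>r\<close> being
  the length of row \<open>r\<close>, counted from 0.\<close>

definition part :: "nat multiset \<Rightarrow> bool" where
  "part N \<longleftrightarrow> (\<forall>r. count N (Suc r) \<le> count N r)"

definition lattice_word :: "nat list \<Rightarrow> bool" where
  "lattice_word w \<longleftrightarrow> (\<forall>k. part (mset (take k w)))"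

lemma length_knuth_triple [simp]: "length (knuth_triple a b c) = 3"
  by (simp add: knuth_triple_def)

lemma mset_knuth_triple [simp]: "mset (knuth_triple a b c) = {#a, b, c#}"
  by (auto simp: knuth_triple_def)

lemma knuth_triple_simps:
  "(a < b) = (b < c) \<Longrightarrow> knuth_triple a b c = [a, b, c]"
  "b \<le> a \<Longrightarrow> a < c \<Longrightarrow> knuth_triple a b c = [a, c, b]"
  "c \<le> a \<Longrightarrow> a < b \<Longrightarrow> knuth_triple a b c = [a, c, b]"
  "a < c \<Longrightarrow> c \<le> b \<Longrightarrow> knuth_triple a b c = [b, a, c]"
  "b < c \<Longrightarrow> c \<le> a \<Longrightarrow> knuth_triple a b c = [b, a, c]"
  by (simp_all add: knuth_triple_def)

lemma knuth_triple_cases: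
  fixes a b c :: nat
  obtains "(a < b) = (b < c)" | "b \<le> a" "a < c" | "c \<le> a" "a < b" | "a < c" "c \<le> b" | "b < c" "c \<le> a"
  by (cases "a < b"; cases "b < c"; cases "a < c") auto

lemma list3_decomp:
  assumes "2 \<le> i" "i < length w"
  obtains p a b c q where "w = p @ a # b # c # q" "i = length p + 2"
proof -
  obtain a b c r where *: "drop (i - 2) w = a # b # c # r"
  proof -
    have "length (drop (i - 2) w) \<ge> 3" using assms by simp
    then show ?thesis using that
      by (metis Suc_le_length_iff numeral_3_eq_3)
  qed
  have "w = take (i - 2) w @ drop (i - 2) w" by simp
  then show ?thesis using that[of "take (i - 2) w" a b c r] * assms by simp
qed

lemma knuth_move_triple:
  "i = length p + 2 \<Longrightarrow> knuth_move i (p @ a # b # c # q) = p @ knuth_triple a b c @ q"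
  by (simp add: knuth_move_def nth_append)

lemma knuth_triple_obtain:
  obtains x y z where "knuth_triple a b c = [x, y, z]" "knuth_triple x y z = [a, b, c]"
proof -
  define t where "t = (if (a < b) = (b < c) then (a, b, c)
      else if b \<le> a \<and> a < c \<or> c \<le> a \<and> a < b then (a, c, b) else (b, a, c))"
  have "knuth_triple a b c = [fst t, fst (snd t), snd (snd t)]"
    by (simp add: t_def knuth_triple_def)
  moreover have "knuth_triple (fst t) (fst (snd t)) (snd (snd t)) = [a, b, c]"
    unfolding t_def knuth_triple_def by (simp; linarith)
  ultimately show ?thesis using that by blast
qed

lemma length_knuth_move [simp]: "length (knuth_move i w) = length w"
  by (auto simp: knuth_move_def)

lemma mset_knuth_move [simp]: "mset (knuth_move i w) = mset w"
proof (cases "2 \<le> i \<and> i < length w")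
  case True
  then obtain p a b c q where "w = p @ a # b # c # q" "i = length p + 2"
    using list3_decomp[of i w] by blast
  then show ?thesis using knuth_move_triple[of i p a b c q] True by simp
qed (auto simp: knuth_move_def)

lemma knuth_move_knuth_move [simp]: "knuth_move i (knuth_move i w) = w"
proof (cases "2 \<le> i \<and> i < length w")
  case True
  then obtain p a b c q where w: "w = p @ a # b # c # q" "i = length p + 2"
    using list3_decomp[of i w] by blast
  obtain x y z where "knuth_triple a b c = [x, y, z]" "knuth_triple x y z = [a, b, c]"
    by (rule knuth_triple_obtain)
  then show ?thesis using w by (simp add: knuth_move_triple)
qed (auto simp: knuth_move_def)

lemma knuth_move_append: "i < length u \<Longrightarrow> knuth_move i (u @ z) = knuth_move i u @ z"
  by (auto simp: knuth_move_def nth_append)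

lemma knuth_move_prepend: "2 \<le> j \<Longrightarrow> knuth_move (length p + j) (p @ u) = p @ knuth_move j u"
  by (auto simp: knuth_move_def nth_append)

lemma drop_knuth_move: "i < m \<Longrightarrow> drop m (knuth_move i w) = drop m w"
  by (auto simp: knuth_move_def)

lemma wdes_append: "j < length u \<Longrightarrow> wdes (u @ z) j = wdes u j"
  by (auto simp: wdes_def nth_append)

section \<open>Partitions as multisets of letters, and lattice words of a given content\<close>

lemma part_count_le: "part N \<Longrightarrow> r \<le> s \<Longrightarrow> count N s \<le> count N r"
  unfolding part_def by (rule lift_Suc_antimono_le[of "count N"]) auto

lemma part_empty [simp]: "part {#}"
  by (simp add: part_def)

lemma lattice_Nil [simp]: "lattice_word []"
  by (simp add: lattice_word_def)

lemma lattice_part: "lattice_word w \<Longrightarrow> part (mset w)"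
  unfolding lattice_word_def by (metis take_all_iff order_refl)

text \<open>The condition on the second part sees the first part only through its content. Hence a
  prefix may be replaced by any lattice word of the same content, which is how convenient
  representatives are chosen later.\<close>

lemma lattice_append_iff:
  "lattice_word (u @ v) \<longleftrightarrow> lattice_word u \<and> (\<forall>k. part (mset u + mset (take k v)))"
proof (intro iffI conjI allI)
  assume l: "lattice_word (u @ v)"
  show "lattice_word u" unfolding lattice_word_def
  proof
    fix k
    have "part (mset (take (min k (length u)) (u @ v)))"
      using l unfolding lattice_word_def by blast
    then show "part (mset (take k u))" by (simp add: min_def split: if_splits)
  qed
  fix k
  have "part (mset (take (length u + k) (u @ v)))"
    using l unfolding lattice_word_def by blast
  then show "part (mset u + mset (take k v))" by simp
next
  assume l: "lattice_word u \<and> (\<forall>k. part (mset u + mset (take k v)))"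
  show "lattice_word (u @ v)" unfolding lattice_word_def
  proof
    fix k
    show "part (mset (take k (u @ v)))"
    proof (cases "k \<le> length u")
      case True
      then show ?thesis using l by (auto simp: lattice_word_def)
    next
      case False
      then show ?thesis using l by auto
    qed
  qed
qed

lemma lattice_snoc:
  "lattice_word (w @ [x]) \<longleftrightarrow> lattice_word w \<and> part (add_mset x (mset w))"
proof -
  have "(\<forall>k. part (mset w + mset (take k [x]))) \<longleftrightarrow> part (mset w) \<and> part (add_mset x (mset w))"
  proof
    assume *: "\<forall>k. part (mset w + mset (take k [x]))"
    show "part (mset w) \<and> part (add_mset x (mset w))"
      using *[rule_format, of 0] *[rule_format, of 1] by simp
  next
    assume *: "part (mset w) \<and> part (add_mset x (mset w))"
    show "\<forall>k. part (mset w + mset (take k [x]))"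
    proof
      fix k show "part (mset w + mset (take k [x]))" using * by (cases k) auto
    qed
  qed
  then show ?thesis unfolding lattice_append_iff using lattice_part[of w] by blast
qed

lemma lattice_snoc2:
  "lattice_word (w @ [x, y]) \<longleftrightarrow> lattice_word (w @ [x]) \<and> part ({#x, y#} + mset w)"
  using lattice_snoc[of "w @ [x]" y] by (simp add: add_mset_commute)

lemma lattice_snoc3:
  "lattice_word (w @ [x, y, z]) \<longleftrightarrow> lattice_word (w @ [x, y]) \<and> part ({#x, y, z#} + mset w)"
  using lattice_snoc[of "w @ [x, y]" z] by (simp add: add_mset_commute)

lemma part_add:
  assumes "part N"
  shows "part (add_mset x N) \<longleftrightarrow> x = 0 \<or> count N x < count N (x - 1)"
proof (cases x)
  case 0
  then show ?thesis using assms by (auto simp: part_def le_SucI)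
next
  case (Suc y)
  have "part (add_mset x N) \<longleftrightarrow> count N x < count N (x - 1)"
  proof
    assume "part (add_mset x N)"
    then have "count (add_mset x N) (Suc y) \<le> count (add_mset x N) y"
      unfolding part_def by blast
    then show "count N x < count N (x - 1)" by (simp add: Suc)
  next
    assume "count N x < count N (x - 1)"
    then show "part (add_mset x N)" using assms by (auto simp: part_def Suc le_SucI)
  qed
  then show ?thesis by (simp add: Suc)
qed

lemma part_remove:
  assumes "part N" "z \<in># N"
  shows "part (N - {#z#}) \<longleftrightarrow> count N (Suc z) < count N z"
proof
  assume "part (N - {#z#})"
  then have "count (N - {#z#}) (Suc z) \<le> count (N - {#z#}) z" unfolding part_def by blast
  moreover have "count N z > 0" using assms by simp
  ultimately show "count N (Suc z) < count N z" by (simp; linarith)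
next
  assume z: "count N (Suc z) < count N z"
  have "count (N - {#z#}) (Suc r) \<le> count (N - {#z#}) r" for r
    using assms(1)[unfolded part_def, rule_format, of r] z by (auto simp: le_diff_conv)
  then show "part (N - {#z#})" by (simp add: part_def)
qed

lemma part_removeI: "part N \<Longrightarrow> count N (Suc z) < count N z \<Longrightarrow> part (N - {#z#})"
  using part_remove[of N z] by (metis count_greater_zero_iff gr_zeroI not_less0)

text \<open>A prefix of the sorted word that reaches \<open>Suc r\<close> already contains every
  \<open>r\<close>. This is the tableau filled row by row.\<close>

lemma lattice_sort:
  assumes "part (mset w)"
  shows "lattice_word (sort w)"
  unfolding lattice_word_def part_def
proof (intro allI)
  fix k r
  let ?s = "sort w" and ?t = "take k (sort w)"
  have split: "mset ?t + mset (drop k ?s) = mset w"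
    by (metis append_take_drop_id mset_append mset_sort)
  show "count (mset ?t) (Suc r) \<le> count (mset ?t) r"
  proof (cases "Suc r \<in> set ?t")
    case True
    have "r \<notin> set (drop k ?s)"
    proof
      assume "r \<in> set (drop k ?s)"
      moreover have "sorted (?t @ drop k ?s)" by simp
      ultimately have "Suc r \<le> r" using True unfolding sorted_append by blast
      then show False by simp
    qed
    then have "count (mset (drop k ?s)) r = 0" by (simp add: count_eq_zero_iff)
    then have "count (mset ?t) r = count (mset w) r"
      using arg_cong[OF split, of "\<lambda>M. count M r"] unfolding count_union by linarith
    moreover have "count (mset ?t) (Suc r) \<le> count (mset w) (Suc r)"
      using arg_cong[OF split, of "\<lambda>M. count M (Suc r)"] by simp
    ultimately show ?thesis using assms unfolding part_def by (metis le_trans)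
  next
    case False
    then show ?thesis by (simp add: count_eq_zero_iff[THEN iffD2])
  qed
qed

lemma ex_lattice_word:
  assumes "part N"
  obtains w where "lattice_word w" "mset w = N"
proof -
  obtain u where "mset u = N" using ex_mset by blast
  then show ?thesis using that[of "sort u"] lattice_sort[of u] assms by simp
qed

lemma lattice_ending:
  assumes "part N" "count N (Suc z) < count N z"
  obtains q where "lattice_word (q @ [z])" "mset (q @ [z]) = N"
proof -
  have z: "z \<in># N" using assms(2) by (metis count_inI not_less0)
  obtain q where "lattice_word q" "mset q = N - {#z#}"
    using ex_lattice_word part_removeI[OF assms] by blast
  then show ?thesis using that[of q] z assms(1) by (simp add: lattice_snoc)
qed

lemma lattice_ending2:
  assumes "part N" "count N (Suc z) < count N z" "count (N - {#z#}) (Suc y) < count (N - {#z#}) y"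
  obtains q where "lattice_word (q @ [y, z])" "mset (q @ [y, z]) = N"
proof -
  have z: "z \<in># N" using assms(2) by (metis count_inI not_less0)
  obtain q where q: "lattice_word (q @ [y])" "mset (q @ [y]) = N - {#z#}"
    using lattice_ending[OF part_removeI[OF assms(1,2)] assms(3)] by blast
  have "add_mset z (mset (q @ [y])) = N" using q(2) z by simp
  then have "mset (q @ [y, z]) = N" by (simp add: add_mset_commute)
  moreover have "lattice_word (q @ [y, z])"
    using lattice_snoc[of "q @ [y]" z] q(1) \<open>add_mset z (mset (q @ [y])) = N\<close> assms(1) by simp
  ultimately show ?thesis using that by blast
qed

lemma lattice_cong_append:
  assumes "lattice_word (u @ v)" "lattice_word u'" "mset u' = mset u"
  shows "lattice_word (u' @ v)"
  using assms unfolding lattice_append_iff by simp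

text \<open>A move alters the content of a single prefix: the one ending after two letters of the
  triple if the last two are exchanged, the one ending after its first letter if the first two are.
  Only that content has to be checked.\<close>

lemma lattice_knuth_move:
  assumes "lattice_word w"
  shows "lattice_word (knuth_move i w)"
proof (cases "2 \<le> i \<and> i < length w")
  case True
  then obtain p a b c q where w: "w = p @ a # b # c # q" "i = length p + 2"
    using list3_decomp[of i w] by blast
  let ?N = "mset p"
  have l: "lattice_word (p @ [a, b, c])"
    using assms w lattice_append_iff[of "p @ [a,b,c]" q] by simp
  then have p: "lattice_word p" "part (add_mset a ?N)" "part ({#a, b#} + ?N)" "part ({#a, b, c#} + ?N)"
    by (auto simp: lattice_snoc3 lattice_snoc2 lattice_snoc)
  have "lattice_word (p @ knuth_triple a b c)"
  proof -
    have pN: "part ?N" using p(1) lattice_part by blast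
    have 1: "part ({#a, c#} + ?N)" if "(a < b) \<noteq> (b < c)" "b \<le> a \<and> a < c \<or> c \<le> a \<and> a < b"
      unfolding part_def
    proof
      fix r show "count ({#a, c#} + ?N) (Suc r) \<le> count ({#a, c#} + ?N) r"
        using that p(2-4)[unfolded part_def, THEN spec, of r] pN[unfolded part_def, THEN spec, of r]
        by (auto split: if_splits)
    qed
    have 2: "part (add_mset b ?N)" if "(a < b) \<noteq> (b < c)" "\<not> (b \<le> a \<and> a < c \<or> c \<le> a \<and> a < b)"
      unfolding part_def
    proof
      fix r show "count (add_mset b ?N) (Suc r) \<le> count (add_mset b ?N) r"
        using that p(2-4)[unfolded part_def, THEN spec, of r] pN[unfolded part_def, THEN spec, of r]
        by (auto split: if_splits)
    qed
    show ?thesis using p 1 2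
      by (auto simp: knuth_triple_def lattice_snoc3 lattice_snoc2 lattice_snoc add_mset_commute)
  qed
  then have "lattice_word ((p @ knuth_triple a b c) @ q)"
    using lattice_cong_append[of "p @ [a,b,c]" q "p @ knuth_triple a b c"] assms w by simp
  then show ?thesis using w by (simp add: knuth_move_triple)
qed (use assms in \<open>auto simp: knuth_move_def\<close>)

section \<open>Connectedness of the lattice words of one content\<close>

definition knuth_rel :: "(nat list \<times> nat list) set" where
  "knuth_rel = {(w, knuth_move i w) | w i. True}"

lemma knuth_relI: "(w, knuth_move i w) \<in> knuth_rel"
  by (auto simp: knuth_rel_def)

lemma knuth_rtrancl_sym: "(u, v) \<in> knuth_rel\<^sup>* \<Longrightarrow> (v, u) \<in> knuth_rel\<^sup>*"
proof -
  have "sym knuth_rel"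
    by (rule symI) (auto simp: knuth_rel_def, metis knuth_move_knuth_move)
  then show "(u, v) \<in> knuth_rel\<^sup>* \<Longrightarrow> (v, u) \<in> knuth_rel\<^sup>*"
    by (meson sym_rtrancl symE)
qed

lemma knuth_rtrancl_append: "(u, v) \<in> knuth_rel\<^sup>* \<Longrightarrow> (u @ z, v @ z) \<in> knuth_rel\<^sup>*"
proof (induction rule: rtrancl_induct)
  case (step v w)
  then obtain i where w: "w = knuth_move i v" by (auto simp: knuth_rel_def)
  show ?case
  proof (cases "i < length v")
    case True
    then have "(v @ z, w @ z) \<in> knuth_rel" using w knuth_move_append knuth_relI by metis
    then show ?thesis using step by simp
  next
    case False
    then have "w = v" using w by (simp add: knuth_move_def)
    then show ?thesis using step by simp
  qed
qed simp

lemma knuth_rtrancl_inv: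
  assumes "(u, v) \<in> knuth_rel\<^sup>*"
  shows "mset v = mset u" "lattice_word u \<Longrightarrow> lattice_word v"
  using assms by (induction rule: rtrancl_induct) (auto simp: knuth_rel_def lattice_knuth_move)

lemma part_remove_pair:
  assumes "part (add_mset c N)" "part (add_mset d N)" "c \<noteq> d"
  shows "part N"
  unfolding part_def
proof
  fix r show "count N (Suc r) \<le> count N r"
    using assms(1,2)[unfolded part_def, THEN spec, of r] assms(3) by (auto split: if_splits)
qed

text \<open>Both \<open>c\<close> and \<open>d\<close> can be added to the content \<open>N\<close>
  left after removing both. So row \<open>d\<close> of \<open>N\<close> is strictly shorter than row
  \<open>d - 1\<close>, and a lattice word of content \<open>N\<close> may end in
  \<open>d - 1\<close>. Since \<open>c \<le> d - 1 < d\<close>, this letter is the witness that lets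
  one Knuth move exchange \<open>c\<close> and \<open>d\<close>.\<close>

lemma lattice_bridge:
  assumes uv: "lattice_word (u0 @ [d])" "lattice_word (v0 @ [c])"
      "add_mset d (mset u0) = add_mset c (mset v0)" "c < d"
  obtains p where "lattice_word (p @ [d - 1, c, d])" "lattice_word (p @ [d - 1, d, c])"
    "mset (p @ [d - 1, c]) = mset u0" "mset (p @ [d - 1, d]) = mset v0"
proof -
  define N where "N = mset u0 - {#c#}"
  have c: "c \<in># mset u0" using uv(3,4) by (metis insert_noteq_member nat_neq_iff)
  have N: "mset u0 = add_mset c N" "mset v0 = add_mset d N"
    using c uv(3) by (simp_all add: N_def, metis add_mset_add_mset_same_iff add_mset_commute
        insert_DiffM)
  have pN: "part (add_mset c N)" "part (add_mset d N)" "part ({#c, d#} + N)"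
    using uv N lattice_part[of u0] lattice_part[of v0] lattice_part[of "u0 @ [d]"]
    by (auto simp: lattice_snoc add_mset_commute)
  then have p0: "part N" using part_remove_pair[of c N d] uv by blast
  have "count N d < count N (d - 1)"
    using pN(2) p0 part_add[of N d] uv(4) by simp
  then have p1: "part (N - {#d - 1#})" "d - 1 \<in># N"
    using part_removeI[of N "d - 1"] p0 uv(4) by (auto simp: Suc_le_eq)
      (metis count_eq_zero_iff not_less0)
  then obtain p where p: "lattice_word p" "mset p = N - {#d - 1#}"
    using ex_lattice_word by blast
  have mp: "add_mset (d - 1) (mset p) = N" using p p1 by simp
  have "lattice_word (p @ [d - 1, c, d])" "lattice_word (p @ [d - 1, d, c])"
    using p mp p0 pN N
    by (simp_all add: lattice_snoc3 lattice_snoc2 lattice_snoc add_mset_commute)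
  then show ?thesis using that mp N by (simp add: add_mset_commute)
qed

lemma knuth_move_bridge: "c < d \<Longrightarrow> knuth_move (length p + 2) (p @ [d - 1, c, d]) = p @ [d - 1, d, c]"
  by (simp add: knuth_move_triple knuth_triple_def)

text \<open>Words with the same last letter are connected by moves on their prefixes. If the last
  letters differ, each word is moved to one end of a bridge.\<close>

lemma lattice_knuth_connected:
  assumes "lattice_word u" "lattice_word v" "mset u = mset v"
  shows "(u, v) \<in> knuth_rel\<^sup>*"
  using assms
proof (induction "length u" arbitrary: u v)
  case 0
  then show ?case by simp
next
  case (Suc m)
  have app: "(u', v') \<in> knuth_rel\<^sup>*"
    if u': "u' = u0 @ [d]" "lattice_word u'" and v': "v' = v0 @ [d]" "lattice_word v'"
      and m: "mset u' = mset v'" "length u' = Suc m" for u' v' u0 v0 d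
  proof -
    have "(u0, v0) \<in> knuth_rel\<^sup>*"
      using Suc(1)[of u0 v0] that by (simp add: lattice_snoc)
    then show ?thesis using knuth_rtrancl_append u' v' by blast
  qed
  obtain u0 d where u: "u = u0 @ [d]" using Suc(2) by (metis length_Suc_conv_rev)
  moreover have "length v = Suc m" using Suc by (metis mset_eq_length)
  then obtain v0 c where v: "v = v0 @ [c]" by (metis length_Suc_conv_rev)
  have bridge: "(u, v) \<in> knuth_rel\<^sup>*"
    if uv: "u = u0 @ [d]" "lattice_word u" "v = v0 @ [c]" "lattice_word v" "mset u = mset v"
      "length u = Suc m" "c < d" for u v u0 v0 c d
  proof -
    have l: "lattice_word (u0 @ [d])" "lattice_word (v0 @ [c])"
      "add_mset d (mset u0) = add_mset c (mset v0)"
      using uv by simp_all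
    obtain p where p: "lattice_word (p @ [d - 1, c, d])" "lattice_word (p @ [d - 1, d, c])"
      "mset (p @ [d - 1, c]) = mset u0" "mset (p @ [d - 1, d]) = mset v0"
      using lattice_bridge[OF l uv(7)] by blast
    let ?w = "p @ [d - 1, c, d]" and ?w' = "p @ [d - 1, d, c]"
    have "mset u = mset ?w" "mset ?w' = mset v" using p uv by (simp_all add: add_mset_commute)
    moreover have "length ?w' = Suc m" using \<open>mset ?w' = mset v\<close> uv(5,6) by (metis mset_eq_length)
    ultimately have "(u, ?w) \<in> knuth_rel\<^sup>*" "(?w', v) \<in> knuth_rel\<^sup>*"
      using app[of u u0 d ?w "p @ [d - 1, c]"] app[of ?w' "p @ [d - 1, d]" c v v0] uv p(1,2)
      by simp_all
    moreover have "(?w, ?w') \<in> knuth_rel"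
      using knuth_relI[of ?w "length p + 2"] knuth_move_bridge[OF uv(7)] by metis
    ultimately show ?thesis by (meson rtrancl.rtrancl_into_rtrancl rtrancl_trans)
  qed
  consider "c = d" | "c < d" | "d < c" by linarith
  then show ?case
  proof cases
    case 1
    then show ?thesis using app u v Suc by metis
  next
    case 2
    then show ?thesis using bridge u v Suc by metis
  next
    case 3
    have "length v = Suc m" using Suc by (metis mset_eq_length)
    then have "(v, u) \<in> knuth_rel\<^sup>*" using bridge[of v v0 c u u0 d] u v Suc.prems 3 by simp
    then show ?thesis by (rule knuth_rtrancl_sym)
  qed
qed

text \<open>A positive letter \<open>x\<close> has an \<open>x - 1\<close> somewhere before it, so a
  new maximum exceeds the old one by at most one, and it can only arise at a descent.\<close>

lemma lattice_max_letter:
  assumes "lattice_word w" "k < length w"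
  shows "\<forall>l\<le>k. w ! l \<le> card {j. 1 \<le> j \<and> j \<le> k \<and> wdes w j}"
  using assms(2)
proof (induction k)
  case 0
  have "part (mset (take 1 w))" using assms(1) unfolding lattice_word_def by blast
  moreover have "take 1 w = [w ! 0]" using 0 by (simp add: take_Suc_conv_app_nth)
  ultimately have "part {#w ! 0#}" by simp
  then have "w ! 0 = 0" using part_add[of "{#}" "w ! 0"] by simp
  then show ?case by simp
next
  case (Suc k)
  let ?S = "\<lambda>k. {j. 1 \<le> j \<and> j \<le> k \<and> wdes w j}"
  have IH: "\<forall>l\<le>k. w ! l \<le> card (?S k)" using Suc by simp
  have fin: "finite (?S m)" for m by (rule finite_subset[of _ "{..m}"]) auto
  have mono: "card (?S k) \<le> card (?S (Suc k))" by (rule card_mono[OF fin]) auto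
  have "w ! Suc k \<le> card (?S (Suc k))"
  proof (cases "wdes w (Suc k)")
    case True
    then have "?S (Suc k) = insert (Suc k) (?S k)" by (auto simp: le_Suc_eq)
    then have c: "card (?S (Suc k)) = Suc (card (?S k))" using fin[of k] by simp
    show ?thesis
    proof (cases "w ! Suc k = 0")
      case False
      have tk: "take (Suc (Suc k)) w = take (Suc k) w @ [w ! Suc k]"
        using Suc(2) by (simp add: take_Suc_conv_app_nth)
      have "part (mset (take (Suc k) w))" "part (mset (take (Suc (Suc k)) w))"
        using assms(1) unfolding lattice_word_def by blast+
      then have "count (mset (take (Suc k) w)) (w ! Suc k - 1) > 0"
        using part_add[of "mset (take (Suc k) w)" "w ! Suc k"] False unfolding tk
        by (metis add_mset_add_single bot_nat_0.not_eq_extremum mset_append mset_single_iff_right not_less0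
            mset.simps)
      then have "w ! Suc k - 1 \<in> set (take (Suc k) w)" by (metis count_greater_zero_iff set_mset_mset)
      then obtain l where "l \<le> k" "w ! l = w ! Suc k - 1"
        by (auto simp: in_set_conv_nth less_Suc_eq_le)
      then show ?thesis using IH c False by (metis Suc_le_mono Suc_pred' bot_nat_0.not_eq_extremum)
    qed simp
  next
    case False
    then have "w ! Suc k \<le> w ! k" by (simp add: wdes_def)
    then show ?thesis using IH mono by (meson le_refl le_trans)
  qed
  then show ?case using IH mono by (metis le_SucE le_trans)
qed

lemma sorted_card_des_le:
  assumes "sorted s" "k < length s"
  shows "card {j. 1 \<le> j \<and> j \<le> k \<and> wdes s j} \<le> s ! k"
  using assms(2)
proof (induction k)
  case (Suc k)
  let ?S = "\<lambda>k. {j. 1 \<le> j \<and> j \<le> k \<and> wdes s j}"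
  have fin: "finite (?S m)" for m by (rule finite_subset[of _ "{..m}"]) auto
  have "?S (Suc k) \<subseteq> (if wdes s (Suc k) then insert (Suc k) (?S k) else ?S k)"
    by (auto simp: le_Suc_eq)
  then have "card (?S (Suc k)) \<le> card (?S k) + (if wdes s (Suc k) then 1 else 0)"
    using card_mono[OF _ \<open>?S (Suc k) \<subseteq> _\<close>] fin[of k] by (auto split: if_splits)
  moreover have "s ! k \<le> s ! Suc k" using assms(1) Suc(2) by (simp add: sorted_nth_mono)
  ultimately show ?case using Suc by (auto simp: wdes_def split: if_splits)
next
  case 0
  have "{j. 1 \<le> j \<and> j \<le> 0 \<and> wdes s j} = {}" by auto
  then show ?case by (metis card.empty le0)
qed

text \<open>The number of descents so far bounds a letter of \<open>w\<close> from above and a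
  letter of \<open>s\<close> from below, so the two words compare letter by letter. The sum of the
  letters, which depends only on the content, then detects equality.\<close>

lemma lattice_le_sorted:
  assumes "lattice_word w" "sorted s" "length w = length s"
    "\<And>j. 1 \<le> j \<Longrightarrow> j < length s \<Longrightarrow> wdes w j \<Longrightarrow> wdes s j"
  shows "sum_list w \<le> sum_list s" "sum_list w = sum_list s \<Longrightarrow> w = s"
proof -
  have le: "w ! k \<le> s ! k" if "k < length s" for k
  proof -
    have "w ! k \<le> card {j. 1 \<le> j \<and> j \<le> k \<and> wdes w j}"
      using lattice_max_letter[of w k] assms that by simp
    also have "\<dots> \<le> card {j. 1 \<le> j \<and> j \<le> k \<and> wdes s j}"
      by (rule card_mono) (use assms(4) that in \<open>auto intro: finite_subset[of _ "{..k}"]\<close>)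
    also have "\<dots> \<le> s ! k" using sorted_card_des_le[of s k] assms that by simp
    finally show ?thesis .
  qed
  have sw: "sum_list w = (\<Sum>k<length s. w ! k)" and ss: "sum_list s = (\<Sum>k<length s. s ! k)"
    using assms(3) by (simp_all add: sum_list_sum_nth atLeast0LessThan)
  show "sum_list w \<le> sum_list s" unfolding sw ss by (rule sum_mono) (use le in auto)
  assume eq: "sum_list w = sum_list s"
  show "w = s"
  proof (rule nth_equalityI)
    fix k assume "k < length w"
    then show "w ! k = s ! k"
      using sum_mono_inv[of "\<lambda>k. w ! k" "{..<length s}" "\<lambda>k. s ! k"] le eq assms(3)
      unfolding sw ss by simp
  qed (fact assms(3))
qed

section \<open>Dual equivalence classes and charts\<close>

lemma mem_class_self [simp]: "T \<in> deq_class A phi h i T"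
  by (simp add: deq_class_def)

lemma class_step:
  "U \<in> deq_class A phi h i T \<Longrightarrow> U \<in> A \<Longrightarrow> h \<le> j \<Longrightarrow> j \<le> i \<Longrightarrow> phi j U \<in> deq_class A phi h i T"
  unfolding deq_class_def by (auto intro: rtrancl.rtrancl_into_rtrancl)

lemma class_trans:
  "U \<in> deq_class A phi h i T \<Longrightarrow> V \<in> deq_class A phi h i U \<Longrightarrow> V \<in> deq_class A phi h i T"
  unfolding deq_class_def by auto

lemma class_mono:
  assumes "h' \<le> h" "i \<le> i'"
  shows "deq_class A phi h i T \<subseteq> deq_class A phi h' i' T"
proof -
  have "{(U, V). U \<in> A \<and> (\<exists>j. h \<le> j \<and> j \<le> i \<and> V = phi j U)}
      \<subseteq> {(U, V). U \<in> A \<and> (\<exists>j. h' \<le> j \<and> j \<le> i' \<and> V = phi j U)}"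
    using assms by (auto intro: le_trans)
  from rtrancl_mono[OF this] show ?thesis by (auto simp: deq_class_def)
qed

locale involutions =
  fixes A :: "'a set" and phi :: "nat \<Rightarrow> 'a \<Rightarrow> 'a" and n :: nat
  assumes finite_A: "finite A"
    and phi_A [simp]: "1 < i \<Longrightarrow> i < n \<Longrightarrow> T \<in> A \<Longrightarrow> phi i T \<in> A"
    and phi_phi [simp]: "1 < i \<Longrightarrow> i < n \<Longrightarrow> T \<in> A \<Longrightarrow> phi i (phi i T) = T"
begin

lemma class_induct [consumes 4, case_names base step]:
  assumes "U \<in> deq_class A phi h i T" "T \<in> A" "1 < h" "i < n"
    and base: "P T"
    and step: "\<And>V j. V \<in> A \<Longrightarrow> V \<in> deq_class A phi h i T \<Longrightarrow> P V \<Longrightarrow> h \<le> j \<Longrightarrow> j \<le> i \<Longrightarrow> P (phi j V)"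
  shows "P U"
proof -
  let ?R = "{(U, V). U \<in> A \<and> (\<exists>j. h \<le> j \<and> j \<le> i \<and> V = phi j U)}"
  have "(T, U) \<in> ?R\<^sup>*" using assms(1) by (simp add: deq_class_def)
  then have "P U \<and> U \<in> A"
  proof (induction rule: rtrancl_induct)
    case base
    then show ?case using assms by blast
  next
    case (step V W)
    then have "V \<in> deq_class A phi h i T" by (simp add: deq_class_def)
    then show ?case using step assms(3,4) assms(6)[of V] by auto
  qed
  then show ?thesis ..
qed

lemma class_sub:
  assumes "T \<in> A" "1 < h" "i < n" "U \<in> deq_class A phi h i T"
  shows "U \<in> A"
  using assms(4,1,2,3) by (induction rule: class_induct) (use assms in auto)

lemma class_sym:
  assumes "T \<in> A" "1 < h" "i < n" "U \<in> deq_class A phi h i T"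
  shows "T \<in> deq_class A phi h i U"
  using assms(4,1,2,3)
proof (induction rule: class_induct)
  case (step V j)
  have "1 < j" "j < n" using step assms by auto
  then have "phi j V \<in> A" "phi j (phi j V) = V" using step by simp_all
  then have "V \<in> deq_class A phi h i (phi j V)"
    using class_step[of "phi j V" A phi h i "phi j V" j] step by simp
  then show ?case using step class_trans by metis
qed simp

lemma class_eq:
  assumes "T \<in> A" "1 < h" "i < n" "U \<in> deq_class A phi h i T"
  shows "deq_class A phi h i U = deq_class A phi h i T"
  using class_trans[OF assms(4)] class_trans[OF class_sym[OF assms]] by (intro equalityI subsetI)

text \<open>The labelling turns \<open>phi j\<close> into the Knuth move at \<open>j\<close>, so a
  path of moves on the prefix can be followed inside the class. Indices below \<open>m\<close> act
  within the first \<open>m\<close> letters and leave \<open>z\<close> alone.\<close>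

lemma lift_path:
  assumes f: "\<And>y j. y \<in> deq_class A phi 2 (m - 1) x \<Longrightarrow> 2 \<le> j \<Longrightarrow> j < m \<Longrightarrow> f (phi j y) = knuth_move j (f y)"
    and x: "x \<in> A" "m - 1 < n" "f x = u @ z" "length u = m"
    and uv: "(u, v) \<in> knuth_rel\<^sup>*"
  shows "\<exists>y\<in>deq_class A phi 2 (m - 1) x. f y = v @ z"
  using uv
proof (induction rule: rtrancl_induct)
  case base
  show ?case by (rule bexI[of _ x]) (use x in simp_all)
next
  case (step v w)
  then obtain y where y: "y \<in> deq_class A phi 2 (m - 1) x" "f y = v @ z" by blast
  obtain j where j: "w = knuth_move j v" using step by (auto simp: knuth_rel_def)
  have len: "length v = m"
    using knuth_rtrancl_inv(1)[OF step(1)] x(4) by (metis mset_eq_length)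
  show ?case
  proof (cases "2 \<le> j \<and> j < m")
    case True
    have yA: "y \<in> A"
      using class_sub[of x 2 "m - 1" y] x y True by simp
    have "f (phi j y) = w @ z" using f[of y j] y True j len by (simp add: knuth_move_append)
    moreover have "phi j y \<in> deq_class A phi 2 (m - 1) x"
      using class_step[OF y(1) yA, of j] True by auto
    ultimately show ?thesis by blast
  next
    case False
    then have "w = v" using j len by (auto simp: knuth_move_def)
    then show ?thesis using y by blast
  qed
qed

lemma lift_word:
  assumes f: "\<And>y j. y \<in> deq_class A phi 2 (m - 1) x \<Longrightarrow> 2 \<le> j \<Longrightarrow> j < m \<Longrightarrow> f (phi j y) = knuth_move j (f y)"
    and x: "x \<in> A" "m - 1 < n" "f x = u @ z" "length u = m"
    and "lattice_word u" "lattice_word v" "mset v = mset u"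
  obtains y where "y \<in> deq_class A phi 2 (m - 1) x" "f y = v @ z"
  using lift_path[of m x f u z v] lattice_knuth_connected[of u v] assms by metis

text \<open>The sorted word of a given content is extremal among lattice words with at most its
  descents, which pins down the content of a lattice word labelling.\<close>

lemma chart_unique:
  assumes T: "T \<in> A" "m - 1 < n"
    and f: "\<And>y. y \<in> deq_class A phi 2 (m - 1) T \<Longrightarrow> length (f y) = m \<and> lattice_word (f y)"
      "\<And>y j. y \<in> deq_class A phi 2 (m - 1) T \<Longrightarrow> 2 \<le> j \<Longrightarrow> j < m \<Longrightarrow> f (phi j y) = knuth_move j (f y)"
    and g: "\<And>y. y \<in> deq_class A phi 2 (m - 1) T \<Longrightarrow> length (g y) = m \<and> lattice_word (g y)"
      "\<And>y j. y \<in> deq_class A phi 2 (m - 1) T \<Longrightarrow> 2 \<le> j \<Longrightarrow> j < m \<Longrightarrow> g (phi j y) = knuth_move j (g y)"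
    and fg: "\<And>y j. y \<in> deq_class A phi 2 (m - 1) T \<Longrightarrow> 1 \<le> j \<Longrightarrow> j < m \<Longrightarrow> wdes (f y) j = wdes (g y) j"
    and x: "x \<in> deq_class A phi 2 (m - 1) T"
  shows "f x = g x"
proof -
  let ?S = "deq_class A phi 2 (m - 1) T"
  have T2: "1 < (2::nat)" by simp
  have sub: "y \<in> A" if "y \<in> ?S" for y
    using class_sub[OF T(1) T2 T(2)] that by blast
  have const: "mset (h y) = mset (h T)"
    if "y \<in> ?S" "\<And>y j. y \<in> ?S \<Longrightarrow> 2 \<le> j \<Longrightarrow> j < m \<Longrightarrow> h (phi j y) = knuth_move j (h y)"
    for h :: "'a \<Rightarrow> nat list" and y
    using that(1) T(1) T2 T(2)
  proof (induction rule: class_induct)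
    case (step V j)
    then have "2 \<le> j" "j < m" by auto
    then show ?case using step that(2)[of V j] by simp
  qed simp
  \<comment> \<open>By connectedness some \<open>x\<close> carries the sorted word as its
    \<open>h\<close>-label; \<open>h' x\<close> has the same descents and is therefore letterwise at
    most \<open>h x\<close>. Letter sums are constant on the class, so applying this in both
    directions gives equal sums and one element with a common label, from which the moves spread
    equality.\<close>
  have key: "sum_list (h' T) \<le> sum_list (h T) \<and>
      (sum_list (h' T) = sum_list (h T) \<longrightarrow> (\<exists>x\<in>?S. h' x = h x))"
    if h: "\<And>y. y \<in> ?S \<Longrightarrow> length (h y) = m \<and> lattice_word (h y)"
      "\<And>y j. y \<in> ?S \<Longrightarrow> 2 \<le> j \<Longrightarrow> j < m \<Longrightarrow> h (phi j y) = knuth_move j (h y)"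
    and h': "\<And>y. y \<in> ?S \<Longrightarrow> length (h' y) = m \<and> lattice_word (h' y)"
      "\<And>y j. y \<in> ?S \<Longrightarrow> 2 \<le> j \<Longrightarrow> j < m \<Longrightarrow> h' (phi j y) = knuth_move j (h' y)"
    and hh: "\<And>y j. y \<in> ?S \<Longrightarrow> 1 \<le> j \<Longrightarrow> j < m \<Longrightarrow> wdes (h y) j = wdes (h' y) j"
    for h h' :: "'a \<Rightarrow> nat list"
  proof -
    have hT: "length (h T) = m" "lattice_word (h T)" using h(1)[of T] by auto
    obtain x where x: "x \<in> ?S" "h x = sort (h T)"
      using lift_word[of m T h "h T" "[]" "sort (h T)"] h(2) T hT lattice_sort[of "h T"]
        lattice_part[of "h T"] by auto
    have le: "sum_list (h' x) \<le> sum_list (h x)" "sum_list (h' x) = sum_list (h x) \<Longrightarrow> h' x = h x"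
      using lattice_le_sorted[of "h' x" "h x"] h'(1)[OF x(1)] h(1)[OF x(1)] hh[OF x(1)] x(2) by auto
    have "sum_list (h' x) = sum_list (h' T)" "sum_list (h x) = sum_list (h T)"
      using const[OF x(1), of h] const[OF x(1), of h'] h(2) h'(2)
      by (metis sum_mset_sum_list)+
    then show ?thesis using le x(1) by auto
  qed
  have kfg: "sum_list (g T) \<le> sum_list (f T) \<and>
      (sum_list (g T) = sum_list (f T) \<longrightarrow> (\<exists>x\<in>?S. g x = f x))"
    by (rule key[OF f g fg])
  moreover have "sum_list (f T) \<le> sum_list (g T) \<and>
      (sum_list (f T) = sum_list (g T) \<longrightarrow> (\<exists>x\<in>?S. f x = g x))"
    by (rule key[OF g f fg[symmetric]])
  ultimately obtain z where z: "z \<in> ?S" "f z = g z"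
    by auto
  have "x \<in> deq_class A phi 2 (m - 1) z"
    using class_eq[OF T(1) T2 T(2) z(1)] x by simp
  then show ?thesis using sub[OF z(1)] T2 T(2)
  proof (induction rule: class_induct)
    case (step V j)
    then have "2 \<le> j" "j < m" by auto
    moreover have "V \<in> ?S" using step class_eq[OF T(1) T2 T(2) z(1)] by simp
    ultimately show ?case using step f(2)[of V j] g(2)[of V j] by simp
  qed (fact z(2))
qed

end

text \<open>Words of length \<open>m\<close> see the descents and the involutions with index below
  \<open>m\<close>. Injectivity on classes is kept separate, because it is the part that corresponds
  to axiom 6.\<close>

definition chart :: "'a set \<Rightarrow> ('a \<Rightarrow> nat set) \<Rightarrow> (nat \<Rightarrow> 'a \<Rightarrow> 'a) \<Rightarrow> nat \<Rightarrow> ('a \<Rightarrow> nat list) \<Rightarrow> bool" where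
  "chart A D phi m f \<longleftrightarrow> (\<forall>T\<in>A. length (f T) = m \<and> lattice_word (f T)
     \<and> (\<forall>j. 1 \<le> j \<and> j < m \<longrightarrow> (j \<in> D T \<longleftrightarrow> wdes (f T) j))
     \<and> (\<forall>j. 2 \<le> j \<and> j < m \<longrightarrow> f (phi j T) = knuth_move j (f T)))"

lemma chartD:
  assumes "chart A D phi m f" "T \<in> A"
  shows "length (f T) = m" "lattice_word (f T)"
    "\<And>j. 1 \<le> j \<Longrightarrow> j < m \<Longrightarrow> j \<in> D T \<longleftrightarrow> wdes (f T) j"
    "\<And>j. 2 \<le> j \<Longrightarrow> j < m \<Longrightarrow> f (phi j T) = knuth_move j (f T)"
  using assms unfolding chart_def by auto

context involutions
begin

lemma chart_lift:
  assumes f: "chart A D phi i f" "i \<le> n" and U: "U \<in> A" "f U = u @ z" "u \<noteq> []"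
    and v: "lattice_word v" "mset v = mset u"
  shows "\<exists>y\<in>deq_class A phi 2 (length u - 1) U. f y = v @ z"
proof -
  have len: "length u \<le> i" using chartD(1)[OF f(1) U(1)] U(2) by simp
  have n: "1 < (2::nat)" "length u - 1 < n" using len f(2) U(3) by (cases u; simp)+
  have "lattice_word u" using chartD(2)[OF f(1) U(1)] U(2) lattice_append_iff by simp
  moreover have "f (phi j y) = knuth_move j (f y)"
    if "y \<in> deq_class A phi 2 (length u - 1) U" "2 \<le> j" "j < length u" for y j
    using chartD(4)[OF f(1) class_sub[OF U(1) n that(1)]] that len by simp
  ultimately show ?thesis
    using lift_path[of "length u" U f u z v] lattice_knuth_connected[of u v] U n(2) v by simp
qed

end

section \<open>Extending a chart by one letter\<close>

text \<open>Axioms 1, 2, 3 and 5 in terms of the involutions. Axiom 4 enters through four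
  consequences: if one of two consecutive colours is active at both ends of an edge of the other,
  the two form a double edge (\<open>double_up\<close>, \<open>double_down\<close>), and in a
  component with five vertices the double edges at the two ends imply each other
  (\<open>five_up\<close>, \<open>five_down\<close>).\<close>

locale pre_deg = involutions A phi n
  for A :: "'a set" and D :: "'a \<Rightarrow> nat set" and phi :: "nat \<Rightarrow> 'a \<Rightarrow> 'a" and n :: nat +
  assumes fixed_iff: "1 < i \<Longrightarrow> i < n \<Longrightarrow> T \<in> A \<Longrightarrow> phi i T = T \<longleftrightarrow> (i - 1 \<in> D T \<longleftrightarrow> i \<in> D T)"
    and flip: "1 < i \<Longrightarrow> i < n \<Longrightarrow> T \<in> A \<Longrightarrow> phi i T \<noteq> T \<Longrightarrow>
      (i - 1 \<in> D (phi i T)) \<noteq> (i - 1 \<in> D T) \<and> (i \<in> D (phi i T)) \<noteq> (i \<in> D T)"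
    and far: "1 < i \<Longrightarrow> i < n \<Longrightarrow> T \<in> A \<Longrightarrow> 1 \<le> j \<Longrightarrow> j < n \<Longrightarrow> j + 2 < i \<or> i + 1 < j \<Longrightarrow>
      j \<in> D (phi i T) \<longleftrightarrow> j \<in> D T"
    and near_down: "2 < i \<Longrightarrow> i < n \<Longrightarrow> T \<in> A \<Longrightarrow> (i - 2 \<in> D (phi i T)) \<noteq> (i - 2 \<in> D T) \<Longrightarrow>
      (i - 2 \<in> D T) \<noteq> (i - 1 \<in> D T)"
    and near_up: "1 < i \<Longrightarrow> i + 1 < n \<Longrightarrow> T \<in> A \<Longrightarrow> (i + 1 \<in> D (phi i T)) \<noteq> (i + 1 \<in> D T) \<Longrightarrow>
      (i + 1 \<in> D T) \<noteq> (i \<in> D T)"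
    and double_up: "2 < i \<Longrightarrow> i < n \<Longrightarrow> T \<in> A \<Longrightarrow> phi i T \<noteq> T \<Longrightarrow> phi (i - 1) T \<noteq> T \<Longrightarrow>
      phi i (phi (i - 1) T) \<noteq> phi (i - 1) T \<Longrightarrow> phi i T = phi (i - 1) T"
    and double_down: "2 < i \<Longrightarrow> i < n \<Longrightarrow> T \<in> A \<Longrightarrow> phi i T \<noteq> T \<Longrightarrow> phi (i - 1) T \<noteq> T \<Longrightarrow>
      phi (i - 1) (phi i T) \<noteq> phi i T \<Longrightarrow> phi i T = phi (i - 1) T"
    and five_up: "3 < i \<Longrightarrow> i < n \<Longrightarrow> T \<in> A \<Longrightarrow> phi (i - 1) T \<noteq> T \<Longrightarrow> phi (i - 2) T = phi (i - 1) T \<Longrightarrow>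
      phi i T \<noteq> T \<Longrightarrow> d = phi (i - 2) (phi i T) \<Longrightarrow> phi i d \<noteq> d \<and> phi (i - 1) d = phi i d"
    and five_down: "3 < i \<Longrightarrow> i < n \<Longrightarrow> T \<in> A \<Longrightarrow> phi i T \<noteq> T \<Longrightarrow> phi (i - 2) T \<noteq> T \<Longrightarrow>
      d = phi (i - 2) T \<Longrightarrow> phi i d \<noteq> d \<Longrightarrow> phi (i - 1) d = phi i d \<Longrightarrow>
      phi (i - 2) (phi i T) = phi (i - 1) (phi i T)"
    and comm: "1 < i \<Longrightarrow> i < n \<Longrightarrow> 1 < j \<Longrightarrow> j < n \<Longrightarrow> j + 3 \<le> i \<Longrightarrow> T \<in> A \<Longrightarrow>
      phi i (phi j T) = phi j (phi i T)"
begin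

text \<open>The tableaux of the class are to receive one more cell in a common row \<open>r\<close>,
  and descent \<open>i\<close> has to say that this row lies below the row of the previous entry. So
  the last letters of the elements with descent \<open>i\<close> must form an initial segment of the
  last letters that occur. Then \<open>r\<close> is one more than its maximum, or 0 if it is
  empty.\<close>

lemma chart_extension_letter:
  assumes f: "chart A D phi i f" "1 \<le> i" "i < n"
    and inj: "\<And>T. T \<in> A \<Longrightarrow> inj_on f (deq_class A phi 2 (i - 1) T)"
    and T: "T \<in> A"
  shows "\<exists>r. \<forall>U\<in>deq_class A phi 2 (i - 1) T.
    lattice_word (f U @ [r]) \<and> (i \<in> D U \<longleftrightarrow> last (f U) < r)"
proof -
  let ?C = "deq_class A phi 2 (i - 1) T"
  have i1: "1 < (2::nat)" "i - 1 < n" using f by auto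
  have CA: "U \<in> A" if "U \<in> ?C" for U using class_sub[OF T i1 that] .
  have ms: "mset (f U) = mset (f T)" if "U \<in> ?C" for U
    using that T i1
  proof (induction rule: class_induct)
    case (step V j)
    then have "2 \<le> j" "j < i" by auto
    then show ?case using step chartD(4)[OF f(1), of V j] by simp
  qed simp
  have word: "\<exists>U\<in>?C. f U = w" if "lattice_word w" "mset w = mset (f T)" for w
  proof -
    have "length (f T) = i" using chartD(1)[OF f(1) T] .
    then have "f T \<noteq> []" "length (f T) = i" using f(2) by auto
    moreover have "i \<le> n" using f(3) by simp
    ultimately show ?thesis using chart_lift[OF f(1) _ T, of "f T" "[]" w] that by simp
  qed
  \<comment> \<open>The two prefixes are connected by moves with index at most \<open>i - 2\<close>,
    which leave descent \<open>i\<close> alone; injectivity of \<open>f\<close> identifies the end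
    of the lifted path with \<open>V\<close>.\<close>
  have last_const: "i \<in> D U \<longleftrightarrow> i \<in> D V"
    if U: "U \<in> ?C" "f U = u @ [c]" and V: "V \<in> ?C" "f V = v @ [c]" for U V u v c
  proof -
    have lu: "length u = i - 1" using chartD(1)[OF f(1) CA[OF U(1)]] U(2) by simp
    have "mset u = mset v" using ms[OF U(1)] ms[OF V(1)] U(2) V(2)
      by (metis add_right_cancel mset_append)
    moreover have "lattice_word u" "lattice_word v"
      using chartD(2)[OF f(1) CA[OF U(1)]] chartD(2)[OF f(1) CA[OF V(1)]] U V
      by (simp_all add: lattice_snoc)
    moreover have sub: "deq_class A phi 2 (i - 2) U \<subseteq> ?C"
      using class_mono[of 2 2 "i - 2" "i - 1" A phi U] class_eq[OF T i1 U(1)] by auto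
    moreover have "U = V" if "u = []"
    proof -
      have "v = []" using \<open>mset u = mset v\<close> that by simp
      then show ?thesis using inj_onD[OF inj[OF T], of U V] U V that by simp
    qed
    ultimately obtain y where y: "y \<in> deq_class A phi 2 (i - 2) U" "f y = v @ [c]"
    proof (cases "u = []")
      case True
      then have "U = V" using \<open>u = [] \<Longrightarrow> U = V\<close> by blast
      then show ?thesis using that[of U] V by simp
    next
      case False
      have "length u - 1 = i - 2" "i \<le> n" using lu f(3) by simp_all
      then have "\<exists>y\<in>deq_class A phi 2 (i - 2) U. f y = v @ [c]"
        using chart_lift[OF f(1) _ CA[OF U(1)] U(2) False, of v]
          \<open>mset u = mset v\<close> \<open>lattice_word v\<close> by simp
      then show ?thesis using that by (elim bexE)
    qed
    have "y = V" using inj_onD[OF inj[OF T], of y V] y sub V by auto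
    moreover have "i \<in> D y \<longleftrightarrow> i \<in> D U"
    proof -
      have "i - 2 < n" using i1 by simp
      with y(1) CA[OF U(1)] i1(1) show ?thesis
      proof (induction rule: class_induct)
        case (step V j)
        then have "1 < j" "j < n" "j + 1 < i" using f by auto
        then show ?case using step far[of j V i] f by simp
      qed simp
    qed
    ultimately show ?thesis by simp
  qed
  \<comment> \<open>The bridge word and its image under \<open>phi (i - 1)\<close> end in
    \<open>d\<close> and \<open>c\<close>. Both \<open>i - 1\<close> and \<open>i\<close> are
    descents at the bridge, so axiom 3 forbids descent \<open>i\<close> to change along this
    edge.\<close>
  have mono: "i \<in> D U" if U: "U \<in> ?C" "f U = u @ [c]" and V: "V \<in> ?C" "f V = v @ [d]"
    and cd: "c < d" "i \<in> D V" for U V u v c d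
  proof -
    have "lattice_word (v @ [d])" "lattice_word (u @ [c])"
      using chartD(2)[OF f(1) CA[OF U(1)]] chartD(2)[OF f(1) CA[OF V(1)]] U V by simp_all
    moreover have "add_mset d (mset v) = add_mset c (mset u)"
      using ms[OF U(1)] ms[OF V(1)] U(2) V(2) by simp
    ultimately obtain p where p: "lattice_word (p @ [d - 1, c, d])" "lattice_word (p @ [d - 1, d, c])"
      "mset (p @ [d - 1, c]) = mset v" "mset (p @ [d - 1, d]) = mset u"
      using lattice_bridge cd(1) by blast
    have "mset (p @ [d - 1, c, d]) = mset (f T)"
      using p(3)[symmetric] ms[OF V(1)] V(2) by (simp add: add_mset_commute)
    then obtain W where W: "W \<in> ?C" "f W = p @ [d - 1, c, d]" using word p(1) by blast
    have "length (f W) = i" using chartD(1)[OF f(1) CA[OF W(1)]] .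
    then have i: "i = length p + 3" using W by simp
    have fW: "f (phi (i - 1) W) = p @ [d - 1, d, c]"
      using chartD(4)[OF f(1) CA[OF W(1)], of "i - 1"] knuth_move_bridge[OF cd(1), of p] W(2) i by simp
    have W': "phi (i - 1) W \<in> ?C" using class_step[OF W(1) CA[OF W(1)]] i by simp
    have "i \<in> D W" using last_const[of V v d W "p @ [d - 1, c]"] V W cd by simp
    moreover have "i - 1 \<in> D W"
      using chartD(3)[OF f(1) CA[OF W(1)], of "i - 1"] i W(2) cd(1) by (simp add: wdes_def nth_append)
    moreover have "i - 1 + 1 = i" "1 < i - 1" using i by simp_all
    ultimately have "i \<in> D (phi (i - 1) W)"
      using near_up[of "i - 1" W] CA[OF W(1)] f(3) by metis
    then show ?thesis
      using last_const[of U u c "phi (i - 1) W" "p @ [d - 1, d]"] U W' fW by simp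
  qed
  have nonempty: "f U \<noteq> []" if "U \<in> ?C" for U
    using chartD(1)[OF f(1) CA[OF that]] f(2) by auto
  have snoc: "f U = butlast (f U) @ [last (f U)]" if "U \<in> ?C" for U
    using nonempty[OF that] by simp
  define G where "G = {c. \<exists>U\<in>?C. last (f U) = c \<and> i \<in> D U}"
  have finG: "finite G"
  proof (rule finite_subset)
    show "G \<subseteq> set (f T)"
    proof
      fix c assume "c \<in> G"
      then obtain U where U: "U \<in> ?C" "last (f U) = c" by (auto simp: G_def)
      then have "c \<in> set (f U)" using nonempty by auto
      then show "c \<in> set (f T)" using ms[OF U(1)] by (metis set_mset_mset)
    qed
  qed simp
  have ext: "lattice_word (f U @ [r])" if "U \<in> ?C" "part (add_mset r (mset (f T)))" for U r
    using that ms[OF that(1)] chartD(2)[OF f(1) CA[OF that(1)]] by (simp add: lattice_snoc)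
  have pT: "part (mset (f T))" using lattice_part chartD(2)[OF f(1) T] by blast
  show ?thesis
  proof (cases "G = {}")
    case True
    then show ?thesis using ext[of _ 0] part_add[OF pT, of 0] by (intro exI[of _ 0]) (auto simp: G_def)
  next
    case False
    define c where "c = Max G"
    have c: "c \<in> G" using finG False by (simp add: c_def)
    then obtain U where U: "U \<in> ?C" "last (f U) = c" "i \<in> D U" by (auto simp: G_def)
    \<comment> \<open>As a last letter, \<open>c\<close> is a removable corner of the content of the
      class; hence row \<open>Suc c\<close> is strictly shorter than row \<open>c\<close> and can be
      extended.\<close>
    have "part (mset (butlast (f U)))" "mset (f T) = add_mset c (mset (butlast (f U)))"
      using chartD(2)[OF f(1) CA[OF U(1)]] snoc[OF U(1)] U(2) ms[OF U(1)]
      by (metis lattice_snoc lattice_part, metis add_mset_add_single mset_append mset_single_iff_right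
          mset.simps)
    then have "count (mset (f T)) (Suc c) < count (mset (f T)) c"
      using part_count_le[of "mset (butlast (f U))" c "Suc c"] by simp
    then have p: "part (add_mset (Suc c) (mset (f T)))" using part_add[OF pT, of "Suc c"] by simp
    have "i \<in> D V \<longleftrightarrow> last (f V) < Suc c" if V: "V \<in> ?C" for V
    proof
      assume "i \<in> D V"
      then have "last (f V) \<in> G" using V by (auto simp: G_def)
      then show "last (f V) < Suc c" using finG by (simp add: c_def less_Suc_eq_le)
    next
      assume "last (f V) < Suc c"
      then show "i \<in> D V"
        using mono[OF V snoc[OF V] U(1) snoc[OF U(1)]] last_const[OF V _ U(1)] snoc[OF V] snoc[OF U(1)] U
        by (metis less_antisym)
    qed
    then show ?thesis using ext p by blast
  qed
qed

end

text \<open>As the new letter is constant on the classes of \<open>phi 2\<close>, ...,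
  \<open>phi (i - 1)\<close>, appending it keeps compatibility with these involutions. What has to
  be earned is compatibility with \<open>phi i\<close>.\<close>

locale chart_extension = pre_deg +
  fixes i :: nat and f :: "'a \<Rightarrow> nat list" and r :: "'a \<Rightarrow> nat"
  assumes f: "chart A D phi i f" and i2: "2 \<le> i" and i_n: "i < n"
    and f_inj: "T \<in> A \<Longrightarrow> inj_on f (deq_class A phi 2 (i - 1) T)"
    and r_const: "T \<in> A \<Longrightarrow> U \<in> deq_class A phi 2 (i - 1) T \<Longrightarrow> r U = r T"
    and r_lattice: "T \<in> A \<Longrightarrow> lattice_word (f T @ [r T])"
    and r_des: "T \<in> A \<Longrightarrow> i \<in> D T \<longleftrightarrow> last (f T) < r T"
begin

definition g :: "'a \<Rightarrow> nat list" where "g T = f T @ [r T]"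

lemma one_less_i: "1 < i" "i - 1 < n" "i - 3 < n" "1 < (2::nat)"
  using i2 i_n by auto

lemma phi_i_A [simp]: "T \<in> A \<Longrightarrow> phi i T \<in> A"
  using phi_A[OF one_less_i(1) i_n] .

lemma phi_i_i [simp]: "T \<in> A \<Longrightarrow> phi i (phi i T) = T"
  using phi_phi[OF one_less_i(1) i_n] .

lemma g_length: "T \<in> A \<Longrightarrow> length (g T) = Suc i"
  using chartD(1)[OF f] by (simp add: g_def)

lemma g_lattice: "T \<in> A \<Longrightarrow> lattice_word (g T)"
  using r_lattice by (simp add: g_def)

lemma g_phi:
  assumes "T \<in> A" "2 \<le> j" "j < i"
  shows "g (phi j T) = knuth_move j (g T)"
proof -
  have "phi j T \<in> deq_class A phi 2 (i - 1) T" using class_step[of T A phi 2 "i - 1" T j] assms by simp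
  then have "r (phi j T) = r T" by (rule r_const[OF assms(1)])
  then show ?thesis using chartD(4)[OF f assms] chartD(1)[OF f assms(1)] assms(3)
    by (simp add: g_def knuth_move_append)
qed

lemma g_des:
  assumes "T \<in> A" "1 \<le> j" "j \<le> i"
  shows "j \<in> D T \<longleftrightarrow> wdes (g T) j"
proof (cases "j = i")
  case True
  have "length (f T) = i" by (rule chartD(1)[OF f assms(1)])
  moreover from this have "f T \<noteq> []" using i2 by (cases "f T") simp_all
  ultimately show ?thesis using True r_des[OF assms(1)] i2
    by (simp add: g_def wdes_def nth_append last_conv_nth)
next
  case False
  then show ?thesis using chartD(1,3)[OF f assms(1)] assms by (simp add: g_def wdes_append)
qed

lemma g_inj: "T \<in> A \<Longrightarrow> U \<in> deq_class A phi 2 (i - 1) T \<Longrightarrow> V \<in> deq_class A phi 2 (i - 1) T \<Longrightarrow>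
    g U = g V \<Longrightarrow> U = V"
  using inj_onD[OF f_inj] by (simp add: g_def)

lemma g_lift:
  assumes U: "U \<in> A" "g U = u @ z" "length u \<le> i" "u \<noteq> []" and v: "lattice_word v" "mset v = mset u"
  shows "\<exists>y\<in>deq_class A phi 2 (length u - 1) U. g y = v @ z"
proof -
  have n: "1 < (2::nat)" "length u - 1 < n" using U(3,4) i_n by (cases u; simp)+
  have "lattice_word u" using g_lattice[OF U(1)] U(2) lattice_append_iff by simp
  moreover have "g (phi j y) = knuth_move j (g y)"
    if "y \<in> deq_class A phi 2 (length u - 1) U" "2 \<le> j" "j < length u" for y j
    using g_phi[OF class_sub[OF U(1) n that(1)]] that U(3) by simp
  ultimately show ?thesis
    using lift_path[of "length u" U g u z v] lattice_knuth_connected[of u v] U n(2) v by simp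
qed

lemma phi_i_class:
  assumes "T \<in> A" "U \<in> deq_class A phi 2 (i - 3) T"
  shows "phi i U \<in> deq_class A phi 2 (i - 3) (phi i T)"
  using assms(2,1) one_less_i(4,3)
proof (induction rule: class_induct)
  case (step V j)
  then have j: "1 < j" "j < n" "j + 3 \<le> i" using one_less_i by auto
  then have "phi i (phi j V) = phi j (phi i V)" using comm[of i j V] i_n one_less_i step by simp
  then show ?case using class_step[OF step.IH, of j] step by simp
qed simp

text \<open>On a class of \<open>phi 2\<close>, ..., \<open>phi (i - 3)\<close> both
  \<open>y\<close> and \<open>phi i y\<close> provide labellings by the first \<open>i - 2\<close>
  letters, because \<open>phi i\<close> commutes with these involutions and keeps the descents below
  \<open>i - 2\<close>. Rigidity makes the two labellings equal.\<close>

lemma g_phi_i_prefix: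
  assumes T: "T \<in> A"
  shows "take (i - 2) (g (phi i T)) = take (i - 2) (g T)"
proof (cases "i = 2")
  case False
  define m where "m = i - 2"
  have m: "m + 2 = i" "m - 1 = i - 3" "m - 1 < n" "1 \<le> m" using False i2 i_n by (auto simp: m_def)
  have SA: "y \<in> A" if "y \<in> deq_class A phi 2 (m - 1) T" for y
    using class_sub[OF T _ m(3) that] by simp
  have "take m (g T) = take m (g (phi i T))"
  proof (rule chart_unique[of T m "\<lambda>y. take m (g y)" "\<lambda>y. take m (g (phi i y))"])
    fix y assume y: "y \<in> deq_class A phi 2 (m - 1) T"
    show "length (take m (g y)) = m \<and> lattice_word (take m (g y))"
      using g_length[OF SA[OF y]] g_lattice[OF SA[OF y]] m
      by (simp, metis append_take_drop_id lattice_append_iff)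
    show "length (take m (g (phi i y))) = m \<and> lattice_word (take m (g (phi i y)))"
      using g_length[of "phi i y"] g_lattice[of "phi i y"] SA[OF y] m
      by (simp, metis append_take_drop_id lattice_append_iff)
    have tk: "take m (knuth_move j w) = knuth_move j (take m w)" if "j < m" "length w = Suc i" for j w
      using knuth_move_append[of j "take m w" "drop m w"] that m by simp
    fix j :: nat
    show "take m (g (phi j y)) = knuth_move j (take m (g y))" if "2 \<le> j" "j < m"
      using g_phi[OF SA[OF y] that(1)] that m tk[of j "g y"] g_length[OF SA[OF y]] by simp
    show "take m (g (phi i (phi j y))) = knuth_move j (take m (g (phi i y)))" if "2 \<le> j" "j < m"
      using g_phi[of "phi i y" j] that m tk[of j "g (phi i y)"] g_length[of "phi i y"] SA[OF y]
        comm[of i j y] i_n by simp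
    show "wdes (take m (g y)) j = wdes (take m (g (phi i y))) j" if "1 \<le> j" "j < m"
    proof -
      have "wdes (take m w) j = wdes w j" if "length w = Suc i" for w
        using wdes_append[of j "take m w" "drop m w"] that \<open>j < m\<close> m by simp
      then show ?thesis
        using g_des[of y j] g_des[of "phi i y" j] far[of i y j] SA[OF y] that m i_n g_length by simp
    qed
  qed (use T m in auto)
  then show ?thesis by (simp add: m_def)
qed simp

lemma g_phi_i_decomp:
  assumes T: "T \<in> A" "g T = p @ [a, b, c]"
  obtains a' b' c' where "g (phi i T) = p @ [a', b', c']"
proof -
  have l: "length p = i - 2" using g_length[OF T(1)] T(2) by simp
  have "length (drop (i - 2) (g (phi i T))) = 3" using g_length[of "phi i T"] T(1) i2 by simp
  then obtain a' b' c' where "drop (i - 2) (g (phi i T)) = [a', b', c']"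
    by (auto simp: length_Suc_conv numeral_3_eq_3 simp del: length_drop)
  moreover have "take (i - 2) (g (phi i T)) = p" using g_phi_i_prefix[OF T(1)] T(2) l by simp
  ultimately show ?thesis using that by (metis append_take_drop_id)
qed

text \<open>Moves inside the prefix with index at most \<open>i - 3\<close> commute with
  \<open>phi i\<close> and leave the last three letters of both labels alone. So the effect of
  \<open>phi i\<close> depends on the prefix only through its content, and the prefix can be chosen
  to end in letters that bring neighbouring colours into contact with colour
  \<open>i\<close>.\<close>

lemma transport:
  assumes T: "T \<in> A" "g T = p @ [a, b, c]" "g (phi i T) = p @ [a', b', c']"
    and q: "lattice_word q" "mset q = mset p"
  obtains x where "x \<in> A" "x \<in> deq_class A phi 2 (i - 3) T" "g x = q @ [a, b, c]"
    "g (phi i x) = q @ [a', b', c']"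
proof (cases "p = []")
  case True
  then show ?thesis using that[of T] T q by simp
next
  case False
  have l: "length p = i - 2" using g_length[OF T(1)] T(2) by simp
  obtain x where x: "x \<in> deq_class A phi 2 (i - 3) T" "g x = q @ [a, b, c]"
    using g_lift[OF T(1,2) _ False q] l by auto
  have xA: "x \<in> A" using class_sub[OF T(1) one_less_i(4,3) x(1)] .
  have "drop (i - 2) (g (phi i x)) = drop (i - 2) (g (phi i T))"
    using x(1) T(1) one_less_i(4,3)
  proof (induction rule: class_induct)
    case (step V j)
    then have j: "1 < j" "j < n" "j + 3 \<le> i" using one_less_i by auto
    then have "phi i (phi j V) = phi j (phi i V)" using comm[of i j V] i_n one_less_i step by simp
    then show ?case using g_phi[of "phi i V" j] step j drop_knuth_move[of j "i - 2" "g (phi i V)"] by simp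
  qed simp
  moreover have "length q = i - 2" using q l by (metis mset_eq_length)
  ultimately have "g (phi i x) = q @ [a', b', c']"
    using g_phi_i_prefix[OF xA] x(2) T(3) l
    by (metis append_eq_conv_conj append_take_drop_id)
  then show ?thesis using that xA x by blast
qed

lemma des_last:
  assumes "x \<in> A" "g x = w @ [b, c]"
  shows "i \<in> D x \<longleftrightarrow> b < c"
proof -
  have "i = length w + 1" using g_length[OF assms(1)] assms(2) by simp
  then show ?thesis using g_des[OF assms(1), of i] assms(2) by (simp add: wdes_def nth_append)
qed

lemma des_last2:
  assumes "x \<in> A" "g x = w @ [a, b, c]"
  shows "i - 1 \<in> D x \<longleftrightarrow> a < b"
proof -
  have "i = length w + 2" using g_length[OF assms(1)] assms(2) by simp
  then show ?thesis using g_des[OF assms(1), of "i - 1"] assms(2) by (simp add: wdes_def nth_append)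
qed

lemma des_last3:
  assumes "x \<in> A" "g x = w @ [z, a, b, c]"
  shows "i - 2 \<in> D x \<longleftrightarrow> z < a"
proof -
  have "i = length w + 3" using g_length[OF assms(1)] assms(2) by simp
  then show ?thesis using g_des[OF assms(1), of "i - 2"] assms(2) by (simp add: wdes_def nth_append)
qed

lemma g_phi_i1:
  assumes "x \<in> A" "g x = w @ [z, a, b, c]"
  shows "g (phi (i - 1) x) = w @ knuth_triple z a b @ [c]" "phi (i - 1) x \<in> A"
proof -
  have i: "i = length w + 3" using g_length[OF assms(1)] assms(2) by simp
  show "g (phi (i - 1) x) = w @ knuth_triple z a b @ [c]"
    using g_phi[OF assms(1), of "i - 1"] knuth_move_triple[of "i - 1" w z a b "[c]"] i assms(2) by simp
  show "phi (i - 1) x \<in> A" using assms(1) i i_n by simp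
qed

lemma g_phi_i2:
  assumes "x \<in> A" "g x = w @ [y, z, a, b, c]"
  shows "g (phi (i - 2) x) = w @ knuth_triple y z a @ [b, c]" "phi (i - 2) x \<in> A"
proof -
  have i: "i = length w + 4" using g_length[OF assms(1)] assms(2) by simp
  show "g (phi (i - 2) x) = w @ knuth_triple y z a @ [b, c]"
    using g_phi[OF assms(1), of "i - 2"] knuth_move_triple[of "i - 2" w y z a "[b, c]"] i assms(2) by simp
  show "phi (i - 2) x \<in> A" using assms(1) i i_n by simp
qed

lemma phi_i_same_class:
  assumes T: "T \<in> A" "x \<in> deq_class A phi 2 (i - 3) T" "phi i x \<in> deq_class A phi 2 (i - 1) x"
  shows "phi i T \<in> deq_class A phi 2 (i - 1) T"
proof -
  have sub: "deq_class A phi 2 (i - 3) U \<subseteq> deq_class A phi 2 (i - 1) U" for U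
    by (rule class_mono) auto
  have "phi i T \<in> deq_class A phi 2 (i - 3) (phi i x)"
    using class_sym[OF _ one_less_i(4,3) phi_i_class[OF T(1,2)]] T by simp
  moreover have "phi i x \<in> deq_class A phi 2 (i - 1) T"
    using T sub class_trans by (metis subsetD)
  ultimately show ?thesis using sub class_trans by (metis subsetD)
qed

text \<open>If the move exchanges the letters in positions \<open>i - 1\<close> and \<open>i\<close>, a representative whose
  preceding letter lies between them carries a double edge.\<close>

lemma extension_move1:
  assumes T: "T \<in> A" "g T = p @ [a, b, c]" and tr: "a < c \<and> c \<le> b \<or> b < c \<and> c \<le> a"
  shows "g (phi i T) = p @ [b, a, c]" "phi i T \<in> deq_class A phi 2 (i - 1) T"
proof -
  \<comment> \<open>With \<open>h\<close> just below the larger of \<open>a\<close> and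
    \<open>b\<close>, the first letter of \<open>h, a, b\<close> is the middle one, so
    \<open>phi (i - 1)\<close> exchanges \<open>a\<close> and \<open>b\<close>, which is what the
    move at \<open>i\<close> should do.\<close>
  define hi where "hi = max a b"
  have ab: "a < b \<and> a < c \<and> c \<le> b \<or> b < a \<and> b < c \<and> c \<le> a"
    using tr by linarith
  have l: "lattice_word (p @ [a, b, c])" using g_lattice[OF T(1)] T(2) by simp
  then have pp: "part (mset p)" "part (add_mset a (mset p))" "part ({#a, b#} + mset p)"
      "part ({#a, b, c#} + mset p)"
    using lattice_part by (auto simp: lattice_snoc3 lattice_snoc2 lattice_snoc)
  obtain h where h: "hi = Suc h" using ab by (cases hi) (auto simp: hi_def)
  have "count (mset p) (Suc h) < count (mset p) h"
  proof (cases "a < b")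
    case True
    then have "b = Suc h" using h by (simp add: hi_def max_def)
    then show ?thesis using True ab pp(2-4)[unfolded part_def, THEN spec, of h]
      by (cases "a = h"; cases "c = Suc h"; simp)
  next
    case False
    then have "a = Suc h" using h by (simp add: hi_def max_def split: if_splits)
    then show ?thesis using pp(2)[unfolded part_def, THEN spec, of h] by simp
  qed
  then have "part (mset p - {#h#})" "h \<in># mset p"
    using part_removeI[OF pp(1)] by (auto intro!: count_inI simp del: set_mset_mset)
  then obtain q where q: "lattice_word q" "mset q = mset p - {#h#}" using ex_lattice_word by blast
  have mq: "mset (q @ [h]) = mset p" using q \<open>h \<in># mset p\<close> by simp
  have lq: "lattice_word (q @ [h])" using q(1) mq pp(1) by (simp add: lattice_snoc)
  obtain a' b' c' where T': "g (phi i T) = p @ [a', b', c']" using g_phi_i_decomp[OF T] .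
  obtain x where x: "x \<in> A" "x \<in> deq_class A phi 2 (i - 3) T" "g x = (q @ [h]) @ [a, b, c]"
    "g (phi i x) = (q @ [h]) @ [a', b', c']"
    using transport[OF T T' lq mq] by blast
  have gx: "g x = q @ [h, a, b, c]" using x by simp
  define x' where "x' = phi (i - 1) x"
  have x': "x' \<in> A" "g x' = q @ [h, b, a, c]"
  proof -
    have "a < b \<and> b = Suc h \<or> b < a \<and> a = Suc h" using ab h by (auto simp: hi_def max_def split: if_splits)
    then have "knuth_triple h a b = [h, b, a]"
      by (auto intro: knuth_triple_simps)
    then show "x' \<in> A" "g x' = q @ [h, b, a, c]"
      using g_phi_i1[OF x(1) gx] by (simp_all add: x'_def)
  qed
  have i3: "2 < i" using g_length[OF x(1)] gx by simp
  have "phi i x \<noteq> x" using fixed_iff[OF one_less_i(1) i_n x(1)]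
      des_last[of x "q @ [h, a]" b c] des_last2[of x "q @ [h]" a b c] x gx ab by auto
  moreover have "phi (i - 1) x \<noteq> x" using x' gx ab unfolding x'_def by auto
  moreover have "phi i (phi (i - 1) x) \<noteq> phi (i - 1) x"
    using fixed_iff[OF one_less_i(1) i_n x'(1)]
      des_last[of x' "q @ [h, b]" a c] des_last2[of x' "q @ [h]" b a c] x' ab by (auto simp: x'_def)
  \<comment> \<open>Colour \<open>i\<close> is active at both ends of the edge of colour
    \<open>i - 1\<close>, which leaves only a double edge.\<close>
  ultimately have e: "phi i x = x'" using double_up[OF i3 i_n x(1)] by (simp add: x'_def)
  then show "g (phi i T) = p @ [b, a, c]" using x(4) x'(2) T' by simp
  have "phi i x \<in> deq_class A phi 2 (i - 1) x"
    using e class_step[of x A phi 2 "i - 1" x "i - 1"] x(1) i3 by (simp add: x'_def)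
  then show "phi i T \<in> deq_class A phi 2 (i - 1) T" using phi_i_same_class[OF T(1) x(2)] by simp
qed

text \<open>If the move exchanges the letters in positions \<open>i\<close> and \<open>i + 1\<close>, suitable representatives
  lie in components of three consecutive colours with five vertices, which determine the letters.\<close>

lemma extension_move2_first:
  assumes T: "T \<in> A" "g T = p @ [a, b, c]" "c \<le> a" "a < b"
    and T': "g (phi i T) = p @ [a', b', c']" "b' \<le> a'" "a' < c'"
  shows "a = a'"
proof (rule ccontr)
  assume ne: "a \<noteq> a'"
  have l: "lattice_word (p @ [a, b, c])" "lattice_word (p @ [a', b', c'])"
    using g_lattice[OF T(1)] g_lattice[of "phi i T"] T T' by simp_all
  then have pp: "part (mset p)" "part (add_mset a (mset p))" "part (add_mset a' (mset p))"
    using lattice_part by (auto simp: lattice_snoc3 lattice_snoc2 lattice_snoc)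
  \<comment> \<open>This letter is smaller than exactly one of \<open>a\<close> and
    \<open>a'\<close>, so descent \<open>i - 2\<close> distinguishes \<open>x\<close> from
    \<open>phi i x\<close>.\<close>
  define h where "h = max a a' - 1"
  have h: "Suc h = max a a'" using ne by (auto simp: h_def max_def)
  have "count (mset p) (Suc h) < count (mset p) h"
    using pp(2,3)[unfolded part_def, THEN spec, of h] h by (cases "a < a'") (auto simp: max_def)
  then obtain q where q: "lattice_word (q @ [h])" "mset (q @ [h]) = mset p"
    using lattice_ending[OF pp(1)] by blast
  obtain x where x: "x \<in> A" "g x = (q @ [h]) @ [a, b, c]" "g (phi i x) = (q @ [h]) @ [a', b', c']"
    using transport[OF T(1,2) T'(1) q] by blast
  define u where "u = phi i x"
  have gx: "g x = q @ [h, a, b, c]" and gu: "g u = q @ [h, a', b', c']" and uA: "u \<in> A"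
    using x by (simp_all add: u_def)
  have i3: "2 < i" using g_length[OF x(1)] gx by simp
  have Dx: "i - 2 \<in> D x \<longleftrightarrow> h < a" "i - 1 \<in> D x"
    using des_last3[OF x(1) gx] des_last2[of x "q @ [h]" a b c] x(1) gx T by simp_all
  have Du: "i - 2 \<in> D u \<longleftrightarrow> h < a'" "i - 1 \<notin> D u"
    using des_last3[OF uA gu] des_last2[of u "q @ [h]" a' b' c'] uA gu T' by simp_all
  consider "a < a'" | "a' < a" using ne by linarith
  then show False
  proof cases
    case 1
    then have h': "a \<le> h" "h < a'" using h by (simp_all add: max_def)
    have "phi i x \<noteq> x" using Dx Du by (auto simp: u_def)
    moreover have "phi (i - 1) x \<noteq> x"
      using fixed_iff[of "i - 1" x] i3 i_n x(1) Dx h' by (simp add: numeral_2_eq_2)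
    moreover have "phi (i - 1) (phi i x) \<noteq> phi i x"
      using fixed_iff[of "i - 1" u] i3 i_n uA Du h' by (simp add: numeral_2_eq_2 u_def)
    \<comment> \<open>A double edge would keep the last letter, but
      \<open>c \<le> a < a' < c'\<close>.\<close>
    ultimately have "u = phi (i - 1) x" using double_down[OF i3 i_n x(1)] by (simp add: u_def)
    then have "q @ [h, a', b', c'] = q @ knuth_triple h a b @ [c]"
      using g_phi_i1[OF x(1) gx] gu by simp
    then have "c' = c" by (metis append.assoc append_Cons append_Nil last_snoc)
    then show False using T T' 1 by simp
  next
    case 2
    then have h': "h < a" "\<not> h < a'" using h by (simp_all add: max_def)
    then show False using near_down[OF i3 i_n x(1)] Dx Du by (auto simp: u_def)
  qed
qed

text \<open>Prescribing the two letters in front of the last three lets the colours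
  \<open>i - 2\<close>, \<open>i - 1\<close> and \<open>i\<close> interact, so that components of
  three colours become usable.\<close>

lemma two_letter_transport:
  assumes T: "T \<in> A" "g T = p @ [a, b, c]" "c \<le> a" "a < b"
    and T': "g (phi i T) = p @ [a, b', c']" "b' \<le> a" "a < c'"
    and yz: "count (mset p) (Suc z) < count (mset p) z"
      "count (mset p - {#z#}) (Suc y) < count (mset p - {#z#}) y"
  obtains q x u where "x \<in> A" "u \<in> A" "phi i x = u" "phi i u = x" "x \<noteq> u" "3 < i"
    "g x = q @ [y, z, a, b, c]" "g u = q @ [y, z, a, b', c']"
proof -
  have "part (mset p)" using lattice_part g_lattice[OF T(1)] T(2) lattice_append_iff by simp
  then obtain q where q: "lattice_word (q @ [y, z])" "mset (q @ [y, z]) = mset p"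
    using lattice_ending2 yz by blast
  obtain x where x: "x \<in> A" "g x = (q @ [y, z]) @ [a, b, c]" "g (phi i x) = (q @ [y, z]) @ [a, b', c']"
    using transport[OF T(1,2) T'(1) q] by blast
  have "3 < i" using g_length[OF x(1)] x(2) by simp
  moreover have "x \<noteq> phi i x"
  proof
    assume "x = phi i x"
    then have "g x = g (phi i x)" by simp
    then show False using x T T' by simp
  qed
  ultimately show ?thesis using that[of x "phi i x" q] x by simp
qed

lemma same_image:
  assumes "x \<in> A" "3 < i" "g (phi (i - 2) x) = g (phi (i - 1) x)"
  shows "phi (i - 2) x = phi (i - 1) x"
  using g_inj[OF assms(1) class_step class_step, of x "i - 2" x "i - 1"] assms by simp

lemma moved_i:
  assumes "x \<in> A" "g x = w @ [a, b, c]" "(a < b) \<noteq> (b < c)"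
  shows "phi i x \<noteq> x"
  using fixed_iff[OF one_less_i(1) i_n assms(1)] des_last2[OF assms(1,2)]
    des_last[of x "w @ [a]" b c] assms by simp

lemma flip_i:
  assumes "x \<in> A" "phi i x \<noteq> x" "g x = w @ [a, b]" "g (phi i x) = w' @ [a', b']"
  shows "(a < b) \<noteq> (a' < b')"
  using flip[OF one_less_i(1) i_n assms(1,2)] des_last[OF assms(1,3)] des_last[of "phi i x" w' a' b']
    assms by auto

text \<open>Suppose \<open>b \<noteq> c'\<close>. The two letters in front are consecutive, with
  \<open>a \<le> y < z\<close> and \<open>Suc z\<close> the larger of \<open>b\<close> and
  \<open>c'\<close>, so that \<open>phi (i - 2)\<close> exchanges \<open>z\<close> and
  \<open>a\<close>. If \<open>b < c'\<close>, the colours \<open>i - 2\<close> and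
  \<open>i - 1\<close> agree at \<open>x\<close>; the five-vertex component then makes
  \<open>phi (i - 1)\<close> and \<open>phi i\<close> agree at \<open>d\<close>, although the former
  keeps descent \<open>i\<close> there. If \<open>c' < b\<close>, the colours \<open>i - 1\<close>
  and \<open>i\<close> agree at \<open>d\<close>, which forces \<open>phi (i - 2)\<close> and
  \<open>phi (i - 1)\<close> to agree at \<open>x\<close>, where their labels differ.\<close>

lemma extension_move2_up:
  assumes T: "T \<in> A" "g T = p @ [a, b, c]" "c \<le> a" "a < b"
    and T': "g (phi i T) = p @ [a, b', c']" "b' \<le> a" "a < c'"
  shows "b = c'"
proof (rule ccontr)
  assume ne: "b \<noteq> c'"
  have l: "lattice_word (p @ [a, b, c])" "lattice_word (p @ [a, b', c'])"
    using g_lattice[OF T(1)] g_lattice[of "phi i T"] T T' by simp_all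
  then have pp: "part (mset p)" "part ({#a, b#} + mset p)" "part ({#a, b', c'#} + mset p)"
    using lattice_part by (auto simp: lattice_snoc3 lattice_snoc2 lattice_snoc)
  define y where "y = max b c' - 2"
  define z where "z = Suc y"
  have z: "Suc z = max b c'" "a \<le> y" using ne T T' by (auto simp: y_def z_def max_def)
  have c1: "count (mset p) (Suc z) < count (mset p) z"
  proof (cases "b < c'")
    case True
    then have "Suc z = c'" using z by (simp add: max_def)
    then show ?thesis using pp(3)[unfolded part_def, THEN spec, of z] T' z by (simp add: z_def)
  next
    case False
    then have "Suc z = b" using z by (simp add: max_def)
    then show ?thesis using pp(2)[unfolded part_def, THEN spec, of z] T z by (simp add: z_def)
  qed
  moreover have "count (mset p - {#z#}) (Suc y) < count (mset p - {#z#}) y"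
    using c1 pp(1)[unfolded part_def, THEN spec, of y] by (simp add: z_def)
  ultimately obtain q x u where x: "x \<in> A" "g x = q @ [y, z, a, b, c]"
    and u: "u \<in> A" "g u = q @ [y, z, a, b', c']" "phi i x = u" "phi i u = x" "x \<noteq> u" "3 < i"
    using two_letter_transport[OF T T'] by metis
  have yza: "knuth_triple y z a = [y, a, z]" and azb': "knuth_triple a z b' = [a, b', z]"
    using z T' by (auto intro: knuth_triple_simps simp: z_def)
  define d where "d = phi (i - 2) u"
  have gx2: "g (phi (i - 2) x) = q @ [y, a, z, b, c]" using g_phi_i2[OF x] yza by simp
  have gd: "g d = (q @ [y]) @ [a, z, b', c']" "d \<in> A" using g_phi_i2[OF u(1,2)] yza by (simp_all add: d_def)
  have gd1: "g (phi (i - 1) d) = (q @ [y]) @ [a, b', z, c']" "phi (i - 1) d \<in> A"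
    using g_phi_i1[OF gd(2,1)] azb' by simp_all
  have gx1: "g (phi (i - 1) x) = (q @ [y]) @ knuth_triple z a b @ [c]"
    using g_phi_i1[OF x(1), of "q @ [y]"] x(2) by simp
  consider "b < c'" | "c' < b" using ne by linarith
  then show False
  proof cases
    case 1
    then have "knuth_triple z a b = [a, z, b]" "z < c'"
      using z T by (auto intro: knuth_triple_simps simp: max_def)
    then have "g (phi (i - 1) x) = g (phi (i - 2) x)" using gx1 gx2 by simp
    then have "phi (i - 2) x = phi (i - 1) x" using same_image[OF x(1) u(6)] by simp
    moreover have "phi (i - 1) x \<noteq> x"
      using gx1 \<open>knuth_triple z a b = _\<close> x(2) z by (auto simp: z_def)
    ultimately have "phi i d \<noteq> d" "phi (i - 1) d = phi i d"
      using five_up[OF u(6) i_n x(1), of d] u by (auto simp: d_def)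
    then have "(b' < c') \<noteq> (z < c')"
      using flip_i[OF gd(2), of "q @ [y, a, z]" b' c' "q @ [y, a, b']" z c'] gd gd1 by simp
    then show False using \<open>z < c'\<close> T' by simp
  next
    case 2
    then have k: "knuth_triple z a b = [z, b, a]" "c' \<le> z"
      using z T by (auto intro: knuth_triple_simps simp: max_def z_def)
    have "phi i d \<noteq> d" using moved_i[OF gd(2), of "q @ [y, a]" z b' c'] gd T' z by (simp add: z_def)
    moreover have "phi i (phi (i - 1) d) \<noteq> phi (i - 1) d"
      using moved_i[OF gd1(2), of "q @ [y, a]" b' z c'] gd1 T' z k by (simp add: z_def)
    moreover have "phi (i - 1) d \<noteq> d"
    proof
      assume "phi (i - 1) d = d"
      then have "g (phi (i - 1) d) = g d" by simp
      then show False using gd gd1 T' z by (simp add: z_def)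
    qed
    ultimately have e: "phi i d \<noteq> d" "phi (i - 1) d = phi i d" using double_up[of i d] u(6) i_n gd(2) by auto
    moreover have "phi (i - 2) u \<noteq> u"
      using gd u(2) z by (auto simp: d_def z_def)
    ultimately have "phi (i - 2) x = phi (i - 1) x"
      using five_down[OF u(6) i_n u(1), of d] u by (auto simp: d_def)
    then show False using gx1 gx2 k z by (simp add: z_def)
  qed
qed

text \<open>The same argument for the smaller letters \<open>c\<close> and \<open>b'\<close>, with
  \<open>x\<close> and \<open>phi i x\<close> interchanged. Now \<open>z\<close> lies just below the
  larger of these letters and \<open>y\<close> just below \<open>a\<close>; as
  \<open>z \<le> y < a\<close>, again \<open>phi (i - 2)\<close> exchanges \<open>z\<close> and
  \<open>a\<close>.\<close>

lemma extension_move2_down: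
  assumes T: "T \<in> A" "g T = p @ [a, b, c]" "c \<le> a" "a < b"
    and T': "g (phi i T) = p @ [a, b', b]" "b' \<le> a"
  shows "c = b'"
proof (rule ccontr)
  assume ne: "c \<noteq> b'"
  have l: "lattice_word (p @ [a, b, c])" "lattice_word (p @ [a, b', b])"
    using g_lattice[OF T(1)] g_lattice[of "phi i T"] T T' by simp_all
  then have pp: "part (mset p)" "part (add_mset a (mset p))" "part ({#a, b'#} + mset p)"
    "part ({#a, b, c#} + mset p)"
    using lattice_part by (auto simp: lattice_snoc3 lattice_snoc2 lattice_snoc)
  define z where "z = max b' c - 1"
  define y where "y = a - 1"
  have z: "Suc z = max b' c" "z \<le> y" "Suc y = a" using ne T T' by (auto simp: y_def z_def max_def)
  \<comment> \<open>If \<open>z = y\<close>, both prescribed letters are taken from the same row,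
    hence the stronger inequality.\<close>
  have c1: "count (mset p) (Suc z) < count (mset p) z \<and>
    (z = y \<longrightarrow> count (mset p) (Suc z) + 1 < count (mset p) z)"
  proof (cases "c < b'")
    case True
    then have "Suc z = b'" using z by (simp add: max_def)
    then show ?thesis using pp(3)[unfolded part_def, THEN spec, of z] z(2,3)
      by (auto split: if_splits)
  next
    case False
    then have "Suc z = c" using z by (simp add: max_def split: if_splits)
    then show ?thesis using pp(4)[unfolded part_def, THEN spec, of z] z(2,3) T
      by (auto split: if_splits)
  qed
  then have "count (mset p - {#z#}) (Suc y) < count (mset p - {#z#}) y"
    using pp(2)[unfolded part_def, THEN spec, of y] z(2,3) by auto
  then obtain q x u where x: "x \<in> A" "g x = q @ [y, z, a, b, c]"
    and u: "u \<in> A" "g u = q @ [y, z, a, b', b]" "phi i x = u" "phi i u = x" "x \<noteq> u" "3 < i"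
    using two_letter_transport[OF T T' T(4)] c1 by metis
  have yza: "knuth_triple y z a = [y, a, z]" and azb: "knuth_triple a z b = [a, b, z]"
    using z T by (auto intro: knuth_triple_simps)
  define d where "d = phi (i - 2) x"
  have gu2: "g (phi (i - 2) u) = q @ [y, a, z, b', b]" using g_phi_i2[OF u(1,2)] yza by simp
  have gd: "g d = (q @ [y]) @ [a, z, b, c]" "d \<in> A" using g_phi_i2[OF x] yza by (simp_all add: d_def)
  have gd1: "g (phi (i - 1) d) = (q @ [y]) @ [a, b, z, c]" "phi (i - 1) d \<in> A"
    using g_phi_i1[OF gd(2,1)] azb by simp_all
  have gu1: "g (phi (i - 1) u) = (q @ [y]) @ knuth_triple z a b' @ [b]"
    using g_phi_i1[OF u(1), of "q @ [y]"] u(2) by simp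
  consider "c < b'" | "b' < c" using ne by linarith
  then show False
  proof cases
    case 1
    then have zz: "z < b'" "c \<le> z" using z by (auto simp: max_def)
    then have k: "knuth_triple z a b' = [a, z, b']" using T' by (auto intro: knuth_triple_simps)
    then have "g (phi (i - 1) u) = g (phi (i - 2) u)" using gu1 gu2 by simp
    then have "phi (i - 2) u = phi (i - 1) u" using same_image[OF u(1) u(6)] by simp
    moreover have "phi (i - 1) u \<noteq> u"
      using gu1 k u(2) z by auto
    ultimately have "phi i d \<noteq> d" "phi (i - 1) d = phi i d"
      using five_up[OF u(6) i_n u(1), of d] u by (auto simp: d_def)
    then have "(b < c) \<noteq> (z < c)"
      using flip_i[OF gd(2), of "q @ [y, a, z]" b c "q @ [y, a, b]" z c] gd gd1 by simp
    then show False using zz T by simp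
  next
    case 2
    then have zz: "z < c" "b' \<le> z" using z by (auto simp: max_def)
    then have k: "knuth_triple z a b' = [z, b', a]" using z by (auto intro: knuth_triple_simps)
    have "phi i d \<noteq> d" using moved_i[OF gd(2), of "q @ [y, a]" z b c] gd T z by simp
    moreover have "phi i (phi (i - 1) d) \<noteq> phi (i - 1) d"
      using moved_i[OF gd1(2), of "q @ [y, a]" b z c] gd1 T z zz by simp
    moreover have "phi (i - 1) d \<noteq> d"
    proof
      assume "phi (i - 1) d = d"
      then have "g (phi (i - 1) d) = g d" by simp
      then show False using gd gd1 T z by simp
    qed
    ultimately have e: "phi i d \<noteq> d" "phi (i - 1) d = phi i d" using double_up[of i d] u(6) i_n gd(2) by auto
    moreover have "phi (i - 2) x \<noteq> x"
      using gd x(2) z by (auto simp: d_def)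
    ultimately have "phi (i - 2) u = phi (i - 1) u"
      using five_down[OF u(6) i_n x(1), of d] u by (auto simp: d_def)
    then show False using gu1 gu2 k z by simp
  qed
qed

lemma extension_move2:
  assumes T: "T \<in> A" "g T = p @ [a, b, c]" "c \<le> a" "a < b"
    and T': "g (phi i T) = p @ [a', b', c']" "b' \<le> a'" "a' < c'"
  shows "a' = a" "b' = c" "c' = b"
proof -
  show a: "a' = a" using extension_move2_first[OF T T'] by simp
  then show b: "c' = b" using extension_move2_up[OF T] T' by simp
  then show "b' = c" using extension_move2_down[OF T] T' a by simp
qed

theorem g_phi_i:
  assumes T: "T \<in> A"
  shows "g (phi i T) = knuth_move i (g T)"
proof -
  have "i < length (g T)" using g_length[OF T] by simp
  with i2 obtain p a b c q where q: "g T = p @ a # b # c # q" and l: "i = length p + 2"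
    by (rule list3_decomp)
  moreover have "q = []" using q l g_length[OF T] by simp
  ultimately have gT: "g T = p @ [a, b, c]" by simp
  have k: "knuth_move i (p @ [x, y, z]) = p @ knuth_triple x y z" for x y z
    using knuth_move_triple[OF l, of x y z "[]"] by simp
  obtain a' b' c' where gT': "g (phi i T) = p @ [a', b', c']" using g_phi_i_decomp[OF T gT] .
  have T'A: "phi i T \<in> A" using T by simp
  have D: "i - 1 \<in> D T \<longleftrightarrow> a < b" "i \<in> D T \<longleftrightarrow> b < c"
    "i - 1 \<in> D (phi i T) \<longleftrightarrow> a' < b'" "i \<in> D (phi i T) \<longleftrightarrow> b' < c'"
    using des_last2[OF T gT] des_last2[OF T'A gT'] des_last[of T "p @ [a]" b c]
      des_last[of "phi i T" "p @ [a']" b' c'] gT gT' T by simp_all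
  show ?thesis
  proof (cases "(a < b) = (b < c)")
    case True
    then have "phi i T = T" using fixed_iff[OF one_less_i(1) i_n T] D by simp
    then show ?thesis using gT k[of a b c] knuth_triple_simps(1)[OF True] by simp
  next
    case moved: False
    then have "phi i T \<noteq> T" using fixed_iff[OF one_less_i(1) i_n T] D by simp
    then have fl: "(a' < b') \<noteq> (a < b)" "(b' < c') \<noteq> (b < c)"
      using flip[OF one_less_i(1) i_n T] D by blast+
    have inv: "phi i (phi i T) = T" using T by simp
    \<comment> \<open>In the cases 1 and 2 the last of the three letters is the middle one before or
      after \<open>phi i\<close>; in the cases 3 and 4 the first one is the middle letter both
      times.\<close>
    consider (1) "a < c \<and> c \<le> b \<or> b < c \<and> c \<le> a" | (2) "a' < c' \<and> c' \<le> b' \<or> b' < c' \<and> c' \<le> a'"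
      | (3) "c \<le> a" "a < b" "b' \<le> a'" "a' < c'" | (4) "b \<le> a" "a < c" "c' \<le> a'" "a' < b'"
    proof (cases "a < b")
      case True
      then have "c \<le> b" "b' \<le> a'" "b' < c'" using moved fl by simp_all
      then show ?thesis using True that by (cases "c \<le> a"; cases "a' < c'") simp_all
    next
      case False
      then have "b < c" "a' < b'" "c' \<le> b'" using moved fl by simp_all
      then show ?thesis using False that by (cases "c \<le> a"; cases "a' < c'") simp_all
    qed
    then show ?thesis
    proof cases
      case 1
      then have "knuth_triple a b c = [b, a, c]" by (auto intro: knuth_triple_simps)
      then show ?thesis using extension_move1(1)[OF T gT 1] gT k by simp
    next
      case 2
      then have "knuth_triple a' b' c' = [b', a', c']" by (auto intro: knuth_triple_simps)
      then have "g T = knuth_move i (g (phi i T))" using extension_move1(1)[OF T'A gT' 2] gT' k inv by simp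
      then show ?thesis by simp
    next
      case 3
      then have "a' = a" "b' = c" "c' = b" using extension_move2[OF T gT 3(1,2) gT' 3(3,4)] by simp_all
      moreover have "knuth_triple a b c = [a, c, b]" using 3 by (auto intro: knuth_triple_simps)
      ultimately show ?thesis using gT gT' k by simp
    next
      case 4
      then have "a = a'" "b = c'" "c = b'"
        using extension_move2[OF T'A gT' 4(3,4) _ 4(1,2)] gT inv by simp_all
      moreover have "knuth_triple a b c = [a, c, b]" using 4 by (auto intro: knuth_triple_simps)
      ultimately show ?thesis using gT gT' k by simp
    qed
  qed
qed

lemma g_chart: "chart A D phi (Suc i) g"
  unfolding chart_def
proof (intro ballI conjI allI impI)
  fix T j assume T: "T \<in> A"
  show "length (g T) = Suc i" "lattice_word (g T)" using g_length g_lattice T by auto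
  show "j \<in> D T \<longleftrightarrow> wdes (g T) j" if "1 \<le> j \<and> j < Suc i" using g_des[OF T, of j] that by simp
  show "g (phi j T) = knuth_move j (g T)" if "2 \<le> j \<and> j < Suc i"
    using g_phi[OF T, of j] g_phi_i[OF T] that by (cases "j = i") auto
qed

end

section \<open>Axiom 6 and injectivity of the extended labelling\<close>

definition one_edge :: "'a set \<Rightarrow> (nat \<Rightarrow> 'a \<Rightarrow> 'a) \<Rightarrow> nat \<Rightarrow> bool" where
  "one_edge A phi i \<longleftrightarrow> (\<forall>u\<in>A. \<forall>v\<in>deq_class A phi 2 i u. v \<in> deq_class A phi 2 (i - 1) u \<or>
     (\<exists>a\<in>deq_class A phi 2 (i - 1) u. v \<in> deq_class A phi 2 (i - 1) (phi i a)))"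

context chart_extension
begin

lemma class1_refl: "T \<in> deq_class A phi 2 (i - 1) T" by simp

lemma class1_sym: "T \<in> A \<Longrightarrow> U \<in> deq_class A phi 2 (i - 1) T \<Longrightarrow> T \<in> deq_class A phi 2 (i - 1) U"
  using class_sym[OF _ one_less_i(4,2)] .

lemma class1_A: "T \<in> A \<Longrightarrow> U \<in> deq_class A phi 2 (i - 1) T \<Longrightarrow> U \<in> A"
  using class_sub[OF _ one_less_i(4,2)] .

lemma class1_inv:
  assumes "T \<in> A" "U \<in> deq_class A phi 2 (i - 1) T"
  shows "last (g U) = last (g T)" "mset (g U) = mset (g T)"
proof -
  show "last (g U) = last (g T)" using r_const[OF assms] by (simp add: g_def)
  show "mset (g U) = mset (g T)"
    using assms(2,1) one_less_i(4,2)
  proof (induction rule: class_induct)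
    case (step V j)
    then have "2 \<le> j" "j < i" using i2 by auto
    then show ?case using step g_phi[of V j] by simp
  qed simp
qed

lemma g_decomp:
  assumes T: "T \<in> A"
  obtains p a b c where "g T = p @ [a, b, c]" "i = length p + 2"
proof -
  have "i < length (g T)" using g_length[OF T] by simp
  with i2 obtain p a b c q where q: "g T = p @ a # b # c # q" and l: "i = length p + 2"
    by (rule list3_decomp)
  moreover have "q = []" using q l g_length[OF T] by simp
  ultimately show ?thesis using that by simp
qed

text \<open>Exchanging the first two of the last three letters stays in the class, thanks to the
  double edge at a suitable representative. Only an exchange of the last two letters can lead to
  another class.\<close>

lemma phi_i_cases:
  assumes T: "T \<in> A"
  obtains (same) "phi i T \<in> deq_class A phi 2 (i - 1) T"
  | (other) p a c d where "g T = p @ [a, c, d]" "g (phi i T) = p @ [a, d, c]"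
      "c \<le> a \<and> a < d \<or> d \<le> a \<and> a < c"
proof -
  obtain p a c d where gT: "g T = p @ [a, c, d]" and l: "i = length p + 2" using g_decomp[OF T] .
  show ?thesis
  proof (cases rule: knuth_triple_cases[of a c d])
    case 1
    then have "phi i T = T" using g_des[OF T] i2 l gT fixed_iff[OF one_less_i(1) i_n T]
      by (simp add: wdes_def nth_append)
    then show ?thesis using same by simp
  next
    case 2
    then have "knuth_triple a c d = [a, d, c]" by (intro knuth_triple_simps)
    then show ?thesis using other[OF gT] g_phi_i[OF T] gT knuth_move_triple[OF l, of a c d "[]"] 2 by simp
  next
    case 3
    then have "knuth_triple a c d = [a, d, c]" by (intro knuth_triple_simps)
    then show ?thesis using other[OF gT] g_phi_i[OF T] gT knuth_move_triple[OF l, of a c d "[]"] 3 by simp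
  next
    case 4
    then show ?thesis using same extension_move1(2)[OF T gT] by simp
  next
    case 5
    then show ?thesis using same extension_move1(2)[OF T gT] by simp
  qed
qed

lemma phi_i_same_last:
  assumes T: "T \<in> A" and l: "last (g (phi i T)) = last (g T)"
  shows "phi i T \<in> deq_class A phi 2 (i - 1) T"
proof (cases rule: phi_i_cases[OF T])
  case (2 p a c d)
  then have "c = d" using l by simp
  then show ?thesis using 2 by auto
qed

text \<open>Equal labels have equal last letters, so the single edge of colour \<open>i\<close>
  between the two classes keeps the last letter and therefore stays within one class, where
  injectivity is known.\<close>

lemma inj_of_one_edge:
  assumes ax6: "one_edge A phi i" and T: "T \<in> A"
  shows "inj_on g (deq_class A phi 2 i T)"
proof (rule inj_onI)
  fix u v assume uv: "u \<in> deq_class A phi 2 i T" "v \<in> deq_class A phi 2 i T" "g u = g v"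
  have uA: "u \<in> A" using class_sub[OF T one_less_i(4) i_n uv(1)] .
  have "v \<in> deq_class A phi 2 i u" using class_eq[OF T one_less_i(4) i_n uv(1)] uv(2) by simp
  then consider "v \<in> deq_class A phi 2 (i - 1) u"
    | a where "a \<in> deq_class A phi 2 (i - 1) u" "v \<in> deq_class A phi 2 (i - 1) (phi i a)"
    using ax6 uA unfolding one_edge_def by blast
  then show "u = v"
  proof cases
    case 1
    then show ?thesis using g_inj[OF uA _ 1] uv(3) by simp
  next
    case 2
    have aA: "a \<in> A" using class1_A[OF uA 2(1)] .
    have "last (g (phi i a)) = last (g v)" using class1_inv(1)[OF _ 2(2)] aA by simp
    then have "last (g (phi i a)) = last (g a)" using class1_inv(1)[OF uA 2(1)] uv(3) by simp
    then have "phi i a \<in> deq_class A phi 2 (i - 1) a" using phi_i_same_last[OF aA] by simp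
    then have vu: "v \<in> deq_class A phi 2 (i - 1) u" using 2 class_trans by metis
    show ?thesis using g_inj[OF uA _ vu] uv(3) by simp
  qed
qed

text \<open>On words, a single exchange of the last letters at a bridge suffices. Injectivity on the
  large class makes the lifted path end at \<open>v\<close> itself and not just at an element with
  the label of \<open>v\<close>.\<close>

lemma one_edge_of_inj:
  assumes inj: "\<And>T. T \<in> A \<Longrightarrow> inj_on g (deq_class A phi 2 i T)"
  shows "one_edge A phi i"
  unfolding one_edge_def
proof (intro ballI)
  fix u v assume uA: "u \<in> A" and v: "v \<in> deq_class A phi 2 i u"
  have vA: "v \<in> A" using class_sub[OF uA one_less_i(4) i_n v] .
  have sub: "deq_class A phi 2 (i - 1) x \<subseteq> deq_class A phi 2 i x" for x by (rule class_mono) auto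
  have eq: "y = z" if "y \<in> deq_class A phi 2 i u" "z \<in> deq_class A phi 2 i u" "g y = g z" for y z
    using inj_onD[OF inj[OF uA] that(3,1,2)] .
  have msv: "mset (g v) = mset (g u)"
    using v uA one_less_i(4) i_n
  proof (induction rule: class_induct)
    case (step V j)
    then show ?case using chartD(4)[OF g_chart step(1), of j] by simp
  qed simp
  obtain u0 d where u0: "g u = u0 @ [d]" using g_decomp[OF uA] by (metis append.assoc append_Cons append_Nil)
  obtain v0 c where v0: "g v = v0 @ [c]" using g_decomp[OF vA] by (metis append.assoc append_Cons append_Nil)
  have len: "length u0 = i" "length v0 = i" using g_length uA vA u0 v0 by (metis length_append_singleton nat.inject)+
  have ne: "u0 \<noteq> []" "v0 \<noteq> []" using len i2 by auto
  have lat: "lattice_word (u0 @ [d])" "lattice_word (v0 @ [c])" using g_lattice uA vA u0 v0 by metis+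
  have same: "y \<in> deq_class A phi 2 i x \<Longrightarrow> x \<in> deq_class A phi 2 i u \<Longrightarrow> y \<in> deq_class A phi 2 i u" for x y
    using class_trans by metis
  show "v \<in> deq_class A phi 2 (i - 1) u \<or>
     (\<exists>a\<in>deq_class A phi 2 (i - 1) u. v \<in> deq_class A phi 2 (i - 1) (phi i a))"
  proof (cases "c = d")
    case True
    then have "mset v0 = mset u0" using msv u0 v0 by simp
    moreover have "lattice_word v0" using lat by (simp add: lattice_snoc)
    ultimately obtain y where y: "y \<in> deq_class A phi 2 (i - 1) u" "g y = v0 @ [d]"
      using g_lift[OF uA u0 _ ne(1)] len by auto
    then have "y = v" using eq[of y v] v v0 True sub by auto
    then show ?thesis using y by simp
  next
    case False
    have "\<exists>p x. lattice_word (p @ [x, c, d]) \<and> lattice_word (p @ [x, d, c]) \<and>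
       mset (p @ [x, c]) = mset u0 \<and> mset (p @ [x, d]) = mset v0 \<and>
       knuth_move i (p @ [x, c, d]) = p @ [x, d, c]"
    proof (cases "c < d")
      case True
      obtain p where p: "lattice_word (p @ [d - 1, c, d])" "lattice_word (p @ [d - 1, d, c])"
        "mset (p @ [d - 1, c]) = mset u0" "mset (p @ [d - 1, d]) = mset v0"
        using lattice_bridge[OF lat _ True] msv u0 v0 by auto
      have "length p + 2 = i" using arg_cong[OF p(3), of size] len by simp
      then show ?thesis using p knuth_move_bridge[OF True, of p] by blast
    next
      case dc: False
      then have "d < c" using False by simp
      then obtain p where p: "lattice_word (p @ [c - 1, d, c])" "lattice_word (p @ [c - 1, c, d])"
        "mset (p @ [c - 1, d]) = mset v0" "mset (p @ [c - 1, c]) = mset u0"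
        using lattice_bridge[OF lat(2,1)] msv u0 v0 by auto
      have "length p + 2 = i" using arg_cong[OF p(3), of size] len by simp
      then have "knuth_move i (p @ [c - 1, c, d]) = p @ [c - 1, d, c]"
        using knuth_move_bridge[OF \<open>d < c\<close>, of p] by (metis knuth_move_knuth_move)
      then show ?thesis using p by blast
    qed
    then obtain p x where p: "lattice_word (p @ [x, c, d])" "lattice_word (p @ [x, d, c])"
       "mset (p @ [x, c]) = mset u0" "mset (p @ [x, d]) = mset v0"
       "knuth_move i (p @ [x, c, d]) = p @ [x, d, c]" by blast
    have l: "lattice_word (p @ [x, c])" "lattice_word (p @ [x, d])"
      using p(1,2) by (simp_all add: lattice_snoc3)
    obtain a where a: "a \<in> deq_class A phi 2 (i - 1) u" "g a = p @ [x, c, d]"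
      using g_lift[OF uA u0 _ ne(1) l(1) p(3)] len by auto
    obtain b where b: "b \<in> deq_class A phi 2 (i - 1) v" "g b = p @ [x, d, c]"
      using g_lift[OF vA v0 _ ne(2) l(2) p(4)] len by auto
    have aA: "a \<in> A" using class1_A[OF uA a(1)] .
    have "phi i a = b"
    proof (rule eq)
      show "phi i a \<in> deq_class A phi 2 i u"
        using class_step[of a A phi 2 i u i] a(1) aA sub i2 by auto
      show "b \<in> deq_class A phi 2 i u" using same[of b v] v sub b(1) by blast
      show "g (phi i a) = g b" using g_phi_i[OF aA] a b p(5) by simp
    qed
    then show ?thesis using a(1) class1_sym[OF vA b(1)] by blast
  qed
qed

end

section \<open>Walks on six letters\<close>

lemma six_letter_moves:
  "knuth_move 2 [a, b, c, d, e, f] = knuth_triple a b c @ [d, e, f]"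
  "knuth_move 3 [a, b, c, d, e, f] = a # knuth_triple b c d @ [e, f]"
  "knuth_move 4 [a, b, c, d, e, f] = [a, b] @ knuth_triple c d e @ [f]"
  "knuth_move 5 [a, b, c, d, e, f] = [a, b, c] @ knuth_triple d e f"
  using knuth_move_triple[of 2 "[]" a b c "[d, e, f]"] knuth_move_triple[of 3 "[a]" b c d "[e, f]"]
    knuth_move_triple[of 4 "[a, b]" c d e "[f]"] knuth_move_triple[of 5 "[a, b, c]" d e f "[]"] by simp_all

lemma fold_knuth_move_prepend:
  assumes "\<forall>j\<in>set J. 2 \<le> j"
  shows "fold knuth_move (map ((+) (length p)) J) (p @ w) = p @ fold knuth_move J w"
  using assms by (induction J arbitrary: w) (simp_all add: knuth_move_prepend)

lemma fold_knuth_move_rev: "fold knuth_move (rev J) (fold knuth_move J w) = w"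
  by (induction J arbitrary: w) simp_all

text \<open>For three removable corners in rows \<open>r < s < t\<close>, six suitable last letters admit a closed walk
  through the three possible last letters that uses each of the three kinds of last exchange once.\<close>

definition tri_word :: "nat \<Rightarrow> nat \<Rightarrow> nat \<Rightarrow> nat \<Rightarrow> nat \<Rightarrow> nat list" where
  "tri_word r s t c d =
    (if t \<notin> {c, d} then [t - 2, t - 1, t, s - 1, c, d]
     else if r \<notin> {c, d} then [t - 2, s - 1, r, t - 1, c, d]
     else [t - 2, s - 1, t - 1, s, c, d])"

text \<open>The fourth letter is the witness: \<open>s - 1\<close> for the pair \<open>r\<close>,
  \<open>s\<close>, \<open>t - 1\<close> for the pair \<open>s\<close>, \<open>t\<close>, and
  \<open>s\<close> for the pair \<open>r\<close>, \<open>t\<close>. It is at least the smaller and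
  less than the larger of the exchanged letters.\<close>

lemma tri_word_swap:
  assumes "r < s" "s < t" "c \<in> {r, s, t}" "d \<in> {r, s, t}" "c \<noteq> d"
  shows "knuth_move 5 (tri_word r s t c d) = tri_word r s t d c"
proof -
  have "knuth_triple (s - 1) r s = [s - 1, s, r]" "knuth_triple (s - 1) s r = [s - 1, r, s]"
    "knuth_triple (t - 1) s t = [t - 1, t, s]" "knuth_triple (t - 1) t s = [t - 1, s, t]"
    "knuth_triple s r t = [s, t, r]" "knuth_triple s t r = [s, r, t]"
    by (rule knuth_triple_simps; use assms(1,2) in linarith)+
  then show ?thesis using assms by (auto simp: tri_word_def six_letter_moves)
qed

lemma tri_word_last:
  assumes "r < s" "s < t" "c \<in> {r, s, t}" "d \<in> {r, s, t}" "c \<noteq> d"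
  shows "\<exists>w a. tri_word r s t c d = w @ [a, c, d] \<and> (c \<le> a \<and> a < d \<or> d \<le> a \<and> a < c)"
proof -
  have "tri_word r s t c d = take 3 (tri_word r s t c d) @ [tri_word r s t c d ! 3, c, d]"
    by (simp add: tri_word_def)
  moreover have "c \<le> tri_word r s t c d ! 3 \<and> tri_word r s t c d ! 3 < d \<or>
      d \<le> tri_word r s t c d ! 3 \<and> tri_word r s t c d ! 3 < c"
  proof -
    have "c = r \<and> d = s \<or> c = s \<and> d = r \<or> c = r \<and> d = t \<or> c = t \<and> d = r \<or> c = s \<and> d = t \<or> c = t \<and> d = s"
      using assms(3-5) by blast
    then show ?thesis
      by (elim disjE conjE; use assms(1,2) in \<open>simp add: tri_word_def; (arith)?\<close>)
  qed
  ultimately show ?thesis by blast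
qed

text \<open>Moves with index 2 to 4 act on the first five letters and keep the last one. For each of
  the three last letters an explicit list of moves replaces one of the other two corners in front of
  it by the third; the reversed list goes back.\<close>

lemma tri_word_connected:
  assumes rst: "r < s" "s < t" and cdf: "c \<in> {r, s, t}" "d \<in> {r, s, t}" "f \<in> {r, s, t}" "c \<noteq> d" "c \<noteq> f" "d \<noteq> f"
  shows "\<exists>J. set J \<subseteq> {2..4} \<and> fold knuth_move J (tri_word r s t c d) = tri_word r s t f d"
proof -
  note k = six_letter_moves
  have a: "knuth_triple (t - 1) t (s - 1) = [t - 1, s - 1, t]"
    "knuth_triple (t - 2) (t - 1) (s - 1) = [t - 2, s - 1, t - 1]"
    "knuth_triple (t - 2) (s - 1) (t - 1) = [t - 2, t - 1, s - 1]"
    "knuth_triple (t - 1) t r = [t - 1, r, t]"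
    "knuth_triple (s - 1) (t - 1) r = [s - 1, r, t - 1]"
    "knuth_triple (t - 1) t s = [t - 1, s, t]"
    "knuth_triple (s - 1) r (t - 1) = [s - 1, t - 1, r]"
    "knuth_triple (s - 1) r s = [s - 1, s, r]"
    by (rule knuth_triple_simps; use rst in linarith)+
  have 1: "fold knuth_move [3, 2, 4, 3] (tri_word r s t r s) = tri_word r s t t s"
    using rst a by (simp add: tri_word_def k)
  have 2: "fold knuth_move [3, 2, 4] (tri_word r s t s r) = tri_word r s t t r"
    using rst a by (simp add: tri_word_def k)
  have 3: "fold knuth_move [3, 2, 4, 2] (tri_word r s t s t) = tri_word r s t r t"
    using rst a by (simp add: tri_word_def k)
  have rev: "fold knuth_move (rev J) w' = w" if "fold knuth_move J w = w'" for J w w'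
    using that fold_knuth_move_rev by blast
  have J: "set J \<subseteq> {2..4}" "set (rev J) \<subseteq> {2..4}" if "J \<in> {[3, 2, 4, 3], [3, 2, 4], [3, 2, 4, 2]}"
    for J :: "nat list" using that by auto
  have "d = r \<and> c = s \<and> f = t \<or> d = r \<and> c = t \<and> f = s \<or> d = s \<and> c = r \<and> f = t \<or>
      d = s \<and> c = t \<and> f = r \<or> d = t \<and> c = r \<and> f = s \<or> d = t \<and> c = s \<and> f = r"
    using cdf rst by force
  then show ?thesis
    using 1 2 3 rev[OF 1] rev[OF 2] rev[OF 3] J by (elim disjE conjE; hypsubst; meson insertI1 insertI2)
qed

text \<open>Here \<open>M\<close> is the content without the three corners. Its rows
  \<open>s - 1\<close> and \<open>t - 1\<close> exceed the rows \<open>s\<close> and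
  \<open>t\<close>, so each can lose a cell, and afterwards row \<open>t - 2\<close> can lose one
  too. Putting the cells back in the order of the word meets partitions only.\<close>

lemma tri_word_lattice:
  assumes rst: "r < s" "s < t"
    and parts: "part ({#r, s, t#} + M)" "part ({#r, s#} + M)" "part ({#r, t#} + M)" "part ({#s, t#} + M)"
  obtains p where "lattice_word (p @ tri_word r s t r t)"
    "mset (p @ tri_word r s t r t) = {#r, s, t#} + M"
proof -
  have s1: "part (add_mset s M)" "part (add_mset r M)" "part (add_mset t M)"
    using part_remove_pair[of r "add_mset s M" t] part_remove_pair[of s "add_mset r M" t]
      part_remove_pair[of r "add_mset t M" s] parts rst by (simp_all add: add_mset_commute)
  then have pM: "part M" using part_remove_pair[of s M r] rst by simp
  have cs: "count M s < count M (s - 1)" and ct: "count M t < count M (t - 1)"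
    using s1 part_add[OF pM] rst by auto
  have pb: "part (M - {#t - 1#})" using part_removeI[OF pM, of "t - 1"] ct rst by simp
  have ca: "count (M - {#t - 1#}) (Suc (s - 1)) < count (M - {#t - 1#}) (s - 1)"
    using cs rst by auto
  have pa: "part (M - {#t - 1#} - {#s - 1#})" using part_removeI[OF pb ca] .
  define R where "R = M - {#t - 1#} - {#s - 1#}"
  have RM: "{#s - 1, t - 1#} + R = M"
  proof -
    have "t - 1 \<in># M" using ct by (metis count_inI not_less0)
    moreover have "s - 1 \<in># M - {#t - 1#}" using ca by (metis count_inI not_less0)
    ultimately show ?thesis unfolding R_def
      by (metis add_mset_add_single insert_DiffM union_commute union_mset_add_mset_left)
  qed
  have "count R (Suc (t - 2)) < count R (t - 2)"
  proof -
    have e: "Suc (t - 2) = t - 1" using rst by simp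
    have "count M (t - 1) \<le> count M (t - 2)" using part_count_le[OF pM, of "t - 2" "t - 1"] by simp
    moreover have "count R (t - 1) = count M (t - 1) - 1"
      "count R (t - 2) = count M (t - 2) - (if s - 1 = t - 2 then 1 else 0)"
      using rst by (simp_all add: R_def)
    moreover have "s - 1 = t - 2 \<longrightarrow> s = t - 1" using rst by linarith
    ultimately show ?thesis using cs ct unfolding e by (cases "s - 1 = t - 2") (simp; linarith)+
  qed
  then obtain p where p: "lattice_word (p @ [t - 2])" "mset (p @ [t - 2]) = R"
    using lattice_ending[OF pa[folded R_def]] by blast
  have "part (add_mset (s - 1) R)"
    using pb ca RM unfolding R_def by (metis Diff_eq_empty_iff_mset add_mset_remove_trivial_If
        count_inI insert_DiffM not_less0)
  then have "lattice_word ((p @ [t - 2]) @ [s - 1])" using p by (simp only: lattice_snoc)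
  then have "lattice_word (((p @ [t - 2]) @ [s - 1]) @ [t - 1])"
    using p pM RM by (simp only: lattice_snoc) (simp add: add_mset_commute)
  then have "lattice_word ((((p @ [t - 2]) @ [s - 1]) @ [t - 1]) @ [s])"
    using p(2) s1(1) RM by (simp only: lattice_snoc) (simp add: add_mset_commute)
  moreover have ms: "mset (p @ [t - 2, s - 1, t - 1, s]) = add_mset s M"
    using p(2) RM by (simp add: add_mset_commute)
  ultimately have l4: "lattice_word (p @ [t - 2, s - 1, t - 1, s])" by simp
  then have "lattice_word ((p @ [t - 2, s - 1, t - 1, s]) @ [r])"
    using ms parts(2) by (simp only: lattice_snoc) (simp add: add_mset_commute)
  moreover have "part ({#r, t#} + mset (p @ [t - 2, s - 1, t - 1, s]))"
    using ms parts(1) by (simp add: add_mset_commute)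
  ultimately have "lattice_word ((p @ [t - 2, s - 1, t - 1, s]) @ [r, t])"
    using lattice_snoc2 by blast
  moreover have "tri_word r s t r t = [t - 2, s - 1, t - 1, s, r, t]" using rst by (simp add: tri_word_def)
  moreover have "mset ((p @ [t - 2, s - 1, t - 1, s]) @ [r, t]) = {#r, s, t#} + M"
    using ms by (simp add: add_mset_commute)
  ultimately show ?thesis using that[of p] by simp
qed

section \<open>Axiom 6 from injectivity on classes of degree six\<close>

context chart_extension
begin

lemma class_chain:
  "T \<in> A \<Longrightarrow> U \<in> deq_class A phi 2 (i - 1) T \<Longrightarrow> V \<in> deq_class A phi 2 (i - 1) T \<Longrightarrow>
    V \<in> deq_class A phi 2 (i - 1) U"
  using class1_sym class_trans by metis

text \<open>Two elements of one class with the same last three letters are connected by involutions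
  with index at most \<open>i - 3\<close>, and these commute with \<open>phi i\<close>.\<close>

lemma phi_i_same_triple:
  assumes T: "T \<in> A" "S \<in> deq_class A phi 2 (i - 1) T" "g T = p @ [a, c, d]" "g S = q @ [a, c, d]"
  shows "phi i S \<in> deq_class A phi 2 (i - 1) (phi i T)"
proof -
  have SA: "S \<in> A" using class1_A[OF T(1,2)] .
  have "mset q = mset p" using class1_inv(2)[OF T(1,2)] T(3,4) by simp
  moreover have "lattice_word q" using g_lattice[OF SA] T(4) lattice_append_iff by simp
  moreover obtain a' b' c' where "g (phi i T) = p @ [a', b', c']" using g_phi_i_decomp[OF T(1,3)] .
  ultimately obtain x where x: "x \<in> deq_class A phi 2 (i - 3) T" "g x = q @ [a, c, d]"
    using transport[OF T(1,3)] by metis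
  have sub: "deq_class A phi 2 (i - 3) U \<subseteq> deq_class A phi 2 (i - 1) U" for U
    by (rule class_mono) auto
  have "x = S" using g_inj[OF T(1) _ T(2)] x sub T(4) by auto
  then show ?thesis using phi_i_class[OF T(1) x(1)] sub by blast
qed

lemma fold_phi:
  assumes "x \<in> A" "set J \<subseteq> {lo..hi}" "2 \<le> lo" "hi \<le> i"
  shows "fold phi J x \<in> A" "fold phi J x \<in> deq_class A phi lo hi x" "g (fold phi J x) = fold knuth_move J (g x)"
proof -
  have "fold phi J x \<in> A \<and> fold phi J x \<in> deq_class A phi lo hi x \<and> g (fold phi J x) = fold knuth_move J (g x)"
    using assms
  proof (induction J arbitrary: x)
    case (Cons j J)
    then have j: "1 < j" "j < n" "2 \<le> j" "j < Suc i" "lo \<le> j" "j \<le> hi" using i_n by auto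
    then have "phi j x \<in> A" "phi j x \<in> deq_class A phi lo hi x"
      using Cons(2) class_step[of x A phi lo hi x j] by simp_all
    then show ?case
      using Cons(1)[of "phi j x"] Cons(3-) class_trans chartD(4)[OF g_chart Cons(2) j(3,4)]
      by (metis fold_simps(2) list.set_intros(2) subsetD subsetI)
  qed simp
  then show "fold phi J x \<in> A" "fold phi J x \<in> deq_class A phi lo hi x"
    "g (fold phi J x) = fold knuth_move J (g x)" by blast+
qed

end

text \<open>The classes of \<open>phi (i - 3)\<close>, ..., \<open>phi i\<close> have degree 6, the
  largest degree about which the Schur condition speaks.\<close>

locale windowed_extension = chart_extension +
  assumes i6: "6 \<le> i"
    and window_inj: "T \<in> A \<Longrightarrow> inj_on g (deq_class A phi (i - 3) i T)"
begin

lemma window_eq: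
  assumes "T \<in> A" "U \<in> deq_class A phi (i - 3) i T" "V \<in> deq_class A phi (i - 3) i T" "g U = g V"
  shows "U = V"
  using inj_onD[OF window_inj[OF assms(1)] assms(4,2,3)] .

text \<open>The class reached by exchanging \<open>c\<close> and \<open>d\<close> is independent of
  the witness letter. In a representative ending in \<open>h, e, a, c, d\<close>, with
  \<open>h\<close> between the witnesses \<open>e\<close> and \<open>a\<close>, the involution
  \<open>phi (i - 2)\<close> exchanges the witnesses. On labels this commutes with
  \<open>phi i\<close>, and since the two results lie in one class of degree 6, they are
  equal.\<close>

lemma phi_i_same_pair:
  assumes T: "T \<in> A" "S \<in> deq_class A phi 2 (i - 1) T" "g T = p @ [a, c, d]" "g S = q @ [e, c, d]"
    and mv: "c \<le> a \<and> a < d \<or> d \<le> a \<and> a < c" "c \<le> e \<and> e < d \<or> d \<le> e \<and> e < c"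
  shows "phi i S \<in> deq_class A phi 2 (i - 1) (phi i T)"
proof (cases "a = e")
  case True
  then show ?thesis using phi_i_same_triple T by simp
next
  case ae: False
  have SA: "S \<in> A" using class1_A[OF T(1,2)] .
  define R where "R = mset p - {#e#}"
  have pq: "add_mset a (mset p) = add_mset e (mset q)" using class1_inv(2)[OF T(1,2)] T(3,4) by simp
  then have "e \<in># mset p" using ae by (metis insert_noteq_member)
  then have R: "mset p = add_mset e R" by (simp add: R_def)
  then have R: "mset p = add_mset e R" "mset q = add_mset a R"
    using pq by simp_all
  have "lattice_word (p @ [a, c, d])" "lattice_word (q @ [e, c, d])"
    using g_lattice[OF T(1)] g_lattice[OF SA] T(3,4) by simp_all
  then have pp: "part (add_mset e R)" "part (add_mset a R)" "part (add_mset a (add_mset e R))"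
    "part (add_mset c (add_mset a (add_mset e R)))"
    using lattice_part[of p] lattice_part[of q] R
    by (auto simp: lattice_snoc3 lattice_snoc2 lattice_snoc add_mset_commute)
  then have pR: "part R" using part_remove_pair ae by blast
  define h where "h = max a e - 1"
  have h: "Suc h = max a e" using ae by (auto simp: h_def max_def)
  have "count R (Suc h) < count R h"
    using pp(1,2)[unfolded part_def, THEN spec, of h] h by (cases "a < e") (auto simp: max_def split: if_splits)
  then obtain p0 where p0: "lattice_word (p0 @ [h])" "mset (p0 @ [h]) = R"
    using lattice_ending[OF pR] by blast
  have l1: "lattice_word ((p0 @ [h]) @ [e])"
    using p0 pp(1) by (simp only: lattice_snoc)
  have l2: "lattice_word (((p0 @ [h]) @ [e]) @ [a])"
    using l1 p0(2)[symmetric] pp(3) by (simp only: lattice_snoc) (simp add: add_mset_commute)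
  have "lattice_word ((((p0 @ [h]) @ [e]) @ [a]) @ [c])"
    using l2 p0(2)[symmetric] pp(4) by (simp only: lattice_snoc) (simp add: add_mset_commute)
  then have W: "lattice_word (p0 @ [h, e, a, c])" by simp
  have mW: "mset (p0 @ [h, e, a, c]) = mset (p @ [a, c])"
    using p0(2)[symmetric] R(1) by (simp add: add_mset_commute)
  have lp: "length p + 2 = i" using g_length[OF T(1)] T(3) by simp
  have gT: "g T = (p @ [a, c]) @ [d]" using T(3) by simp
  have "\<exists>y\<in>deq_class A phi 2 (i - 1) T. g y = (p0 @ [h, e, a, c]) @ [d]"
    using g_lift[OF T(1) gT _ _ W mW] lp by (auto simp flip: lp)
  then obtain T0 where T0: "T0 \<in> deq_class A phi 2 (i - 1) T" "g T0 = p0 @ [h, e, a, c, d]" by auto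
  have T0A: "T0 \<in> A" using class1_A[OF T(1) T0(1)] .
  have lp0: "i = length p0 + 4" using g_length[OF T0A] T0(2) by simp
  have kh: "knuth_triple h e a = [h, a, e]"
  proof (cases "a < e")
    case True
    then show ?thesis using h by (intro knuth_triple_simps(3)) (auto simp: max_def)
  next
    case False
    then show ?thesis using h ae by (intro knuth_triple_simps(2)) (auto simp: max_def)
  qed
  define T1 where "T1 = phi (i - 2) T0"
  have gT1: "g T1 = p0 @ [h, a, e, c, d]" and T1A: "T1 \<in> A"
    using g_phi_i2[OF T0A T0(2)] kh by (simp_all add: T1_def)
  have T1T: "T1 \<in> deq_class A phi 2 (i - 1) T"
    using class_step[OF T0(1) T0A, of "i - 2"] lp0 by (simp add: T1_def)
  have kc: "knuth_triple a c d = [a, d, c]" "knuth_triple e c d = [e, d, c]"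
    using mv by (auto intro: knuth_triple_simps)
  have g0: "g (phi i T0) = p0 @ [h, e, a, d, c]" and g1: "g (phi i T1) = p0 @ [h, a, e, d, c]"
    using g_phi_i[OF T0A] g_phi_i[OF T1A] T0(2) gT1 kc knuth_move_triple[of i "p0 @ [h, e]" a c d "[]"]
      knuth_move_triple[of i "p0 @ [h, a]" e c d "[]"] lp0 by simp_all
  have "g (phi (i - 2) (phi i T0)) = g (phi i T1)"
    using g_phi_i2[OF _ g0] T0A kh g1 by simp
  moreover have "phi (i - 2) (phi i T0) \<in> deq_class A phi (i - 3) i T0"
    "phi i T1 \<in> deq_class A phi (i - 3) i T0"
    unfolding T1_def using T0A lp0 i_n by (auto intro!: class_step)
  ultimately have e1: "phi i T1 = phi (i - 2) (phi i T0)" using window_eq[OF T0A] by metis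
  have "phi i T0 \<in> deq_class A phi 2 (i - 1) (phi i T)"
    using phi_i_same_triple[OF T(1) T0(1) T(3), of "p0 @ [h, e]"] T0(2) by simp
  then have t1: "phi i T1 \<in> deq_class A phi 2 (i - 1) (phi i T)"
    unfolding e1 using class_step[OF _ phi_i_A[OF T0A], of phi 2 "i - 1" "phi i T" "i - 2"] lp0 by simp
  have "S \<in> deq_class A phi 2 (i - 1) T1" using class_chain[OF T(1) T1T T(2)] .
  then have "phi i S \<in> deq_class A phi 2 (i - 1) (phi i T1)"
    using phi_i_same_triple[OF T1A, of S "p0 @ [h, a]" e c d q] gT1 T(4) by simp
  then show ?thesis using t1 class_trans by metis
qed

text \<open>Exchanging \<open>d\<close> with \<open>c\<close> and with \<open>e\<close> leads from
  one class to two others, and these have to be joined by an edge. The last two letters run through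
  \<open>c d\<close>, \<open>d c\<close>, \<open>e c\<close>, \<open>c e\<close>,
  \<open>d e\<close>, \<open>e d\<close>: alternately \<open>phi i\<close> exchanges them and a walk
  replaces the first of them. A direct walk from \<open>c d\<close> to \<open>e d\<close> ends at
  the same label. All of this takes place in one class of degree 6, so injectivity closes the
  walk.\<close>

lemma triangle:
  assumes v1: "v1 \<in> A" "g v1 = p1 @ [a1, c, d]" "c \<le> a1 \<and> a1 < d \<or> d \<le> a1 \<and> a1 < c"
    and v: "v \<in> deq_class A phi 2 (i - 1) v1" "g v = p2 @ [a2, e, d]" "e \<le> a2 \<and> a2 < d \<or> d \<le> a2 \<and> a2 < e"
    and cf: "c \<noteq> e"
  shows "\<exists>a\<in>deq_class A phi 2 (i - 1) (phi i v1). phi i v \<in> deq_class A phi 2 (i - 1) (phi i a)"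
proof -
  have vA: "v \<in> A" using class1_A[OF v1(1) v(1)] .
  define M where "M = add_mset a2 (mset p2) - {#c#}"
  have pq: "add_mset c (add_mset a1 (mset p1)) = add_mset e (add_mset a2 (mset p2))"
    using class1_inv(2)[OF v1(1) v(1)] v1(2) v(2) by simp
  then have "c \<in># add_mset a2 (mset p2)" using cf by (metis insert_noteq_member)
  then have M2: "add_mset a2 (mset p2) = add_mset c M" by (simp add: M_def)
  then have M1: "add_mset a1 (mset p1) = add_mset e M" using pq by (metis add_mset_add_mset_same_iff add_mset_commute)
  have lv1: "lattice_word (p1 @ [a1, c, d])" "lattice_word (p1 @ [a1, d, c])"
    using g_lattice[OF v1(1)] lattice_knuth_move[of "p1 @ [a1, c, d]" "length p1 + 2"] v1(2,3)
      knuth_move_triple[of _ p1 a1 c d "[]"] knuth_triple_simps[of _ a1] by auto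
  have lv: "lattice_word (p2 @ [a2, e, d])" "lattice_word (p2 @ [a2, d, e])"
    using g_lattice[OF vA] lattice_knuth_move[of "p2 @ [a2, e, d]" "length p2 + 2"] v(2,3)
      knuth_move_triple[of _ p2 a2 e d "[]"] knuth_triple_simps[of _ a2] by auto
  have parts: "part ({#c, d, e#} + M)" "part ({#c, e#} + M)" "part ({#d, e#} + M)" "part ({#c, d#} + M)"
  proof -
    have "part ({#a1, c, d#} + mset p1)" "part ({#a1, c#} + mset p1)" "part ({#a1, d#} + mset p1)"
      "part ({#a2, d#} + mset p2)"
      using lv1 lv by (simp_all add: lattice_snoc3 lattice_snoc2)
    moreover have "{#a1, c, d#} + mset p1 = {#c, d#} + add_mset a1 (mset p1)"
      "{#a1, c#} + mset p1 = {#c#} + add_mset a1 (mset p1)"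
      "{#a1, d#} + mset p1 = {#d#} + add_mset a1 (mset p1)"
      "{#a2, d#} + mset p2 = {#d#} + add_mset a2 (mset p2)"
      by (simp_all add: add_mset_commute)
    ultimately have "part ({#c, d#} + add_mset e M)" "part ({#c#} + add_mset e M)"
      "part ({#d#} + add_mset e M)" "part ({#d#} + add_mset c M)"
      unfolding M1 M2 by metis+
    then show "part ({#c, d, e#} + M)" "part ({#c, e#} + M)" "part ({#d, e#} + M)" "part ({#c, d#} + M)"
      by (simp_all add: add_mset_commute)
  qed
  have cd: "c \<noteq> d" and fd: "d \<noteq> e" using v1(3) v(3) by auto
  obtain r s t where rst: "r < s" "s < t" and set: "{#r, s, t#} = {#c, d, e#}"
  proof -
    have "sorted (sort [c, d, e])" "distinct (sort [c, d, e])" "length (sort [c, d, e]) = 3"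
      using cd fd cf by auto
    moreover have "\<exists>r s t. l = [r, s, t]" if "length l = 3" for l :: "nat list"
      using that by (auto simp: length_Suc_conv numeral_3_eq_3)
    ultimately obtain r s t where *: "sort [c, d, e] = [r, s, t]" by blast
    then have "r < s" "s < t" using \<open>sorted (sort [c, d, e])\<close> \<open>distinct (sort [c, d, e])\<close> by auto
    moreover have "mset [r, s, t] = mset [c, d, e]" unfolding *[symmetric] by (rule mset_sort)
    then have "{#r, s, t#} = {#c, d, e#}" by simp
    ultimately show ?thesis using that by blast
  qed
  have mem: "c \<in> {r, s, t}" "d \<in> {r, s, t}" "e \<in> {r, s, t}"
    using arg_cong[OF set, of set_mset] by auto
  have "(r = c \<or> r = d \<or> r = e) \<and> (s = c \<or> s = d \<or> s = e) \<and> (t = c \<or> t = d \<or> t = e)"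
    using arg_cong[OF set, of set_mset] by auto
  then have parts': "part ({#r, s#} + M)" "part ({#r, t#} + M)" "part ({#s, t#} + M)"
    using parts(2-4) rst by (auto simp: add_mset_commute)
  obtain p where p: "lattice_word (p @ tri_word r s t r t)"
    "mset (p @ tri_word r s t r t) = {#r, s, t#} + M"
    using tri_word_lattice[OF rst _ parts'] parts(1) set by auto
  let ?N = "\<lambda>c d. p @ tri_word r s t c d"
  have len6: "length (tri_word r s t x y) = 6" for x y by (simp add: tri_word_def)
  have "size (mset (?N r t)) = Suc i"
    unfolding p(2) set using g_length[OF v1(1)] v1(2) arg_cong[OF M1, of size] by simp
  then have ip: "i = length p + 5" using len6 by simp
  have swap: "knuth_move i (?N x y) = ?N y x" if "x \<in> {r, s, t}" "y \<in> {r, s, t}" "x \<noteq> y" for x y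
    using tri_word_swap[OF rst that] knuth_move_prepend[of 5 p] ip by simp
  have walk: "\<exists>U. U \<in> A \<and> U \<in> deq_class A phi (i - 3) (i - 1) T \<and> g U = ?N z y"
    if xyz: "T \<in> A" "g T = ?N x y" "x \<in> {r, s, t}" "y \<in> {r, s, t}" "z \<in> {r, s, t}" "x \<noteq> y" "x \<noteq> z" "y \<noteq> z"
    for T x y z
  proof -
    obtain J where J: "set J \<subseteq> {2..4}" "fold knuth_move J (tri_word r s t x y) = tri_word r s t z y"
      using tri_word_connected[OF rst xyz(3-8)] by blast
    let ?J = "map ((+) (length p)) J"
    have "set ?J \<subseteq> {i - 3..i - 1}" using J(1) ip by auto
    moreover have "fold knuth_move ?J (?N x y) = ?N z y" using fold_knuth_move_prepend[of J p] J by (simp add: subset_iff)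
    ultimately show ?thesis using fold_phi[OF xyz(1), of ?J "i - 3" "i - 1"] xyz(2) ip by auto
  qed
  have w1: "deq_class A phi (i - 3) (i - 1) x \<subseteq> deq_class A phi 2 (i - 1) x"
    and w2: "deq_class A phi (i - 3) (i - 1) x \<subseteq> deq_class A phi (i - 3) i x" for x
    by (rule class_mono; use ip in simp)+
  \<comment> \<open>Being lattice with the right content is known for the pair \<open>r\<close>,
    \<open>t\<close>; exchanges and walks carry it to the other pairs.\<close>
  define P where "P w \<longleftrightarrow> lattice_word w \<and> mset w = {#r, s, t#} + M" for w
  have P_knuth_move: "P w \<Longrightarrow> P (knuth_move j w)" for w j using lattice_knuth_move by (simp add: P_def)
  then have P_fold: "P w \<Longrightarrow> P (fold knuth_move J w)" for w J by (induction J arbitrary: w) simp_all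
  have Pswap: "P (?N x y) \<Longrightarrow> P (?N y x)" if "x \<in> {r, s, t}" "y \<in> {r, s, t}" "x \<noteq> y" for x y
    using swap[OF that] P_knuth_move by metis
  have Pwalk: "P (?N x y) \<Longrightarrow> P (?N z y)"
    if xyz: "x \<in> {r, s, t}" "y \<in> {r, s, t}" "z \<in> {r, s, t}" "x \<noteq> y" "x \<noteq> z" "y \<noteq> z" for x y z
  proof -
    assume Pxy: "P (?N x y)"
    obtain J where J: "set J \<subseteq> {2..4}" "fold knuth_move J (tri_word r s t x y) = tri_word r s t z y"
      using tri_word_connected[OF rst xyz] by blast
    have "fold knuth_move (map ((+) (length p)) J) (?N x y) = ?N z y"
      using fold_knuth_move_prepend[of J p] J by (simp add: subset_iff)
    then show "P (?N z y)" using P_fold[OF Pxy] by metis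
  qed
  have Prt: "P (?N r t)" using p by (simp add: P_def)
  have Pst: "P (?N s t)" using Pwalk[OF _ _ _ _ _ _ Prt, of s] rst by simp
  have Ptr: "P (?N t r)" and Pts: "P (?N t s)" using Pswap[OF _ _ _ Prt] Pswap[OF _ _ _ Pst] rst by simp_all
  have Psr: "P (?N s r)" using Pwalk[OF _ _ _ _ _ _ Ptr, of s] rst by simp
  have Prs: "P (?N r s)" using Pswap[OF _ _ _ Psr] rst by simp
  have "P (?N c d)" using mem(1,2) cd Prt Pst Ptr Pts Psr Prs by auto
  moreover have "?N c d = (p @ butlast (tri_word r s t c d)) @ [d]" by (simp add: tri_word_def)
  then obtain w0 where w0: "?N c d = w0 @ [d]" by blast
  ultimately have w0': "lattice_word w0" "add_mset d (mset w0) = {#c, d, e#} + M"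
    using set by (simp_all add: P_def lattice_snoc)
  have mw0: "mset w0 = mset (p1 @ [a1, c])" using w0'(2) M1 by (simp add: add_mset_commute)
  have gv1: "g v1 = (p1 @ [a1, c]) @ [d]" using v1(2) by simp
  have li: "length (p1 @ [a1, c]) = i" using g_length[OF v1(1)] v1(2) by simp
  have "\<exists>y\<in>deq_class A phi 2 (length (p1 @ [a1, c]) - 1) v1. g y = w0 @ [d]"
    by (rule g_lift[OF v1(1) gv1 _ _ w0'(1) mw0]) (use li in simp_all)
  then obtain T0 where T0: "T0 \<in> deq_class A phi 2 (i - 1) v1" "g T0 = ?N c d"
    unfolding li w0 by blast
  have T0A: "T0 \<in> A" using class1_A[OF v1(1) T0(1)] .
  define T0' where "T0' = phi i T0"
  have T0': "T0' \<in> A" "g T0' = ?N d c" using T0A g_phi_i[OF T0A] T0(2) swap mem cd by (simp_all add: T0'_def)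
  obtain T2 where T2: "T2 \<in> A" "T2 \<in> deq_class A phi (i - 3) (i - 1) T0'" "g T2 = ?N e c"
    using walk[OF T0' mem(2,1,3)] cd fd cf by auto
  define T2' where "T2' = phi i T2"
  have T2': "T2' \<in> A" "g T2' = ?N c e" using T2 g_phi_i[OF T2(1)] swap mem cf by (simp_all add: T2'_def)
  obtain T3 where T3: "T3 \<in> A" "T3 \<in> deq_class A phi (i - 3) (i - 1) T2'" "g T3 = ?N d e"
    using walk[OF T2' mem(1,3,2)] cd fd cf by auto
  have T3': "phi i T3 \<in> A" "g (phi i T3) = ?N e d" using T3 g_phi_i[OF T3(1)] swap mem fd by simp_all
  obtain T4 where T4: "T4 \<in> A" "T4 \<in> deq_class A phi (i - 3) (i - 1) T0" "g T4 = ?N e d"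
    using walk[OF T0A T0(2) mem(1,2,3)] cd fd cf by auto
  have "phi i T3 = T4"
  proof (rule window_eq[OF T0A])
    have up: "x \<in> deq_class A phi (i - 3) i T0 \<Longrightarrow> x \<in> A \<Longrightarrow> phi i x \<in> deq_class A phi (i - 3) i T0" for x
      using class_step[of x A phi "i - 3" i T0 i] by simp
    have "T0' \<in> deq_class A phi (i - 3) i T0" using up[of T0] T0A by (simp add: T0'_def)
    then have "T2 \<in> deq_class A phi (i - 3) i T0" using T2(2) w2 class_trans by (metis subsetD)
    then have "T2' \<in> deq_class A phi (i - 3) i T0" using up[of T2] T2(1) by (simp add: T2'_def)
    then have "T3 \<in> deq_class A phi (i - 3) i T0" using T3(2) w2 class_trans by (metis subsetD)
    then show "phi i T3 \<in> deq_class A phi (i - 3) i T0" using up[of T3] T3(1) by simp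
    show "T4 \<in> deq_class A phi (i - 3) i T0" using T4(2) w2 by blast
  qed (simp add: T3' T4)
  then have "phi i T4 = T3" using T3 by auto
  have T4v: "v \<in> deq_class A phi 2 (i - 1) T4"
  proof -
    have "T4 \<in> deq_class A phi 2 (i - 1) v1" using T0(1) T4(2) w1 class_trans by (metis subsetD)
    then show ?thesis using class_chain[OF v1(1) _ v(1)] by simp
  qed
  obtain w a where wa: "tri_word r s t e d = w @ [a, e, d]" "e \<le> a \<and> a < d \<or> d \<le> a \<and> a < e"
    using tri_word_last[OF rst mem(3,2)] fd by metis
  have "phi i v \<in> deq_class A phi 2 (i - 1) (phi i T4)"
    using phi_i_same_pair[OF T4(1) T4v, of "p @ w" a e d p2 a2] T4(3) wa v(2,3) by simp
  moreover have "T3 \<in> deq_class A phi 2 (i - 1) (phi i T2)" using T3(2) w1 by (auto simp: T2'_def)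
  ultimately have e1: "phi i v \<in> deq_class A phi 2 (i - 1) (phi i T2)"
    using \<open>phi i T4 = T3\<close> class_trans by metis
  obtain w' a' where wa': "tri_word r s t c d = w' @ [a', c, d]" "c \<le> a' \<and> a' < d \<or> d \<le> a' \<and> a' < c"
    using tri_word_last[OF rst mem(1,2)] cd by metis
  have "T0' \<in> deq_class A phi 2 (i - 1) (phi i v1)"
    using phi_i_same_pair[OF v1(1) T0(1) v1(2), of "p @ w'" a'] T0(2) wa' v1(3) by (simp add: T0'_def)
  then have "T2 \<in> deq_class A phi 2 (i - 1) (phi i v1)" using T2(2) w1 class_trans by (metis subsetD)
  then show ?thesis using e1 by blast
qed

text \<open>Two successive edges of colour \<open>i\<close> between classes reduce to at most one.
  After the edge from \<open>a\<close> to \<open>a1\<close>, the next edge at \<open>V\<close>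
  either exchanges the same letters as the edge back to \<open>a\<close>, and so returns to the
  class of \<open>a\<close>, or it closes a triangle.\<close>

lemma one_edge_windowed: "one_edge A phi i"
  unfolding one_edge_def
proof (intro ballI)
  fix u v assume uA: "u \<in> A" and v: "v \<in> deq_class A phi 2 i u"
  let ?P = "\<lambda>v. v \<in> deq_class A phi 2 (i - 1) u \<or>
     (\<exists>a\<in>deq_class A phi 2 (i - 1) u. v \<in> deq_class A phi 2 (i - 1) (phi i a))"
  show "?P v"
    using v uA one_less_i(4) i_n
  proof (induction rule: class_induct)
    case (step V j)
    consider "j < i" | "j = i" using step.hyps by linarith
    then show ?case
    proof cases
      case 1
      then have "j \<le> i - 1" by simp
      then show ?thesis using step.IH class_step[OF _ step.hyps(1), of phi 2 "i - 1" _ j] step.hyps by blast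
    next
      case ji: 2
      from step.IH show ?thesis
      proof (elim disjE bexE)
        assume "V \<in> deq_class A phi 2 (i - 1) u"
        then show ?thesis using ji class1_refl by blast
      next
        fix a assume a: "a \<in> deq_class A phi 2 (i - 1) u" "V \<in> deq_class A phi 2 (i - 1) (phi i a)"
        have aA: "a \<in> A" using class1_A[OF uA a(1)] .
        define a1 where "a1 = phi i a"
        have a1: "a1 \<in> A" "phi i a1 = a" using aA by (simp_all add: a1_def)
        have VA: "V \<in> A" using step.hyps(1) .
        show ?thesis
        proof (cases rule: phi_i_cases[OF VA])
          case 1
          then show ?thesis using ji a class_trans by metis
        next
          case (2 p2 a2 e d)
          note V2 = this
          show ?thesis
          proof (cases rule: phi_i_cases[OF a1(1)])
            case 1
            then have "a \<in> deq_class A phi 2 (i - 1) a1" using a1 by simp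
            then have "a1 \<in> deq_class A phi 2 (i - 1) a" using class1_sym[OF a1(1)] by simp
            then have "V \<in> deq_class A phi 2 (i - 1) u" using a class_trans unfolding a1_def by metis
            then show ?thesis using ji class1_refl by blast
          next
            case (2 p1 a1' c d')
            have "d' = d" using class1_inv(1)[OF a1(1) a(2)[folded a1_def]] 2 V2 by simp
            note A1 = 2[unfolded this]
            have V1: "V \<in> deq_class A phi 2 (i - 1) a1" using a(2) by (simp add: a1_def)
            show ?thesis
            proof (cases "c = e")
              case True
              have "phi i V \<in> deq_class A phi 2 (i - 1) a"
                using phi_i_same_pair[OF a1(1) V1 A1(1), of p2 a2] V2 A1 True a1 by simp
              then show ?thesis using a(1) ji class_trans by metis
            next
              case False
              obtain b where b: "b \<in> deq_class A phi 2 (i - 1) a" "phi i V \<in> deq_class A phi 2 (i - 1) (phi i b)"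
                using triangle[OF a1(1) A1(1) A1(3) V1 V2(1) V2(3) False] a1 by auto
              then show ?thesis using a(1) ji class_trans by metis
            qed
          qed
        qed
      qed
    qed
  qed simp
qed

end

section \<open>Quasisymmetric expansion of Schur functions\<close>

definition compat :: "nat set \<Rightarrow> nat multiset \<Rightarrow> bool" where
  "compat X M \<longleftrightarrow> (\<forall>j\<in>X. sorted_list_of_multiset M ! (j - 1) < sorted_list_of_multiset M ! j)"

text \<open>A monomial has only one sorted arrangement, so each coefficient is 0 or 1.\<close>

lemma fundQ_eq:
  "fundQ m X M = (if size M = m \<and> (\<forall>x\<in>#M. 1 \<le> x) \<and> compat X M then 1 else 0)"
proof -
  let ?S = "{s. length s = m \<and> sorted s \<and> (\<forall>x\<in>set s. 1 \<le> x) \<and> mset s = M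
     \<and> (\<forall>j\<in>X. s ! (j - 1) < s ! j)}"
  let ?s = "sorted_list_of_multiset M"
  have s: "s = ?s" if "sorted s" "mset s = M" for s
    using that sorted_list_of_multiset_mset[of s] by (simp add: sorted_sort_id)
  have m: "mset ?s = M" "sorted ?s" by simp_all
  have l: "length ?s = size M" using m(1) by (metis size_mset)
  have "?S = (if size M = m \<and> (\<forall>x\<in>#M. 1 \<le> x) \<and> compat X M then {?s} else {})"
  proof -
    have 1: "x = ?s" if "x \<in> ?S" for x using s that by blast
    have 2: "?s \<in> ?S \<longleftrightarrow> size M = m \<and> (\<forall>x\<in>#M. 1 \<le> x) \<and> compat X M"
      using l by (simp add: compat_def)
    show ?thesis
    proof (cases "?s \<in> ?S")
      case True
      then have "?S = {?s}" using 1 by blast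
      then show ?thesis using 2 True by metis
    next
      case False
      have "x \<notin> ?S" for x
      proof
        assume "x \<in> ?S"
        moreover from this have "x = ?s" by (rule 1)
        ultimately show False using False by simp
      qed
      then have "?S = {}" by blast
      then show ?thesis using 2 False by metis
    qed
  qed
  then show ?thesis unfolding fundQ_def by simp
qed

text \<open>The monomial comes from the sorted word that increases exactly at the positions in
  \<open>X\<close>. Its coefficient in \<open>Q\<close> of \<open>Y\<close> is nonzero just for
  \<open>Y \<subseteq> X\<close>, so the fundamental functions are triangular with respect to
  inclusion.\<close>

lemma ex_compat_iff:
  assumes "X \<subseteq> {1..<m}"
  obtains M where "size M = m" "\<forall>x\<in>#M. 1 \<le> x" "\<And>Y. Y \<subseteq> {1..<m} \<Longrightarrow> compat Y M \<longleftrightarrow> Y \<subseteq> X"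
proof -
  define h where "h k = Suc (card (X \<inter> {1..k}))" for k
  define s where "s = map h [0..<m]"
  have fin: "finite (X \<inter> {1..k})" for k by simp
  have mono: "h k \<le> h l" if "k \<le> l" for k l
    unfolding h_def using that by (auto intro!: card_mono)
  have srt: "sorted s" unfolding s_def by (auto simp: sorted_iff_nth_mono intro: mono)
  have step: "h (j - 1) < h j \<longleftrightarrow> j \<in> X" if "1 \<le> j" for j
  proof (cases "j \<in> X")
    case True
    then have "X \<inter> {1..j} = insert j (X \<inter> {1..j - 1})" using that by auto
    moreover have "j \<notin> X \<inter> {1..j - 1}" using that by auto
    ultimately show ?thesis using True fin by (simp add: h_def)
  next
    case False
    then have "X \<inter> {1..j} = X \<inter> {1..j - 1}" using that by (auto simp: le_less)
    then show ?thesis using False by (simp add: h_def)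
  qed
  have sl: "sorted_list_of_multiset (mset s) = s" using srt by (simp add: sorted_list_of_multiset_mset sorted_sort_id)
  have "compat Y (mset s) \<longleftrightarrow> Y \<subseteq> X" if Y: "Y \<subseteq> {1..<m}" for Y
  proof -
    have "s ! (j - 1) < s ! j \<longleftrightarrow> j \<in> X" if "j \<in> Y" for j
      using step[of j] Y that by (auto simp: s_def subset_iff)
    then show ?thesis unfolding compat_def sl by auto
  qed
  then show ?thesis using that[of "mset s"] by (auto simp: s_def h_def)
qed

text \<open>Linear independence, stated for multiplicities. The coefficient at the monomial
  belonging to \<open>X\<close> counts the members whose set is contained in \<open>X\<close>;
  induction over proper subsets isolates those whose set is \<open>X\<close> itself.\<close>

lemma fundQ_independent:
  fixes d :: "'a \<Rightarrow> nat set" and e :: "'b \<Rightarrow> nat set"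
  assumes K: "finite K" "\<And>x. x \<in> K \<Longrightarrow> d x \<subseteq> {1..<m}" and L: "finite L" "\<And>y. y \<in> L \<Longrightarrow> e y \<subseteq> {1..<m}"
    and eq: "\<And>M. (\<Sum>x\<in>K. fundQ m (d x) M) = (\<Sum>y\<in>L. fundQ m (e y) M)"
    and X: "X \<subseteq> {1..<m}"
  shows "card {x \<in> K. d x = X} = card {y \<in> L. e y = X}"
proof -
  have le: "card {x \<in> K. d x \<subseteq> X} = card {y \<in> L. e y \<subseteq> X}" if X: "X \<subseteq> {1..<m}" for X
  proof -
    obtain M where M: "size M = m" "\<forall>x\<in>#M. 1 \<le> x" "\<And>Y. Y \<subseteq> {1..<m} \<Longrightarrow> compat Y M \<longleftrightarrow> Y \<subseteq> X"
      using ex_compat_iff[OF X] by blast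
    have "(\<Sum>x\<in>K. fundQ m (d x) M) = (\<Sum>x\<in>K. if d x \<subseteq> X then 1 else 0)"
      by (rule sum.cong) (use M K in \<open>auto simp: fundQ_eq\<close>)
    moreover have "(\<Sum>x\<in>L. fundQ m (e x) M) = (\<Sum>x\<in>L. if e x \<subseteq> X then 1 else 0)"
      by (rule sum.cong) (use M L in \<open>auto simp: fundQ_eq\<close>)
    moreover have "(\<Sum>x\<in>K. if d x \<subseteq> X then 1 else 0) = int (card {x \<in> K. d x \<subseteq> X})"
      using K(1) by (simp add: sum.If_cases Int_def)
    moreover have "(\<Sum>x\<in>L. if e x \<subseteq> X then 1 else 0) = int (card {x \<in> L. e x \<subseteq> X})"
      using L(1) by (simp add: sum.If_cases Int_def)
    ultimately show ?thesis using eq[of M] by simp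
  qed
  have part: "card {x \<in> K. d x \<subseteq> X} = card {x \<in> K. d x = X} + (\<Sum>Y\<in>{Y. Y \<subset> X}. card {x \<in> K. d x = Y})"
    if "finite K" "finite X" for K :: "'c set" and d and X :: "nat set"
  proof -
    have fin: "finite {Y. Y \<subset> X}" using that(2) by (auto intro: finite_subset[of _ "Pow X"])
    have "{x \<in> K. d x \<subseteq> X} = (\<Union>Y\<in>insert X {Y. Y \<subset> X}. {x \<in> K. d x = Y})" by auto
    then have "card {x \<in> K. d x \<subseteq> X} = (\<Sum>Y\<in>insert X {Y. Y \<subset> X}. card {x \<in> K. d x = Y})"
      using that(1) fin by (simp only:, subst card_UN_disjoint) auto
    then show ?thesis using fin by simp
  qed
  have "finite X" using X finite_subset by blast
  then show ?thesis using X
  proof (induction X rule: finite_psubset_induct)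
    case (psubset X)
    have "(\<Sum>Y\<in>{Y. Y \<subset> X}. card {x \<in> K. d x = Y}) = (\<Sum>Y\<in>{Y. Y \<subset> X}. card {x \<in> L. e x = Y})"
      by (rule sum.cong) (use psubset in auto)
    then show ?case
      using part[OF K(1) psubset(1), of d] part[OF L(1) psubset(1), of e] le[OF psubset(3)] by simp
  qed
qed

section \<open>Semistandard tableaux and standardization\<close>

definition shape :: "nat multiset \<Rightarrow> (nat \<times> nat) set" where
  "shape N = {(r, c). c < count N r}"

definition tableaux :: "nat multiset \<Rightarrow> nat multiset \<Rightarrow> (nat \<times> nat \<Rightarrow> nat) set" where
  "tableaux N M = {T. (\<forall>x. x \<notin> shape N \<longrightarrow> T x = undefined)
     \<and> (\<forall>r c. Suc c < count N r \<longrightarrow> T (r, c) \<le> T (r, Suc c))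
     \<and> (\<forall>r c. c < count N (Suc r) \<longrightarrow> T (r, c) < T (Suc r, c))
     \<and> image_mset T (mset_set (shape N)) = M}"

text \<open>A tableau is built by adding cells in the order of its standardization: by entry, and from
  left to right, that is, with weakly decreasing rows, among equal entries. The pairs (row, entry)
  are listed last cell first.\<close>

fun standard_order :: "(nat \<times> nat) list \<Rightarrow> bool" where
  "standard_order [] = True"
| "standard_order [(r, e)] = part {#r#}"
| "standard_order ((r, e) # (r', e') # zs) = (standard_order ((r', e') # zs)
     \<and> part (add_mset r (mset (map fst ((r', e') # zs)))) \<and> (e' < e \<or> e' = e \<and> r \<le> r'))"

fun fill :: "(nat \<times> nat) list \<Rightarrow> nat \<times> nat \<Rightarrow> nat" where
  "fill [] = (\<lambda>_. undefined)"
| "fill ((r, e) # zs) = (fill zs)((r, count (mset (map fst zs)) r) := e)"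

lemma standard_order_tl: "standard_order (z # zs) \<Longrightarrow> standard_order zs"
  by (cases "(z # zs)" rule: standard_order.cases) auto

lemma standard_order_part: "standard_order zs \<Longrightarrow> part (mset (map fst zs))"
  by (cases zs rule: standard_order.cases) auto

lemma finite_shape [simp]: "finite (shape N)"
proof -
  have "shape N = (\<Union>r\<in>set_mset N. (\<lambda>c. (r, c)) ` {..<count N r})"
    by (auto simp: shape_def) (metis count_inI image_eqI lessThan_iff not_less0)
  then show ?thesis by simp
qed

lemma shape_add: "shape (add_mset r N) = insert (r, count N r) (shape N)" "(r, count N r) \<notin> shape N"
  by (auto simp: shape_def less_Suc_eq split: if_splits)

lemma image_shape_add:
  assumes "T' = T((r, count N r) := e)"
  shows "image_mset T' (mset_set (shape (add_mset r N))) = add_mset e (image_mset T (mset_set (shape N)))"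
proof -
  have "image_mset T' (mset_set (shape N)) = image_mset T (mset_set (shape N))"
    using shape_add(2)[of r N] by (intro image_mset_cong) (auto simp: assms)
  then show ?thesis using shape_add[of r N] by (simp add: assms)
qed

text \<open>The cell added last has the largest entry and, among the cells with this entry, lies in
  the topmost row. This lets the head of the list be recovered from the tableau.\<close>

lemma fill_head:
  assumes "standard_order ((r, e) # zs)" "(q, c) \<in> shape (mset (map fst ((r, e) # zs)))"
  shows "fill ((r, e) # zs) (q, c) < e \<or> fill ((r, e) # zs) (q, c) = e \<and> r \<le> q"
  using assms
proof (induction zs arbitrary: r e)
  case Nil
  then show ?case by (auto simp: shape_def split: if_splits)
next
  case (Cons z zs)
  obtain r' e' where z: "z = (r', e')" by (cases z)
  show ?case
  proof (cases "(q, c) = (r, count (mset (map fst (z # zs))) r)")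
    case True
    then show ?thesis by simp
  next
    case False
    then have "(q, c) \<in> shape (mset (map fst (z # zs)))"
      using Cons(3) shape_add(1)[of r "mset (map fst (z # zs))"] by auto
    then have "fill (z # zs) (q, c) < e' \<or> fill (z # zs) (q, c) = e' \<and> r' \<le> q"
      using Cons(1)[of r' e'] Cons(2) z by simp
    moreover have "e' < e \<or> e' = e \<and> r \<le> r'" using Cons(2) z by simp
    moreover have "fill ((r, e) # z # zs) (q, c) = fill (z # zs) (q, c)" using False by auto
    ultimately show ?thesis by linarith
  qed
qed

text \<open>The new cell ends its row, and its upper neighbour lies in a smaller row, where the
  order of equal entries excludes the entry of the new cell. So columns stay strict.\<close>

lemma fill_tableau:
  assumes "standard_order zs"
  shows "fill zs \<in> tableaux (mset (map fst zs)) (mset (map snd zs))"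
  using assms
proof (induction zs)
  case Nil
  then show ?case by (simp add: tableaux_def shape_def)
next
  case (Cons z zs)
  obtain r e where z: "z = (r, e)" by (cases z)
  let ?N = "mset (map fst zs)"
  have pN: "part (add_mset r ?N)" and pN0: "part ?N"
    using standard_order_part[OF Cons(2)] standard_order_part[OF standard_order_tl[OF Cons(2)]] z by simp_all
  have IH: "fill zs \<in> tableaux ?N (mset (map snd zs))"
    using Cons standard_order_tl by blast
  have old: "fill zs (q, c) < e \<or> fill zs (q, c) = e \<and> r \<le> q" if "(q, c) \<in> shape ?N" for q c
  proof -
    have "fill (z # zs) (q, c) = fill zs (q, c)" using that z shape_add(2)[of r ?N] by auto
    moreover have "(q, c) \<in> shape (mset (map fst (z # zs)))" using that z shape_add(1)[of r ?N] by simp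
    ultimately show ?thesis using fill_head[of r e zs q c] Cons(2) z by simp
  qed
  have c0: "r = 0 \<or> count ?N r < count ?N (r - 1)" using part_add[OF pN0, of r] pN by simp
  show ?case unfolding tableaux_def
  proof (intro CollectI conjI allI impI)
    fix x assume "x \<notin> shape (mset (map fst (z # zs)))"
    then have "x \<notin> shape ?N" "x \<noteq> (r, count ?N r)" using z shape_add(1)[of r ?N] by auto
    then have "fill (z # zs) x = fill zs x" "fill zs x = undefined" using IH z by (auto simp: tableaux_def simp del: split_paired_All)
    then show "fill (z # zs) x = undefined" by simp
  next
    fix q c assume c: "Suc c < count (mset (map fst (z # zs))) q"
    show "fill (z # zs) (q, c) \<le> fill (z # zs) (q, Suc c)"
    proof (cases "q = r \<and> Suc c = count ?N r")
      case True
      then have "(q, c) \<in> shape ?N" by (auto simp: shape_def)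
      then have "fill zs (q, c) \<le> e" using old[of q c] by auto
      then show ?thesis using True z by auto
    next
      case False
      then have "Suc c < count ?N q" using c z by (auto split: if_splits)
      then show ?thesis using IH z by (auto simp: tableaux_def)
    qed
  next
    fix q c assume c: "c < count (mset (map fst (z # zs))) (Suc q)"
    show "fill (z # zs) (q, c) < fill (z # zs) (Suc q, c)"
    proof (cases "Suc q = r \<and> c = count ?N r")
      case True
      then have "(q, c) \<in> shape ?N" using c0 by (auto simp: shape_def)
      then have "fill zs (q, c) < e" using old[of q c] True by auto
      then show ?thesis using True z by auto
    next
      case False
      then have c': "c < count ?N (Suc q)" using c z by (auto split: if_splits)
      then have "c < count ?N q" using pN0 unfolding part_def by (metis less_le_trans)
      then show ?thesis using IH z c' by (auto simp: tableaux_def)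
    qed
  next
    show "image_mset (fill (z # zs)) (mset_set (shape (mset (map fst (z # zs))))) = mset (map snd (z # zs))"
      using image_shape_add[of "fill (z # zs)" "fill zs" r ?N e] IH z by (simp add: tableaux_def)
  qed
qed

text \<open>Comparing each head with the cell of the other one gives both inequalities between the
  entries and, for equal entries, between the rows.\<close>

lemma fill_inj:
  assumes "standard_order zs" "standard_order zs'" "fill zs = fill zs'"
    "mset (map fst zs) = mset (map fst zs')" "mset (map snd zs) = mset (map snd zs')"
  shows "zs = zs'"
  using assms
proof (induction zs arbitrary: zs')
  case Nil
  then show ?case by simp
next
  case (Cons z zs)
  have "zs' \<noteq> []" using Cons(5) by auto
  then obtain z' zs0 where zs': "zs' = z' # zs0" by (cases zs') auto
  obtain r e where z: "z = (r, e)" by (cases z)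
  obtain r' e' where z': "z' = (r', e')" by (cases z')
  let ?N = "mset (map fst (z # zs))"
  have c: "(r, count (mset (map fst zs)) r) \<in> shape ?N" "(r', count (mset (map fst zs0)) r') \<in> shape ?N"
    using shape_add(1)[of r "mset (map fst zs)"] shape_add(1)[of r' "mset (map fst zs0)"] z z' zs' Cons(5) by auto
  have v: "fill (z # zs) (r, count (mset (map fst zs)) r) = e"
    "fill (z # zs) (r', count (mset (map fst zs0)) r') = e'"
    unfolding z by (simp, unfold z[symmetric] Cons(4) zs' z', simp)
  have "e < e' \<or> e = e' \<and> r' \<le> r"
    using fill_head[of r' e' zs0 r "count (mset (map fst zs)) r"] c v Cons(3-5) z' zs' by metis
  moreover have "e' < e \<or> e' = e \<and> r \<le> r'"
    using fill_head[of r e zs r' "count (mset (map fst zs0)) r'"] c v Cons(2) z by metis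
  ultimately have zz: "z = z'" using z z' by auto
  have m: "mset (map fst zs) = mset (map fst zs0)" "mset (map snd zs) = mset (map snd zs0)"
    using Cons(5,6) zs' zz by simp_all
  have "fill zs = fill zs0"
  proof
    fix x
    show "fill zs x = fill zs0 x"
    proof (cases "x = (r, count (mset (map fst zs)) r)")
      case True
      then have "x \<notin> shape (mset (map fst zs))" using shape_add(2) by simp
      moreover have "fill zs \<in> tableaux (mset (map fst zs)) (mset (map snd zs))"
        "fill zs0 \<in> tableaux (mset (map fst zs)) (mset (map snd zs))"
        using fill_tableau[of zs] fill_tableau[of zs0] standard_order_tl Cons(2,3) unfolding zs' m by blast+
      ultimately show ?thesis unfolding tableaux_def mem_Collect_eq by metis
    next
      case False
      then show ?thesis using fun_cong[OF Cons(4), of x] z z' zs' zz m by simp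
    qed
  qed
  then show ?case using Cons(1)[of zs0] standard_order_tl Cons(2,3) zs' zz m by blast
qed

text \<open>The cell to remove is the last one in the topmost row that contains the maximal entry.
  Maximality leaves no cell below it, and minimality of the row yields the order required among
  equal entries.\<close>

lemma fill_surj:
  assumes "part N" "T \<in> tableaux N M"
  shows "\<exists>zs. standard_order zs \<and> fill zs = T \<and> mset (map fst zs) = N \<and> mset (map snd zs) = M"
  using assms
proof (induction "size N" arbitrary: N T M)
  case 0
  then have "N = {#}" by simp
  then have "T = (\<lambda>_. undefined)" "M = {#}" using 0 by (auto simp: tableaux_def shape_def)
  then show ?case using \<open>N = {#}\<close> by (intro exI[of _ "[]"]) simp
next
  case (Suc k)
  have T: "\<And>x. x \<notin> shape N \<Longrightarrow> T x = undefined" "\<And>r c. Suc c < count N r \<Longrightarrow> T (r, c) \<le> T (r, Suc c)"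
    "\<And>r c. c < count N (Suc r) \<Longrightarrow> T (r, c) < T (Suc r, c)" "image_mset T (mset_set (shape N)) = M"
    using Suc(4) by (auto simp: tableaux_def)
  have "N \<noteq> {#}" using Suc(2) by auto
  then obtain q where "q \<in># N" by blast
  then have "(q, 0) \<in> shape N" by (auto simp: shape_def)
  then have ne: "T ` shape N \<noteq> {}" by auto
  define e where "e = Max (T ` shape N)"
  have max: "T x \<le> e" if "x \<in> shape N" for x using that by (simp add: e_def)
  have "e \<in> T ` shape N" using ne by (simp add: e_def)
  then have ex: "\<exists>r. \<exists>c. (r, c) \<in> shape N \<and> T (r, c) = e" by auto
  define r where "r = (LEAST r. \<exists>c. (r, c) \<in> shape N \<and> T (r, c) = e)"
  have "\<exists>c. (r, c) \<in> shape N \<and> T (r, c) = e" unfolding r_def by (rule LeastI_ex[OF ex])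
  then obtain c where c: "c < count N r" "T (r, c) = e" by (auto simp: shape_def)
  have minr: "r \<le> q" if "(q, c) \<in> shape N" "T (q, c) = e" for q c
    unfolding r_def using that by (intro Least_le) blast
  define N' where "N' = N - {#r#}"
  have N': "N = add_mset r N'" using c(1) by (simp add: N'_def) (metis count_inI insert_DiffM not_less0)
  define c0 where "c0 = count N' r"
  have c0: "count N r = Suc c0" by (simp add: N' c0_def)
  have "T (r, c) \<le> T (r, c0)"
  proof -
    have "c \<le> j \<Longrightarrow> j \<le> c0 \<Longrightarrow> T (r, c) \<le> T (r, j)" for j
    proof (induction j rule: dec_induct)
      case (step j)
      then show ?case using T(2)[of j r] c0 by simp
    qed simp
    then show ?thesis using c c0 by simp
  qed
  then have Tc0: "T (r, c0) = e" using max[of "(r, c0)"] c c0 by (auto simp: shape_def)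
  have "count N (Suc r) \<le> c0"
  proof (rule ccontr)
    assume "\<not> count N (Suc r) \<le> c0"
    then have "c0 < count N (Suc r)" by simp
    then have "e < T (Suc r, c0)" "(Suc r, c0) \<in> shape N" using T(3)[of c0 r] Tc0 by (simp_all add: shape_def)
    then show False using max[of "(Suc r, c0)"] by simp
  qed
  then have pN': "part N'" unfolding N'_def using part_removeI[OF Suc(3)] c0 by simp
  define T' where "T' = T((r, c0) := undefined)"
  have shN: "shape N = insert (r, c0) (shape N')" "(r, c0) \<notin> shape N'"
    unfolding N' c0_def by (rule shape_add)+
  have TT: "T = T'((r, count N' r) := e)" using Tc0 by (auto simp: T'_def c0_def)
  have "M = add_mset e (image_mset T' (mset_set (shape N')))"
    using image_shape_add[OF TT] T(4) N' by simp
  then have M: "M - {#e#} = image_mset T' (mset_set (shape N'))" "M = add_mset e (M - {#e#})" by simp_all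
  have le: "count N' q \<le> count N q" for q by (simp add: N')
  have "T' \<in> tableaux N' (M - {#e#})" unfolding tableaux_def
  proof (intro CollectI conjI allI impI)
    fix x assume "x \<notin> shape N'"
    then show "T' x = undefined" using T(1)[of x] shN by (auto simp: T'_def)
  next
    fix q c assume *: "Suc c < count N' q"
    then have "(q, c) \<noteq> (r, c0)" "(q, Suc c) \<noteq> (r, c0)" by (auto simp: c0_def)
    then show "T' (q, c) \<le> T' (q, Suc c)" using T(2)[of c q] * le[of q] by (auto simp: T'_def)
  next
    fix q c assume *: "c < count N' (Suc q)"
    then have "c < count N' q" using pN' unfolding part_def by (metis less_le_trans)
    then have "(q, c) \<noteq> (r, c0)" "(Suc q, c) \<noteq> (r, c0)" using * by (auto simp: c0_def)
    then show "T' (q, c) < T' (Suc q, c)" using T(3)[of c q] * le[of "Suc q"] by (auto simp: T'_def)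
  qed (simp add: M(1))
  moreover have "k = size N'" using Suc(2) N' by simp
  ultimately obtain zs where zs: "standard_order zs" "fill zs = T'" "mset (map fst zs) = N'"
      "mset (map snd zs) = M - {#e#}"
    using Suc(1)[of N' T'] pN' by blast
  have f: "fill ((r, e) # zs) = T" using zs TT by simp
  have "standard_order ((r, e) # zs)"
  proof (cases zs)
    case Nil
    then show ?thesis using zs(3) N' Suc(3) by simp
  next
    case (Cons z zs0)
    obtain r' e' where z: "z = (r', e')" by (cases z)
    let ?x = "(r', count (mset (map fst zs0)) r')"
    have x: "?x \<in> shape N'" using zs(3) Cons z shape_add(1)[of r' "mset (map fst zs0)"] by auto
    have "T' ?x = e'" using zs(2) Cons z by auto
    then have "T ?x = e'" using x shN(2) by (auto simp: T'_def)
    then have "e' \<le> e" "e' = e \<longrightarrow> r \<le> r'" using max[of ?x] minr x shN(1) by auto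
    moreover have "part (add_mset r (mset (map fst zs)))" using zs(3) N' Suc(3) by simp
    ultimately show ?thesis using zs(1) Cons z by auto
  qed
  then show ?case using f zs(3,4) N' M(2) by (intro exI[of _ "(r, e) # zs"]) simp
qed

text \<open>Equal consecutive entries require weakly decreasing rows; equivalently, the entries must
  grow strictly wherever the row word has a descent.\<close>

lemma standard_order_iff:
  assumes "length w = length s" "sorted s"
  shows "standard_order (rev (zip w s)) \<longleftrightarrow>
    lattice_word w \<and> (\<forall>j. 1 \<le> j \<and> j < length w \<and> wdes w j \<longrightarrow> s ! (j - 1) < s ! j)"
  using assms
proof (induction w s rule: rev_induct2)
  case (4 r w e s)
  let ?c = "\<lambda>w s. \<forall>j. 1 \<le> j \<and> j < length w \<and> wdes w j \<longrightarrow> s ! (j - 1) < s ! j"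
  have l: "length w = length s" "sorted s" using 4 by (simp_all add: sorted_append)
  have IH: "standard_order (rev (zip w s)) \<longleftrightarrow> lattice_word w \<and> ?c w s" using 4 l by simp
  have z: "rev (zip (w @ [r]) (s @ [e])) = (r, e) # rev (zip w s)" using l by simp
  have ms: "mset (map fst (rev (zip w s))) = mset w"
    using l by (simp only: rev_map[symmetric] map_fst_zip mset_rev)
  have c: "?c (w @ [r]) (s @ [e]) \<longleftrightarrow> ?c w s \<and> (w \<noteq> [] \<and> last w < r \<longrightarrow> last s < e)"
  proof -
    have "?c (w @ [r]) (s @ [e]) \<longleftrightarrow> ?c w s \<and> (1 \<le> length w \<and> wdes (w @ [r]) (length w) \<longrightarrow> s ! (length w - 1) < e)"
    proof (intro iffI conjI allI impI)
      fix j assume C: "?c (w @ [r]) (s @ [e])" and j: "1 \<le> j \<and> j < length w \<and> wdes w j"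
      then have "(s @ [e]) ! (j - 1) < (s @ [e]) ! j" by (simp add: wdes_append)
      moreover have "j < length s" "j - 1 < length s" using j l(1) by auto
      ultimately show "s ! (j - 1) < s ! j" by (simp only: nth_append if_True)
    next
      assume C: "?c (w @ [r]) (s @ [e])" and j: "1 \<le> length w \<and> wdes (w @ [r]) (length w)"
      then have "(s @ [e]) ! (length w - 1) < (s @ [e]) ! length w" by simp
      then show "s ! (length w - 1) < e" using j l(1) by (simp add: nth_append split: if_splits)
    next
      fix j assume C: "?c w s \<and> (1 \<le> length w \<and> wdes (w @ [r]) (length w) \<longrightarrow> s ! (length w - 1) < e)"
        and j: "1 \<le> j \<and> j < length (w @ [r]) \<and> wdes (w @ [r]) j"
      show "(s @ [e]) ! (j - 1) < (s @ [e]) ! j"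
      proof (cases "j = length w")
        case True
        moreover from True j have "s ! (length w - 1) < e" using C by simp
        moreover have "length w - 1 < length s" using True j l(1) by (cases s) auto
        ultimately show ?thesis using l(1) by (simp only: nth_append_left nth_append_length)
      next
        case False
        then have "j < length w" using j by simp
        moreover from this have "s ! (j - 1) < s ! j" using C j by (simp add: wdes_append)
        moreover have "j - 1 < length s" using \<open>j < length w\<close> l(1) by simp
        ultimately show ?thesis using l(1) by (simp only: nth_append_left)
      qed
    qed
    moreover have "1 \<le> length w \<Longrightarrow> wdes (w @ [r]) (length w) \<longleftrightarrow> last w < r"
      by (cases "w = []") (simp_all add: wdes_def nth_append last_conv_nth)
    moreover have "1 \<le> length w \<Longrightarrow> s ! (length w - 1) = last s"
      using l by (subst last_conv_nth) auto
    ultimately show ?thesis by (cases w) auto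
  qed
  show ?case
  proof (cases "w = []")
    case True
    then show ?thesis using l z lattice_snoc[of "[]" r] by (simp add: wdes_def)
  next
    case False
    have "rev (zip w s) = (last w, last s) # rev (zip (butlast w) (butlast s))"
    proof -
      obtain w0 a where w0: "w = w0 @ [a]" using False by (metis append_butlast_last_id)
      moreover have "s \<noteq> []" using False l by auto
      then obtain s0 b where "s = s0 @ [b]" by (metis append_butlast_last_id)
      ultimately show ?thesis using l by simp
    qed
    moreover have "last s \<le> e"
    proof -
      have "last s \<in> set s" using False l by (cases s) auto
      then show ?thesis using 4 by (simp add: sorted_append)
    qed
    ultimately have "standard_order (rev (zip (w @ [r]) (s @ [e]))) \<longleftrightarrow>
        standard_order (rev (zip w s)) \<and> part (add_mset r (mset w)) \<and> (last w < r \<longrightarrow> last s < e)"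
      unfolding z using ms by auto
    then show ?thesis using IH c False by (auto simp: lattice_snoc)
  qed
qed auto

text \<open>A semistandard tableau is determined by its content and its standardization. The latter
  is a lattice word, and it is admissible precisely when the sorted content grows at all its
  descents.\<close>

lemma card_tableaux:
  assumes "part N" "size M = size N"
  shows "card (tableaux N M) = card {w. lattice_word w \<and> mset w = N \<and> compat {j. 1 \<le> j \<and> j < length w \<and> wdes w j} M}"
proof -
  let ?s = "sorted_list_of_multiset M"
  let ?W = "{w. lattice_word w \<and> mset w = N \<and> compat {j. 1 \<le> j \<and> j < length w \<and> wdes w j} M}"
  have s: "sorted ?s" "mset ?s = M" by simp_all
  have ls: "length ?s = size N" using s(2) assms(2) by (metis size_mset)
  have lw: "length w = length ?s" if "mset w = N" for w using that ls by (metis size_mset)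
  have fst: "map fst (rev (zip w ?s)) = rev w" and snd: "map snd (rev (zip w ?s)) = rev ?s"
    if "mset w = N" for w
    using lw[OF that] by (simp_all only: rev_map[symmetric] map_fst_zip map_snd_zip)
  have so: "standard_order (rev (zip w ?s)) \<longleftrightarrow> lattice_word w \<and> compat {j. 1 \<le> j \<and> j < length w \<and> wdes w j} M"
    if "mset w = N" for w
    using standard_order_iff[OF lw[OF that] s(1)] by (auto simp: compat_def)
  have "bij_betw (\<lambda>w. fill (rev (zip w ?s))) ?W (tableaux N M)"
  proof (rule bij_betw_imageI)
    show "inj_on (\<lambda>w. fill (rev (zip w ?s))) ?W"
    proof (rule inj_onI)
      fix w w' assume w: "w \<in> ?W" "w' \<in> ?W" and eq: "fill (rev (zip w ?s)) = fill (rev (zip w' ?s))"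
      have m: "mset w = N" "mset w' = N" using w by auto
      have "rev (zip w ?s) = rev (zip w' ?s)"
        by (rule fill_inj) (use so m w eq fst snd in auto)
      then have "rev w = rev w'" using fst m by metis
      then show "w = w'" by simp
    qed
    show "(\<lambda>w. fill (rev (zip w ?s))) ` ?W = tableaux N M"
    proof (intro equalityI subsetI)
      fix T assume "T \<in> (\<lambda>w. fill (rev (zip w ?s))) ` ?W"
      then obtain w where w: "w \<in> ?W" "T = fill (rev (zip w ?s))" by blast
      then have m: "mset w = N" by simp
      have "T \<in> tableaux (mset (map fst (rev (zip w ?s)))) (mset (map snd (rev (zip w ?s))))"
        unfolding w(2) by (rule fill_tableau) (use so[OF m] w in simp)
      then show "T \<in> tableaux N M" unfolding fst[OF m] snd[OF m] using m by simp
    next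
      fix T assume "T \<in> tableaux N M"
      then obtain zs where zs: "standard_order zs" "fill zs = T" "mset (map fst zs) = N" "mset (map snd zs) = M"
        using fill_surj[OF assms(1)] by blast
      have "sorted (rev (map snd zs))" using zs(1)
      proof (induction zs rule: standard_order.induct)
        case (3 r e r' e' zs)
        then show ?case by (auto simp: sorted_append)
      qed auto
      then have "rev (map snd zs) = ?s"
        using zs(4) sorted_list_of_multiset_mset[of "rev (map snd zs)"] by (simp add: sorted_sort_id)
      then have zip: "rev (zip (rev (map fst zs)) ?s) = zs"
        by (metis rev_rev_ident rev_map zip_map_fst_snd)
      have m: "mset (rev (map fst zs)) = N" using zs(3) by simp
      have "rev (map fst zs) \<in> ?W" using so[OF m] zip zs(1) m by simp
      then show "T \<in> (\<lambda>w. fill (rev (zip w ?s))) ` ?W" using zs(2) zip by force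
    qed
  qed
  from bij_betw_same_card[OF this] show ?thesis by simp
qed

section \<open>Gessel's expansion of a Schur function over standard tableaux\<close>

definition word_des :: "nat list \<Rightarrow> nat set" where
  "word_des w = {j. 1 \<le> j \<and> j < length w \<and> wdes w j}"

definition shape_mset :: "nat list \<Rightarrow> nat multiset" where
  "shape_mset lam = (\<Sum>r<length lam. replicate_mset (lam ! r) r)"

lemma count_shape_mset: "count (shape_mset lam) r = (if r < length lam then lam ! r else 0)"
proof -
  have "count (shape_mset lam) r = (\<Sum>k<length lam. if k = r then lam ! k else 0)"
    unfolding shape_mset_def count_sum by (rule sum.cong) auto
  then show ?thesis by simp
qed

lemma shape_shape_mset: "shape (shape_mset lam) = cells lam"
  by (auto simp: shape_def cells_def count_shape_mset split: if_splits)

lemma part_shape_mset: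
  assumes "is_partition lam k"
  shows "part (shape_mset lam)" "size (shape_mset lam) = k"
proof -
  show "part (shape_mset lam)"
    using assms unfolding part_def is_partition_def count_shape_mset
    by (auto simp: sorted_wrt_iff_nth_less)
  have "size (shape_mset lam) = (\<Sum>r<length lam. lam ! r)"
    by (simp add: shape_mset_def size_multiset_sum)
  then show "size (shape_mset lam) = k"
    using assms by (simp add: is_partition_def sum_list_sum_nth atLeast0LessThan)
qed

lemma finite_words: "finite {w. mset w = N}"
  by (rule finite_subset[OF _ finite_lists_length_eq[of "set_mset N" "size N"]]) auto

lemma card_shape: "card (shape N) = size N"
proof -
  have "shape N = Sigma (set_mset N) (\<lambda>r. {..<count N r})"
    by (auto simp: shape_def) (metis count_inI not_less0)
  then show ?thesis by (simp add: size_multiset_overloaded_eq)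
qed

theorem schur_expansion:
  assumes "is_partition lam k"
  shows "schur lam M = (\<Sum>w | lattice_word w \<and> mset w = shape_mset lam. fundQ k (word_des w) M)"
proof -
  let ?N = "shape_mset lam"
  let ?Y = "{w. lattice_word w \<and> mset w = ?N}"
  note N = part_shape_mset[OF assms]
  have finY: "finite ?Y" by (rule finite_subset[OF _ finite_words[of ?N]]) auto
  have ssyt: "ssyt lam M = (if size M = k \<and> (\<forall>x\<in>#M. 1 \<le> x) then tableaux ?N M else {})"
  proof -
    have c: "(r, c) \<in> cells lam \<longleftrightarrow> c < count ?N r" for r c
      using shape_shape_mset[of lam] by (auto simp: shape_def)
    have sz: "size M = k" if "image_mset T (mset_set (cells lam)) = M" for T
      using that N(2) card_shape[of ?N] by (auto simp: shape_shape_mset)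
    have "T \<in> ssyt lam M \<longleftrightarrow> (\<forall>x\<in>#M. 1 \<le> x) \<and> T \<in> tableaux ?N M" for T
    proof
      assume T: "T \<in> ssyt lam M"
      have "T (r, c) \<le> T (r, Suc c)" if "Suc c < count ?N r" for r c
        using T that c[of r c] c[of r "Suc c"] by (simp add: ssyt_def)
      moreover have "T (r, c) < T (Suc r, c)" if "c < count ?N (Suc r)" for r c
      proof -
        have "c < count ?N r" using that N(1) unfolding part_def by (metis less_le_trans)
        then show ?thesis using T that c[of r c] c[of "Suc r" c] by (simp add: ssyt_def)
      qed
      moreover have "T x = undefined" if "x \<notin> shape ?N" for x
      proof -
        have "T \<in> cells lam \<rightarrow>\<^sub>E set_mset M" using T unfolding ssyt_def by blast
        then show ?thesis using that unfolding shape_shape_mset by (rule PiE_arb)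
      qed
      ultimately show "(\<forall>x\<in>#M. 1 \<le> x) \<and> T \<in> tableaux ?N M"
        using T by (auto simp: tableaux_def ssyt_def shape_shape_mset)
    next
      assume T: "(\<forall>x\<in>#M. 1 \<le> x) \<and> T \<in> tableaux ?N M"
      then have im: "image_mset T (mset_set (cells lam)) = M" by (simp add: tableaux_def shape_shape_mset)
      have "T x \<in> set_mset M" if "x \<in> cells lam" for x
        using that unfolding im[symmetric] by (simp flip: shape_shape_mset)
      moreover have "T x = undefined" if "x \<notin> cells lam" for x
        using T that unfolding tableaux_def shape_shape_mset by blast
      ultimately have "T \<in> cells lam \<rightarrow>\<^sub>E set_mset M" by auto
      moreover have "\<forall>r c. (r, c) \<in> cells lam \<and> (r, Suc c) \<in> cells lam \<longrightarrow> T (r, c) \<le> T (r, Suc c)"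
        "\<forall>r c. (r, c) \<in> cells lam \<and> (Suc r, c) \<in> cells lam \<longrightarrow> T (r, c) < T (Suc r, c)"
        using T unfolding c tableaux_def by blast+
      ultimately show "T \<in> ssyt lam M" using T im unfolding ssyt_def by blast
    qed
    moreover have "size M = k" if "T \<in> tableaux ?N M" for T
      using sz[of T] that by (simp add: tableaux_def shape_shape_mset)
    ultimately have "ssyt lam M = {T. size M = k \<and> (\<forall>x\<in>#M. 1 \<le> x) \<and> T \<in> tableaux ?N M}" by blast
    then show ?thesis by simp
  qed
  show ?thesis
  proof (cases "size M = k \<and> (\<forall>x\<in>#M. 1 \<le> x)")
    case True
    then have "schur lam M = int (card {w \<in> ?Y. compat (word_des w) M})"
      using card_tableaux[OF N(1), of M] N(2) ssyt by (simp add: schur_def word_des_def conj_assoc)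
    moreover have "(\<Sum>w\<in>?Y. fundQ k (word_des w) M) = (\<Sum>w\<in>?Y. if compat (word_des w) M then 1 else 0)"
      using True by (intro sum.cong) (auto simp: fundQ_eq)
    ultimately show ?thesis using finY by (simp add: sum.If_cases Int_def)
  next
    case False
    then have "schur lam M = 0" unfolding schur_def ssyt by (simp only: if_False card.empty of_nat_0)
    moreover have "(\<Sum>w\<in>?Y. fundQ k (word_des w) M) = 0"
      by (rule sum.neutral) (use False in \<open>auto simp: fundQ_eq\<close>)
    ultimately show ?thesis by simp
  qed
qed

text \<open>All later uses of the Schur condition pass through this form: by independence, each
  descent set occurs as often as among the standard tableaux of the shape.\<close>

lemma schur_des_count:
  fixes d :: "'a \<Rightarrow> nat set"
  assumes "is_partition lam k" "finite K" "\<And>x. x \<in> K \<Longrightarrow> d x \<subseteq> {1..<k}"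
    and "\<And>M. (\<Sum>x\<in>K. fundQ k (d x) M) = schur lam M" "X \<subseteq> {1..<k}"
  shows "card {x \<in> K. d x = X} = card {w. lattice_word w \<and> mset w = shape_mset lam \<and> word_des w = X}"
proof -
  let ?Y = "{w. lattice_word w \<and> mset w = shape_mset lam}"
  have "card {x \<in> K. d x = X} = card {w \<in> ?Y. word_des w = X}"
  proof (rule fundQ_independent[of K d k ?Y word_des])
    show "finite ?Y" by (rule finite_subset[OF _ finite_words[of "shape_mset lam"]]) auto
    fix w assume "w \<in> ?Y"
    then have "length w = k" using part_shape_mset(2)[OF assms(1)] size_mset[of w] by simp
    then show "word_des w \<subseteq> {1..<k}" by (auto simp: word_des_def)
  qed (use assms schur_expansion[OF assms(1)] in auto)
  then show ?thesis by (simp add: conj_assoc)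
qed

section \<open>Knuth classes of arbitrary words\<close>

text \<open>The crystal raising operators commute with Knuth moves and preserve descents, so that every
  Knuth class looks like the class of a lattice word. The operator for \<open>r\<close> changes the letter
  \<open>Suc r\<close> at which the excess of \<open>Suc r\<close> over \<open>r\<close> in prefixes first attains its maximum.\<close>

definition delta :: "nat \<Rightarrow> nat \<Rightarrow> int" where
  "delta r x = (if x = Suc r then 1 else if x = r then -1 else 0)"

definition excess :: "nat \<Rightarrow> nat list \<Rightarrow> int" where
  "excess r w = (\<Sum>x\<leftarrow>w. delta r x)"

text \<open>The offset \<open>e\<close> accounts for letters already split off, so that the
  condition can be evaluated piece by piece along a concatenation. With offset 0 on both sides of a
  letter \<open>Suc r\<close>, the conditions say that the excess of prefixes reaches its maximum
  for the first time at this letter.\<close>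

definition left_ok :: "nat \<Rightarrow> int \<Rightarrow> nat list \<Rightarrow> bool" where
  "left_ok r e u \<longleftrightarrow> (\<forall>t s. u = t @ s \<longrightarrow> 0 \<le> e + excess r s)"

definition right_ok :: "nat \<Rightarrow> int \<Rightarrow> nat list \<Rightarrow> bool" where
  "right_ok r e v \<longleftrightarrow> (\<forall>s t. v = s @ t \<longrightarrow> 0 \<le> e - excess r s)"

definition raises :: "nat \<Rightarrow> nat list \<Rightarrow> nat list \<Rightarrow> bool" where
  "raises r w w' \<longleftrightarrow> (\<exists>u v. w = u @ Suc r # v \<and> w' = u @ r # v \<and> left_ok r 0 u \<and> right_ok r 0 v)"

lemma excess_simps [simp]: "excess r [] = 0" "excess r (x # w) = delta r x + excess r w"
    "excess r (u @ v) = excess r u + excess r v"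
  by (simp_all add: excess_def)

lemma excess_mset: "mset u = mset v \<Longrightarrow> excess r u = excess r v"
  unfolding excess_def by (metis mset_map sum_mset_sum_list)

lemma left_ok_append: "left_ok r e (u @ v) \<longleftrightarrow> left_ok r e v \<and> left_ok r (e + excess r v) u"
proof
  assume l: "left_ok r e (u @ v)"
  show "left_ok r e v \<and> left_ok r (e + excess r v) u"
    unfolding left_ok_def
  proof (intro conjI allI impI)
    fix t s assume "v = t @ s"
    then show "0 \<le> e + excess r s" using l unfolding left_ok_def by (metis append.assoc)
  next
    fix t s assume "u = t @ s"
    then have "u @ v = t @ (s @ v)" by simp
    then have "0 \<le> e + excess r (s @ v)" using l unfolding left_ok_def by blast
    then show "0 \<le> e + excess r v + excess r s" by simp
  qed
next
  assume l: "left_ok r e v \<and> left_ok r (e + excess r v) u"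
  show "left_ok r e (u @ v)" unfolding left_ok_def
  proof (intro allI impI)
    fix t s assume "u @ v = t @ s"
    then consider w where "u @ w = t" "v = w @ s" | w where "u = t @ w" "s = w @ v"
      by (auto simp: append_eq_append_conv2)
    then show "0 \<le> e + excess r s"
    proof cases
      case 1
      then show ?thesis using l unfolding left_ok_def by blast
    next
      case 2
      then have "0 \<le> e + excess r v + excess r w" using l unfolding left_ok_def by blast
      then show ?thesis using 2 by simp
    qed
  qed
qed

lemma right_ok_append: "right_ok r e (u @ v) \<longleftrightarrow> right_ok r e u \<and> right_ok r (e - excess r u) v"
proof
  assume l: "right_ok r e (u @ v)"
  show "right_ok r e u \<and> right_ok r (e - excess r u) v"
    unfolding right_ok_def
  proof (intro conjI allI impI)
    fix s t assume "u = s @ t"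
    then show "0 \<le> e - excess r s" using l unfolding right_ok_def by (metis append.assoc)
  next
    fix s t assume "v = s @ t"
    then have "u @ v = (u @ s) @ t" by simp
    then have "0 \<le> e - excess r (u @ s)" using l unfolding right_ok_def by blast
    then show "0 \<le> e - excess r u - excess r s" by simp
  qed
next
  assume l: "right_ok r e u \<and> right_ok r (e - excess r u) v"
  show "right_ok r e (u @ v)" unfolding right_ok_def
  proof (intro allI impI)
    fix s t assume "u @ v = s @ t"
    then consider w where "u @ w = s" "v = w @ t" | w where "u = s @ w" "t = w @ v"
      by (auto simp: append_eq_append_conv2)
    then show "0 \<le> e - excess r s"
    proof cases
      case 1
      then have "0 \<le> e - excess r u - excess r w" using l unfolding right_ok_def by blast
      then show ?thesis using 1 by auto
    next
      case 2
      then show ?thesis using l unfolding right_ok_def by blast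
    qed
  qed
qed

lemma left_ok_Nil [simp]: "left_ok r e [] \<longleftrightarrow> 0 \<le> e"
  by (simp add: left_ok_def)

lemma right_ok_Nil [simp]: "right_ok r e [] \<longleftrightarrow> 0 \<le> e"
  by (simp add: right_ok_def)

lemma left_ok_Cons [simp]:
  "left_ok r e (x # v) \<longleftrightarrow> left_ok r e v \<and> 0 \<le> e + delta r x + excess r v"
proof
  assume l: "left_ok r e (x # v)"
  have "x # v = [] @ (x # v)" by simp
  then have "0 \<le> e + excess r (x # v)" using l unfolding left_ok_def by blast
  moreover have "left_ok r e v" using l left_ok_append[of r e "[x]" v] by simp
  ultimately show "left_ok r e v \<and> 0 \<le> e + delta r x + excess r v" by simp
next
  assume l: "left_ok r e v \<and> 0 \<le> e + delta r x + excess r v"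
  show "left_ok r e (x # v)" unfolding left_ok_def
  proof (intro allI impI)
    fix t s assume "x # v = t @ s"
    then show "0 \<le> e + excess r s" using l unfolding left_ok_def by (cases t) auto
  qed
qed

lemma right_ok_Cons [simp]: "right_ok r e (x # v) \<longleftrightarrow> 0 \<le> e \<and> right_ok r (e - delta r x) v"
proof
  assume l: "right_ok r e (x # v)"
  have "x # v = [] @ (x # v)" by simp
  then have "0 \<le> e - excess r []" using l unfolding right_ok_def by blast
  moreover have "right_ok r (e - delta r x) v" using l right_ok_append[of r e "[x]" v] by simp
  ultimately show "0 \<le> e \<and> right_ok r (e - delta r x) v" by simp
next
  assume l: "0 \<le> e \<and> right_ok r (e - delta r x) v"
  show "right_ok r e (x # v)" unfolding right_ok_def
  proof (intro allI impI)
    fix s t assume st: "x # v = s @ t"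
    show "0 \<le> e - excess r s"
    proof (cases s)
      case (Cons y s')
      then have "0 \<le> e - delta r x - excess r s'" using l st unfolding right_ok_def by auto
      then show ?thesis using Cons st by simp
    qed (use l in simp)
  qed
qed

lemma left_ok_excess: "left_ok r e u \<Longrightarrow> 0 \<le> e + excess r u"
  unfolding left_ok_def by (metis append_Nil)

lemma right_ok_pos: "right_ok r e u \<Longrightarrow> 0 \<le> e"
  unfolding right_ok_def by (metis diff_zero append_Nil excess_simps(1))

text \<open>A move exchanges adjacent letters \<open>r\<close> and \<open>Suc r\<close> only behind
  a further \<open>r\<close> or in front of a further \<open>Suc r\<close>. In either situation the
  smallest partial sum, counted from the right and including the empty one, is unchanged. The dual
  statement for \<open>right_ok\<close> has the same reason.\<close>

lemma left_ok_triple: "left_ok r e (knuth_triple a b c) \<longleftrightarrow> left_ok r e [a, b, c]"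
proof (cases rule: knuth_triple_cases[of a b c])
  case 1
  then show ?thesis by (simp add: knuth_triple_simps)
next
  case 2
  then show ?thesis by (auto simp: knuth_triple_simps delta_def)
next
  case 3
  then show ?thesis by (auto simp: knuth_triple_simps delta_def)
next
  case 4
  then show ?thesis by (auto simp: knuth_triple_simps delta_def)
next
  case 5
  then show ?thesis by (auto simp: knuth_triple_simps delta_def)
qed

lemma right_ok_triple: "right_ok r e (knuth_triple a b c) \<longleftrightarrow> right_ok r e [a, b, c]"
proof (cases rule: knuth_triple_cases[of a b c])
  case 1
  then show ?thesis by (simp add: knuth_triple_simps)
next
  case 2
  then show ?thesis by (auto simp: knuth_triple_simps delta_def)
next
  case 3
  then show ?thesis by (auto simp: knuth_triple_simps delta_def)
next
  case 4
  then show ?thesis by (auto simp: knuth_triple_simps delta_def)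
next
  case 5
  then show ?thesis by (auto simp: knuth_triple_simps delta_def)
qed

lemma left_ok_knuth_move: "left_ok r e (knuth_move j u) \<longleftrightarrow> left_ok r e u"
proof (cases "2 \<le> j \<and> j < length u")
  case True
  then obtain p a b c q where u: "u = p @ a # b # c # q" "j = length p + 2"
    using list3_decomp[of j u] by blast
  have e: "excess r (knuth_triple a b c) = excess r [a, b, c]" by (rule excess_mset) simp
  have "left_ok r e (p @ knuth_triple a b c @ q) \<longleftrightarrow> left_ok r e (p @ [a, b, c] @ q)"
    unfolding left_ok_append left_ok_triple excess_simps(3) e by simp
  then show ?thesis using u by (simp add: knuth_move_triple)
qed (auto simp: knuth_move_def)

lemma right_ok_knuth_move: "right_ok r e (knuth_move j u) \<longleftrightarrow> right_ok r e u"
proof (cases "2 \<le> j \<and> j < length u")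
  case True
  then obtain p a b c q where u: "u = p @ a # b # c # q" "j = length p + 2"
    using list3_decomp[of j u] by blast
  have e: "excess r (knuth_triple a b c) = excess r [a, b, c]" by (rule excess_mset) simp
  have "right_ok r e (p @ knuth_triple a b c @ q) \<longleftrightarrow> right_ok r e (p @ [a, b, c] @ q)"
    unfolding right_ok_append right_ok_triple excess_simps(3) e by simp
  then show ?thesis using u by (simp add: knuth_move_triple)
qed (auto simp: knuth_move_def)

lemma raisesI: "left_ok r 0 u \<Longrightarrow> right_ok r 0 v \<Longrightarrow> raises r (u @ Suc r # v) (u @ r # v)"
  unfolding raises_def by blast

text \<open>The raised letter is the first of the triple. In general the move exchanges the same
  positions before and after raising. The exception is \<open>y = r\<close>,
  \<open>z = Suc r\<close>: there the two moves are of different type, and in the image the raised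
  letter is the third. The lemmas for the second and third position are analogous, the latter with
  the mirrored exception.\<close>

lemma raises_triple1:
  assumes l: "left_ok r 0 p" and rt: "right_ok r 0 ([y, z] @ q)"
  shows "raises r (p @ knuth_triple (Suc r) y z @ q) (p @ knuth_triple r y z @ q)"
proof -
  have d: "delta r y \<le> 0" "delta r y + delta r z \<le> 0" "right_ok r (- delta r y - delta r z) q"
    using rt by (auto dest: right_ok_pos)
  have y: "y \<noteq> Suc r" and z: "z = Suc r \<Longrightarrow> y = r" using d(1,2) by (auto simp: delta_def split: if_splits)
  show ?thesis
  proof (cases "z = Suc r")
    case True
    then have yr: "y = r" using z by simp
    have k: "knuth_triple (Suc r) r (Suc r) = [r, Suc r, Suc r]" "knuth_triple r r (Suc r) = [r, Suc r, r]"
      by (rule knuth_triple_simps; simp)+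
    have "raises r ((p @ [r, Suc r]) @ Suc r # q) ((p @ [r, Suc r]) @ r # q)"
      by (rule raisesI) (use l d True yr in \<open>simp_all add: left_ok_append delta_def\<close>)
    then show ?thesis using k True yr by simp
  next
    case zn: False
    show ?thesis
    proof (cases rule: knuth_triple_cases[of "Suc r" y z])
      case 1
      then have "(r < y) = (y < z)" using y by auto
      then show ?thesis using 1 raisesI[OF l rt] by (simp add: knuth_triple_simps)
    next
      case 2
      then have "y \<le> r" "r < z" using y by auto
      then have "right_ok r 0 ([z, y] @ q)" using rt 2 d by (simp add: delta_def split: if_splits)
      then show ?thesis using 2 raisesI[OF l] \<open>y \<le> r\<close> \<open>r < z\<close> by (simp add: knuth_triple_simps)
    next
      case 3
      then have "z \<le> r" "r < y" using zn by auto
      then have "right_ok r 0 ([z, y] @ q)" using rt 3 d by (simp add: delta_def split: if_splits)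
      then show ?thesis using 3 raisesI[OF l] \<open>z \<le> r\<close> \<open>r < y\<close> by (simp add: knuth_triple_simps)
    next
      case 4
      then have "r < z" "delta r y = 0" by (auto simp: delta_def)
      then have "left_ok r 0 (p @ [y])" "right_ok r 0 ([z] @ q)" using l d by (simp_all add: left_ok_append right_ok_append)
      then show ?thesis using 4 raisesI[of r "p @ [y]" "z # q"] \<open>r < z\<close> by (simp add: knuth_triple_simps)
    next
      case 5
      then have "z \<le> r" "delta r y = 0" using zn by (auto simp: delta_def)
      then have "left_ok r 0 (p @ [y])" "right_ok r 0 ([z] @ q)" using l d by (simp_all add: left_ok_append right_ok_append)
      then show ?thesis using 5 raisesI[of r "p @ [y]" "z # q"] \<open>z \<le> r\<close> by (simp add: knuth_triple_simps)
    qed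
  qed
qed

lemma raises_triple2:
  assumes l: "left_ok r 0 (p @ [x])" and rt: "right_ok r 0 ([z] @ q)"
  shows "raises r (p @ knuth_triple x (Suc r) z @ q) (p @ knuth_triple x r z @ q)"
proof -
  have d: "0 \<le> delta r x" "left_ok r (delta r x) p" "delta r z \<le> 0" "right_ok r (- delta r z) q"
    using l rt by (auto simp: left_ok_append dest: right_ok_pos)
  have x: "x \<noteq> r" and z: "z \<noteq> Suc r" using d by (auto simp: delta_def split: if_splits)
  show ?thesis
  proof (cases rule: knuth_triple_cases[of x "Suc r" z])
    case 1
    then have "(x < r) = (r < z)" using x z by auto
    then show ?thesis using 1 raisesI[OF l rt] by (simp add: knuth_triple_simps)
  next
    case 2
    then have e: "delta r z = 0" by (simp add: delta_def)
    then have "left_ok r 0 (p @ [x, z])" "right_ok r 0 q"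
      using d by (simp_all add: left_ok_append)
    then show ?thesis using 2 raisesI[of r "p @ [x, z]" q] by (simp add: knuth_triple_simps)
  next
    case 3
    then have "x < r" using x by simp
    then have e: "delta r z = 0" using 3 by (simp add: delta_def)
    then have "left_ok r 0 (p @ [x, z])" "right_ok r 0 q"
      using d by (simp_all add: left_ok_append)
    then show ?thesis using 3 \<open>x < r\<close> raisesI[of r "p @ [x, z]" q] by (simp add: knuth_triple_simps)
  next
    case 4
    then have "z \<le> r" using z by simp
    then have e: "delta r x = 0" using 4 by (simp add: delta_def)
    then have "left_ok r 0 p" "right_ok r 0 ([x, z] @ q)"
      using d by simp_all
    then show ?thesis using 4 \<open>z \<le> r\<close> raisesI[of r p "[x, z] @ q"] by (simp add: knuth_triple_simps)
  next
    case 5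
    then have e: "delta r x = 0" by (simp add: delta_def)
    then have "left_ok r 0 p" "right_ok r 0 ([x, z] @ q)"
      using d by simp_all
    then show ?thesis using 5 raisesI[of r p "[x, z] @ q"] by (simp add: knuth_triple_simps)
  qed
qed

lemma raises_triple3:
  assumes l: "left_ok r 0 (p @ [x, y])" and rt: "right_ok r 0 q"
  shows "raises r (p @ knuth_triple x y (Suc r) @ q) (p @ knuth_triple x y r @ q)"
proof -
  have d: "0 \<le> delta r y" "0 \<le> delta r x + delta r y" "left_ok r (delta r x + delta r y) p"
    using l by (auto simp: left_ok_append)
  have y: "y \<noteq> r" and x: "x = r \<Longrightarrow> y = Suc r" using d(1,2) by (auto simp: delta_def split: if_splits)
  show ?thesis
  proof (cases "x = r")
    case True
    then have yr: "y = Suc r" using x by simp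
    have k: "knuth_triple r (Suc r) (Suc r) = [Suc r, r, Suc r]" "knuth_triple r (Suc r) r = [r, r, Suc r]"
      by (rule knuth_triple_simps; simp)+
    have "raises r (p @ Suc r # [r, Suc r] @ q) (p @ r # [r, Suc r] @ q)"
      by (rule raisesI) (use rt d True yr in \<open>simp_all add: delta_def\<close>)
    then show ?thesis using k True yr by simp
  next
    case xn: False
    show ?thesis
    proof (cases rule: knuth_triple_cases[of x y "Suc r"])
      case 1
      then have "(x < y) = (y < r)" using y by auto
      then show ?thesis using 1 raisesI[OF l rt] by (simp add: knuth_triple_simps)
    next
      case 2
      then have "x < r" using xn by simp
      then have "delta r y = 0" "delta r x = 0" using 2 by (simp_all add: delta_def)
      then have "left_ok r 0 (p @ [x])" "right_ok r 0 ([y] @ q)" using d rt by (simp_all add: left_ok_append right_ok_append)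
      then show ?thesis using 2 raisesI[of r "p @ [x]" "y # q"] \<open>x < r\<close> by (simp add: knuth_triple_simps)
    next
      case 3
      then have "delta r y = 0" by (simp add: delta_def)
      then have "left_ok r 0 (p @ [x])" "right_ok r 0 ([y] @ q)" using d rt by (simp_all add: left_ok_append right_ok_append)
      then show ?thesis using 3 raisesI[of r "p @ [x]" "y # q"] by (simp add: knuth_triple_simps)
    next
      case 4
      then have "x < r" using xn by simp
      then have "delta r x = 0" by (simp add: delta_def)
      then have "left_ok r 0 (p @ [y, x])" using d by (simp add: left_ok_append add.commute)
      then show ?thesis using 4 raisesI[of r "p @ [y, x]" q] \<open>x < r\<close> rt by (simp add: knuth_triple_simps)
    next
      case 5
      then have "y < r" using y by simp
      then have "delta r y = 0" by (simp add: delta_def)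
      then have "left_ok r 0 (p @ [y, x])" using d by (simp add: left_ok_append add.commute)
      then show ?thesis using 5 raisesI[of r "p @ [y, x]" q] \<open>y < r\<close> rt by (simp add: knuth_triple_simps)
    qed
  qed
qed

lemma raises_knuth_move:
  assumes "raises r w w'"
  shows "raises r (knuth_move j w) (knuth_move j w')"
proof -
  obtain u v where w: "w = u @ Suc r # v" "w' = u @ r # v" and l: "left_ok r 0 u" and rt: "right_ok r 0 v"
    using assms unfolding raises_def by blast
  show ?thesis
  proof (cases "2 \<le> j \<and> j < length w")
    case False
    moreover have "length w' = length w" using w by simp
    ultimately have "knuth_move j w = w" "knuth_move j w' = w'" by (auto simp: knuth_move_def)
    then show ?thesis using assms by simp
  next
    case True
    consider (1) "j < length u" | (2) "j = length u" | (3) "j = length u + 1" | (4) "j = length u + 2"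
      | (5) "length u + 3 \<le> j" by linarith
    then show ?thesis
    proof cases
      case 1
      then show ?thesis unfolding w knuth_move_append[OF 1] using raisesI left_ok_knuth_move l rt by metis
    next
      case 2
      then have "length (drop (length u - 2) u) = 2" using True by auto
      moreover have "\<exists>x y. l = [x, y]" if "length l = 2" for l :: "nat list"
        using that by (auto simp: numeral_2_eq_2 length_Suc_conv)
      ultimately obtain x y where "drop (length u - 2) u = [x, y]" by blast
      then obtain p where u: "u = p @ [x, y]" by (metis append_take_drop_id)
      then show ?thesis using raises_triple3[of r p x y v] l rt 2 w by (simp add: knuth_move_triple)
    next
      case 3
      then have "u \<noteq> []" using True by auto
      then obtain p x where u: "u = p @ [x]" by (metis append_butlast_last_id)
      have "v \<noteq> []" using 3 True w by auto
      then obtain z q where v: "v = z # q" by (cases v) auto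
      show ?thesis using raises_triple2[of r p x z q] l rt 3 w u v by (simp add: knuth_move_triple)
    next
      case 4
      then have "length v \<ge> 2" using True w by simp
      then obtain y z q where v: "v = y # z # q" by (metis Suc_le_length_iff numeral_2_eq_2)
      then show ?thesis using raises_triple1[of r u y z q] l rt 4 w by (simp add: knuth_move_triple)
    next
      case 5
      define k where "k = j - (length u + 1)"
      have j: "j = length (u @ [a]) + k" "2 \<le> k" for a using 5 by (simp_all add: k_def)
      have "knuth_move j ((u @ [a]) @ v) = (u @ [a]) @ knuth_move k v" for a
        using knuth_move_prepend[OF j(2), of "u @ [a]" v] j(1)[of a] by simp
      then have "knuth_move j w = u @ Suc r # knuth_move k v" "knuth_move j w' = u @ r # knuth_move k v" using w by simp_all
      then show ?thesis using raisesI right_ok_knuth_move l rt by metis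
    qed
  qed
qed

text \<open>Changing \<open>Suc r\<close> to \<open>r\<close> affects a comparison only after a
  letter \<open>r\<close> or before a letter \<open>Suc r\<close>, and the conditions on the two
  sides exclude both.\<close>

lemma raises_des:
  assumes "raises r w w'"
  shows "word_des w = word_des w'"
proof -
  obtain u v where w: "w = u @ Suc r # v" "w' = u @ r # v" and l: "left_ok r 0 u" and rt: "right_ok r 0 v"
    using assms unfolding raises_def by blast
  have "wdes w j = wdes w' j" if j: "1 \<le> j" "j < length w" for j
  proof -
    consider (1) "j < length u" | (2) "j = length u" | (3) "j = length u + 1" | (5) "length u + 2 \<le> j" by linarith
    then show ?thesis
    proof cases
      case 1
      then show ?thesis using w by (simp add: wdes_append)
    next
      case 2
      then obtain p x where u: "u = p @ [x]" using j by (metis append_butlast_last_id list.size(3) not_one_le_zero)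
      have "x \<noteq> r" using l u by (auto simp: left_ok_append delta_def)
      then show ?thesis using w u 2 by (auto simp: wdes_def nth_append)
    next
      case 3
      then have "v \<noteq> []" using j w by auto
      then obtain y q where v: "v = y # q" by (cases v) auto
      have "y \<noteq> Suc r" using rt v by (auto simp: delta_def dest: right_ok_pos)
      then show ?thesis using w v 3 by (auto simp: wdes_def nth_append)
    next
      case 5
      then obtain k where "j = Suc (Suc (length u)) + k" by (metis add_2_eq_Suc' add.commute le_Suc_ex)
      then show ?thesis using w by (simp add: wdes_def nth_append)
    qed
  qed
  moreover have "length w = length w'" using w by simp
  ultimately show ?thesis by (auto simp: word_des_def)
qed

text \<open>If two positions were possible, the letters strictly between them would have excess at
  least 0 by one condition and at most 0 by the other, also after adding the contribution of the
  letter at a position, which is 1 or -1. So the position can be recovered from either word, and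
  raising is a partial injection.\<close>

lemma raises_unique:
  assumes "raises r w1 w1'" "raises r w2 w2'"
  shows "w1 = w2 \<longleftrightarrow> w1' = w2'"
proof -
  obtain u1 v1 where 1: "w1 = u1 @ Suc r # v1" "w1' = u1 @ r # v1" "left_ok r 0 u1" "right_ok r 0 v1"
    using assms unfolding raises_def by blast
  obtain u2 v2 where 2: "w2 = u2 @ Suc r # v2" "w2' = u2 @ r # v2" "left_ok r 0 u2" "right_ok r 0 v2"
    using assms unfolding raises_def by blast
  have key: False if ass: "u1 @ a # v1 = u2 @ a # v2" "length u1 < length u2" "a = r \<or> a = Suc r"
     "left_ok r 0 u2" "right_ok r 0 v1" for a u1 v1 u2 v2
  proof -
    obtain s where s: "u2 = u1 @ a # s" "v1 = s @ a # v2"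
    proof -
      have "u2 = u1 @ drop (length u1) u2" using ass(1,2)
        by (metis append_eq_append_conv_if append_take_drop_id less_imp_le)
      moreover obtain b s where bs: "drop (length u1) u2 = b # s"
        using ass(2) by (metis Cons_nth_drop_Suc)
      ultimately have u2: "u2 = u1 @ b # s" by simp
      then have "a = b" "v1 = s @ a # v2" using ass(1) by simp_all
      then show ?thesis using that u2 by blast
    qed
    have l1: "0 \<le> excess r s" "0 \<le> excess r s + delta r a"
      using ass(4) left_ok_excess[of r 0 s] by (auto simp: s left_ok_append)
    have "0 \<le> - excess r s - delta r a" "0 \<le> - excess r s"
      using ass(5) by (auto simp: s right_ok_append dest: right_ok_pos)
    then show False using l1 ass(3) by (auto simp: delta_def)
  qed
  show ?thesis
  proof
    assume eq: "w1 = w2"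
    have "length u1 = length u2"
      using key[of u1 "Suc r" v1 u2 v2] key[of u2 "Suc r" v2 u1 v1] 1 2 eq by (metis nat_neq_iff)
    then show "w1' = w2'" using eq 1 2 by simp
  next
    assume eq: "w1' = w2'"
    have "length u1 = length u2"
      using key[of u1 r v1 u2 v2] key[of u2 r v2 u1 v1] 1 2 eq by (metis nat_neq_iff)
    then show "w1 = w2" using eq 1 2 by simp
  qed
qed

lemma excess_count: "excess r w = int (count (mset w) (Suc r)) - int (count (mset w) r)"
  by (induction w) (auto simp: delta_def)

text \<open>A word that is not lattice has a prefix of positive excess for some \<open>r\<close>.
  The shortest prefix of maximal excess is then nonempty and ends in \<open>Suc r\<close>.\<close>

lemma ex_raises:
  assumes "\<not> lattice_word w"
  shows "\<exists>r w'. raises r w w'"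
proof -
  obtain k0 r where k0: "excess r (take k0 w) > 0"
    using assms unfolding lattice_word_def part_def excess_count by (auto simp: not_le)
  define h where "h k = excess r (take k w)" for k
  define m where "m = Max (h ` {..length w})"
  have hle: "h k \<le> m" for k
  proof -
    have "h k = h (min k (length w))" by (simp add: h_def min_def)
    also have "\<dots> \<le> m" unfolding m_def by (rule Max_ge) auto
    finally show ?thesis .
  qed
  have "m \<in> h ` {..length w}" unfolding m_def by (rule Max_in) auto
  then have ex: "\<exists>k. h k = m" by auto
  define k where "k = (LEAST k. h k = m)"
  have hk: "h k = m" unfolding k_def by (rule LeastI_ex[OF ex])
  have min: "h j < m" if "j < k" for j
    using not_less_Least[of j "\<lambda>k. h k = m"] that hle[of j] by (auto simp: k_def)
  have "0 < m" using k0 hle[of k0] by (simp add: h_def)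
  then have kpos: "0 < k" using hk by (cases k) (auto simp: h_def)
  then obtain k' where k': "k = Suc k'" by (cases k) auto
  have kl: "k' < length w"
  proof (rule ccontr)
    assume "\<not> k' < length w"
    then have "h k' = h k" by (simp add: h_def k')
    then show False using min[of k'] hk k' by simp
  qed
  define u where "u = take k' w"
  define v where "v = drop k w"
  have w: "w = u @ w ! k' # v" using kl by (simp add: u_def v_def k' id_take_nth_drop)
  have tk: "take k w = u @ [w ! k']" using kl by (simp add: u_def k' take_Suc_conv_app_nth)
  have hu: "excess r u < m" using min[of k'] k' by (simp add: h_def u_def)
  have hm: "excess r u + delta r (w ! k') = m" using hk tk by (simp add: h_def)
  then have wk: "w ! k' = Suc r" using hu by (auto simp: delta_def split: if_splits)
  have "left_ok r 0 u" unfolding left_ok_def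
  proof (intro allI impI)
    fix t s assume u': "u = t @ s"
    then have "t = take (length t) w" using w by (metis append.assoc append_eq_conv_conj)
    moreover have "length t < k" using u' kl k' by (metis append_take_drop_id length_append length_take
          less_Suc_eq_le min_absorb2 le_add1 less_imp_le u_def)
    ultimately have "excess r t < m" using min[of "length t"] by (simp add: h_def)
    then show "0 \<le> 0 + excess r s" using hm wk u' by (simp add: delta_def)
  qed
  moreover have "right_ok r 0 v" unfolding right_ok_def
  proof (intro allI impI)
    fix s t assume v': "v = s @ t"
    then have "take (k + length s) w = take k w @ s"
      by (simp add: take_add v_def[symmetric])
    then have "excess r (take k w) + excess r s \<le> m" using hle[of "k + length s"] by (simp add: h_def)
    then show "0 \<le> 0 - excess r s" using hk by (simp add: h_def)
  qed
  ultimately show ?thesis using raisesI w wk by metis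
qed

definition knuth_class :: "nat list \<Rightarrow> nat list set" where
  "knuth_class w = {v. (w, v) \<in> knuth_rel\<^sup>*}"

lemma raises_path:
  assumes "raises r w w'"
  shows "(w, v) \<in> knuth_rel\<^sup>* \<Longrightarrow> \<exists>v'. (w', v') \<in> knuth_rel\<^sup>* \<and> raises r v v'"
    "(w', v') \<in> knuth_rel\<^sup>* \<Longrightarrow> \<exists>v. (w, v) \<in> knuth_rel\<^sup>* \<and> raises r v v'"
proof -
  show "\<exists>v'. (w', v') \<in> knuth_rel\<^sup>* \<and> raises r v v'" if "(w, v) \<in> knuth_rel\<^sup>*"
    using that
  proof (induction rule: rtrancl_induct)
    case (step v x)
    then obtain v' j where "(w', v') \<in> knuth_rel\<^sup>*" "raises r v v'" "x = knuth_move j v" by (auto simp: knuth_rel_def)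
    then show ?case using raises_knuth_move knuth_relI rtrancl.rtrancl_into_rtrancl by metis
  qed (use assms in blast)
  show "\<exists>v. (w, v) \<in> knuth_rel\<^sup>* \<and> raises r v v'" if "(w', v') \<in> knuth_rel\<^sup>*"
    using that
  proof (induction rule: rtrancl_induct)
    case (step v' x)
    then obtain v j where "(w, v) \<in> knuth_rel\<^sup>*" "raises r v v'" "x = knuth_move j v'" by (auto simp: knuth_rel_def)
    then show ?case using raises_knuth_move knuth_relI rtrancl.rtrancl_into_rtrancl by metis
  qed (use assms in blast)
qed

text \<open>Raising commutes with moves, is injective and keeps descents, so it maps one Knuth class
  bijectively onto the other.\<close>

lemma raises_class_sum:
  fixes F :: "nat set \<Rightarrow> int"
  assumes "raises r w w'"
  shows "(\<Sum>v\<in>knuth_class w. F (word_des v)) = (\<Sum>v\<in>knuth_class w'. F (word_des v))"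
proof -
  define h where "h v = (THE v'. raises r v v')" for v
  have h: "h v = v'" if "raises r v v'" for v v'
    unfolding h_def using that raises_unique by (intro the_equality) blast+
  have "bij_betw h (knuth_class w) (knuth_class w')"
  proof (rule bij_betw_imageI)
    show "inj_on h (knuth_class w)"
    proof (rule inj_onI)
      fix x y assume "x \<in> knuth_class w" "y \<in> knuth_class w" "h x = h y"
      then obtain x' y' where "raises r x x'" "raises r y y'" "x' = y'"
        using raises_path(1)[OF assms] h unfolding knuth_class_def by (metis mem_Collect_eq)
      then show "x = y" using raises_unique by blast
    qed
    show "h ` knuth_class w = knuth_class w'"
    proof (intro equalityI subsetI)
      fix y assume "y \<in> h ` knuth_class w"
      then show "y \<in> knuth_class w'" using raises_path(1)[OF assms] h unfolding knuth_class_def by fastforce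
    next
      fix y assume "y \<in> knuth_class w'"
      then show "y \<in> h ` knuth_class w" using raises_path(2)[OF assms] h unfolding knuth_class_def by force
    qed
  qed
  moreover have "word_des (h v) = word_des v" if v: "v \<in> knuth_class w" for v
  proof -
    obtain v' where "raises r v v'" using raises_path(1)[OF assms] v unfolding knuth_class_def by blast
    then show ?thesis using h raises_des by metis
  qed
  ultimately show ?thesis
    using sum.reindex_bij_betw[of h "knuth_class w" "knuth_class w'" "\<lambda>v. F (word_des v)"] by simp
qed

lemma knuth_class_lattice:
  assumes "lattice_word w"
  shows "knuth_class w = {v. lattice_word v \<and> mset v = mset w}"
proof (intro equalityI subsetI)
  fix v assume "v \<in> knuth_class w"
  then show "v \<in> {v. lattice_word v \<and> mset v = mset w}"
    using knuth_rtrancl_inv[of w v] assms by (simp add: knuth_class_def)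
next
  fix v assume "v \<in> {v. lattice_word v \<and> mset v = mset w}"
  then show "v \<in> knuth_class w"
    using lattice_knuth_connected[OF assms, of v] by (simp add: knuth_class_def)
qed

lemma ex_partition:
  assumes "part N"
  obtains lam where "is_partition lam (size N)" "shape_mset lam = N"
proof -
  define l where "l = (LEAST r. count N r = 0)"
  have "\<exists>r. count N r = 0"
  proof (rule ccontr)
    assume "\<nexists>r. count N r = 0"
    then have "set_mset N = UNIV" by (auto simp: count_eq_zero_iff)
    then show False using finite_set_mset[of N] by (metis infinite_UNIV_nat)
  qed
  then have l0: "count N l = 0" unfolding l_def by (rule LeastI_ex)
  have lpos: "count N r > 0" if "r < l" for r using not_less_Least[of r "\<lambda>r. count N r = 0"] that by (simp add: l_def)
  define lam where "lam = map (count N) [0..<l]"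
  have zero: "count N r = 0" if "l \<le> r" for r using part_count_le[OF assms that] l0 by simp
  have "shape_mset lam = N"
    by (rule multiset_eqI) (use zero in \<open>auto simp: count_shape_mset lam_def\<close>)
  moreover have "sum_list lam = size N"
  proof -
    have "r \<in># N \<longleftrightarrow> r \<in> {0..<l}" for r
    proof (cases "r < l")
      case True
      then show ?thesis using lpos[OF True] by (simp only: count_greater_zero_iff atLeastLessThan_iff le0 simp_thms)
    next
      case False
      then show ?thesis using zero[of r] by (simp only: not_less count_eq_zero_iff atLeastLessThan_iff le0 simp_thms)
    qed
    then have "set_mset N = {0..<l}" by (rule set_eqI)
    then show ?thesis unfolding size_multiset_overloaded_eq lam_def
      by (simp only: interv_sum_list_conv_sum_set_nat set_upt)
  qed
  moreover have "sorted_wrt (\<ge>) lam"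
    using part_count_le[OF assms] by (simp add: lam_def sorted_wrt_iff_nth_less)
  moreover have "0 \<notin> set lam"
  proof
    assume "0 \<in> set lam"
    then obtain r where "r < l" "count N r = 0" by (auto simp: lam_def)
    then show False using lpos by (metis less_irrefl)
  qed
  ultimately show ?thesis using that by (simp add: is_partition_def)
qed

text \<open>Raising decreases the sum of the letters, so it ends at a lattice word. The class of a
  lattice word consists of all lattice words of its content, whose sum is a Schur function.\<close>

theorem knuth_class_schur:
  "\<exists>lam. is_partition lam (length w) \<and>
    (\<forall>M. (\<Sum>v\<in>knuth_class w. fundQ (length w) (word_des v) M) = schur lam M)"
proof (induction "sum_list w" arbitrary: w rule: less_induct)
  case less
  show ?case
  proof (cases "lattice_word w")
    case True
    then obtain lam where "is_partition lam (size (mset w))" "shape_mset lam = mset w"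
      using ex_partition lattice_part by blast
    then show ?thesis using schur_expansion knuth_class_lattice[OF True] by (intro exI[of _ lam]) simp
  next
    case False
    then obtain r w' where r: "raises r w w'" using ex_raises by blast
    then have "sum_list w' < sum_list w" "length w' = length w" by (auto simp: raises_def)
    then obtain lam where "is_partition lam (length w)"
      "\<And>M. (\<Sum>v\<in>knuth_class w'. fundQ (length w) (word_des v) M) = schur lam M"
      using less[of w'] by auto
    then show ?thesis using raises_class_sum[OF r, of "\<lambda>X. fundQ (length w) X _"] by auto
  qed
qed

section \<open>Classes of degree at most five\<close>

fun lattice_words :: "nat \<Rightarrow> nat list list" where
  "lattice_words 0 = [[]]"
| "lattice_words (Suc m) = [w @ [r]. w \<leftarrow> lattice_words m, r \<leftarrow> [0..<Suc m],
     r = 0 \<or> count_list w r < count_list w (r - 1)]"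

definition des_list :: "nat list \<Rightarrow> nat list" where
  "des_list w = filter (\<lambda>j. w ! (j - 1) < w ! j) [1..<length w]"

lemma set_des_list: "set (des_list w) = word_des w"
  by (auto simp: des_list_def word_des_def wdes_def)

lemma des_list_inj:
  assumes "word_des v = word_des w" "length v = length w"
  shows "des_list v = des_list w"
proof -
  have "des_list u = filter (\<lambda>j. j \<in> word_des u) [1..<length u]" for u
    unfolding des_list_def by (rule filter_cong) (auto simp: word_des_def wdes_def)
  then show ?thesis using assms by simp
qed

lemma set_lattice_words: "set (lattice_words m) = {w. lattice_word w \<and> length w = m}"
proof (induction m)
  case 0
  then show ?case by auto
next
  case (Suc m)
  show ?case
  proof (intro equalityI subsetI)
    fix w assume "w \<in> set (lattice_words (Suc m))"
    then obtain u r where u: "u \<in> set (lattice_words m)" "w = u @ [r]" "r = 0 \<or> count_list u r < count_list u (r - 1)"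
      by (auto split: if_splits)
    then have "lattice_word u" "length u = m" using Suc by auto
    then show "w \<in> {w. lattice_word w \<and> length w = Suc m}"
      using u(2,3) part_add[OF lattice_part[of u], of r] by (auto simp: lattice_snoc count_mset)
  next
    fix w assume w: "w \<in> {w. lattice_word w \<and> length w = Suc m}"
    then obtain u r where ur: "w = u @ [r]" "length u = m" by (auto simp: length_Suc_conv_rev)
    then have l: "lattice_word u" "part (add_mset r (mset u))" using w by (auto simp: lattice_snoc)
    then have c: "r = 0 \<or> count_list u r < count_list u (r - 1)"
      using part_add[OF lattice_part[of u], of r] by (simp add: count_mset)
    have "r < Suc m"
    proof (cases "r = 0")
      case False
      then have "r - 1 \<in> set u" using c by (metis count_notin not_less0)
      then obtain k where k: "k < length u" "u ! k = r - 1" by (auto simp: in_set_conv_nth)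
      have "u ! k \<le> card {j. 1 \<le> j \<and> j \<le> k \<and> wdes u j}" using lattice_max_letter[OF l(1) k(1)] by simp
      also have "\<dots> \<le> card {1..k}" by (rule card_mono) auto
      finally show ?thesis using k ur(2) by simp
    qed simp
    moreover have "u \<in> set (lattice_words m)" using Suc l(1) ur by simp
    ultimately show "w \<in> set (lattice_words (Suc m))" using ur c
      by (auto simp del: upt_Suc intro!: bexI[of _ u])
  qed
qed

text \<open>One family of descent sets for each partition of 3, 4 and 5. The condition
  \<open>distinct\<close> records that within a shape the descent set determines the
  tableau.\<close>

lemma des_families_exec:
  "\<forall>w\<in>set (lattice_words 3). let D = map des_list (filter (\<lambda>v. sort v = sort w) (lattice_words 3)) in
     distinct D \<and> D \<in> set [[[]], [[2], [1]], [[1, 2]]]"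
  "\<forall>w\<in>set (lattice_words 4). let D = map des_list (filter (\<lambda>v. sort v = sort w) (lattice_words 4)) in
     distinct D \<and> D \<in> set [[[]], [[3], [2], [1]], [[2], [1, 3]], [[2, 3], [1, 3], [1, 2]], [[1, 2, 3]]]"
  "\<forall>w\<in>set (lattice_words 5). let D = map des_list (filter (\<lambda>v. sort v = sort w) (lattice_words 5)) in
     distinct D \<and> D \<in> set [[[]], [[4], [3], [2], [1]], [[3], [2, 4], [2], [1, 4], [1, 3]],
       [[3, 4], [2, 4], [2, 3], [1, 4], [1, 3], [1, 2]], [[2, 4], [2, 3], [1, 3, 4], [1, 3], [1, 2, 4]],
       [[2, 3, 4], [1, 3, 4], [1, 2, 4], [1, 2, 3]], [[1, 2, 3, 4]]]"
  by code_simp+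

text \<open>Descent sets have equal multiplicities in \<open>K\<close> and among the lattice words
  of the shape; these are at most 1, so \<open>d\<close> is injective on \<open>K\<close> and its
  image is one of the listed families.\<close>

lemma schur_des_families:
  fixes d :: "'a \<Rightarrow> nat set"
  assumes K: "is_partition lam k" "finite K" "\<And>x. x \<in> K \<Longrightarrow> d x \<subseteq> {1..<k}"
    "\<And>M. (\<Sum>x\<in>K. fundQ k (d x) M) = schur lam M"
    and exec: "\<forall>w\<in>set (lattice_words k). let D = map des_list (filter (\<lambda>v. sort v = sort w) (lattice_words k)) in
       distinct D \<and> D \<in> set Fs"
  shows "inj_on d K \<and> d ` K \<in> (\<lambda>D. set ` set D) ` set Fs"
proof -
  let ?N = "shape_mset lam"
  let ?Y = "{w. lattice_word w \<and> mset w = ?N}"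
  have N: "part ?N" "size ?N = k" using part_shape_mset[OF K(1)] by auto
  obtain w0 where w0: "lattice_word w0" "mset w0 = ?N" using ex_lattice_word[OF N(1)] by blast
  let ?L = "filter (\<lambda>v. sort v = sort w0) (lattice_words k)"
  have len: "length w = k" if "mset w = ?N" for w using that N(2) size_mset[of w] by simp
  have srt: "sort v = sort w0 \<longleftrightarrow> mset v = ?N" for v
    using w0(2) by (metis mset_sort properties_for_sort sorted_sort)
  have Y: "?Y = set ?L" using srt len by (auto simp: set_lattice_words)
  have w0L: "w0 \<in> set (lattice_words k)" using w0 len by (simp add: set_lattice_words)
  have D: "distinct (map des_list ?L)" "map des_list ?L \<in> set Fs"
    using bspec[OF exec w0L] unfolding Let_def by blast+
  have injY: "inj_on word_des ?Y"
  proof (rule inj_onI)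
    fix v w assume vw: "v \<in> ?Y" "w \<in> ?Y" "word_des v = word_des w"
    then have "des_list v = des_list w" using des_list_inj[of v w] len by simp
    moreover have "inj_on des_list (set ?L)" using D(1) unfolding distinct_map by blast
    ultimately show "v = w" using vw unfolding Y by (metis inj_onD)
  qed
  have finY: "finite ?Y" unfolding Y by simp
  have cnt: "card {x \<in> K. d x = X} = card {w \<in> ?Y. word_des w = X}" if "X \<subseteq> {1..<k}" for X
    using schur_des_count[OF K that] by (simp add: conj_assoc)
  have le1: "card {w \<in> ?Y. word_des w = X} \<le> 1" for X
  proof -
    have "v = w" if "v \<in> {w \<in> ?Y. word_des w = X}" "w \<in> {w \<in> ?Y. word_des w = X}" for v w
      using inj_onD[OF injY, of v w] that by simp
    moreover have "finite {w \<in> ?Y. word_des w = X}" using finY by (rule rev_finite_subset) auto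
    ultimately show ?thesis unfolding One_nat_def by (subst card_le_Suc0_iff_eq) blast+
  qed
  have "inj_on d K"
  proof (rule inj_onI)
    fix x y assume xy: "x \<in> K" "y \<in> K" "d x = d y"
    have "card {z \<in> K. d z = d x} \<le> Suc 0" using cnt[OF K(3)[OF xy(1)]] le1[of "d x"] by simp
    moreover have "finite {z \<in> K. d z = d x}" using K(2) by simp
    ultimately show "x = y" using xy by (auto simp: card_le_Suc0_iff_eq)
  qed
  moreover have "d ` K = word_des ` ?Y"
  proof -
    have e: "X \<in> d ` K \<longleftrightarrow> X \<in> word_des ` ?Y" if X: "X \<subseteq> {1..<k}" for X
    proof -
      have "X \<in> d ` K \<longleftrightarrow> card {x \<in> K. d x = X} \<noteq> 0" using K(2) by auto
      also have "\<dots> \<longleftrightarrow> card {w \<in> ?Y. word_des w = X} \<noteq> 0" using cnt[OF X] by simp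
      also have "\<dots> \<longleftrightarrow> X \<in> word_des ` ?Y"
      proof -
        have "finite {w \<in> ?Y. word_des w = X}" using finY by (rule rev_finite_subset) auto
        then have "card {w \<in> ?Y. word_des w = X} \<noteq> 0 \<longleftrightarrow> {w \<in> ?Y. word_des w = X} \<noteq> {}" by simp
        then show ?thesis by blast
      qed
      finally show ?thesis .
    qed
    have s1: "X \<subseteq> {1..<k}" if X: "X \<in> word_des ` ?Y" for X
    proof -
      obtain w where w: "w \<in> ?Y" "X = word_des w" using X by (rule imageE)
      then have "length w = k" using len[of w] by simp
      then show ?thesis unfolding w(2) word_des_def by auto
    qed
    have s2: "X \<subseteq> {1..<k}" if X: "X \<in> d ` K" for X
    proof -
      obtain x where "x \<in> K" "X = d x" using X by (rule imageE)
      then show ?thesis using K(3) by simp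
    qed
    show ?thesis
    proof (rule set_eqI)
      fix X show "X \<in> d ` K \<longleftrightarrow> X \<in> word_des ` ?Y" using e[of X] s1[of X] s2[of X] by argo
    qed
  qed
  moreover have "word_des ` ?Y = set ` set (map des_list ?L)"
    unfolding Y by (simp add: image_image set_des_list)
  ultimately have "inj_on d K" "d ` K = set ` set (map des_list ?L)" by (simp_all only:)
  then show ?thesis using imageI[OF D(2), of "\<lambda>D. set ` set D"] by (simp only: simp_thms)
qed

section \<open>Components of two and three consecutive colours\<close>

definition flips :: "'a set \<Rightarrow> ('a \<Rightarrow> nat set) \<Rightarrow> ('a \<Rightarrow> 'a) \<Rightarrow> nat \<Rightarrow> bool" where
  "flips K d f j \<longleftrightarrow> (\<forall>x\<in>K. f x \<in> K \<and> f (f x) = x \<and> (f x = x \<longleftrightarrow> (j - 1 \<in> d x \<longleftrightarrow> j \<in> d x))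
     \<and> (f x \<noteq> x \<longrightarrow> (j - 1 \<in> d (f x)) \<noteq> (j - 1 \<in> d x) \<and> (j \<in> d (f x)) \<noteq> (j \<in> d x)))"

definition edges :: "'a set \<Rightarrow> ('a \<Rightarrow> 'a) \<Rightarrow> 'a set set" where
  "edges K f = (\<lambda>x. {x, f x}) ` {x \<in> K. f x \<noteq> x}"

text \<open>The first part of axiom 4 with the base vertex quantified away, so that it becomes a
  property of the component as a set.\<close>

definition pair_form :: "'a set \<Rightarrow> 'a set set \<Rightarrow> 'a set set \<Rightarrow> bool" where
  "pair_form C F1 F2 \<longleftrightarrow> (\<exists>v. C = {v} \<and> F1 = {} \<and> F2 = {})
     \<or> (\<exists>x y z. distinct [x, y, z] \<and> C = {x, y, z} \<and> F1 = {{x, y}} \<and> F2 = {{y, z}})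
     \<or> (\<exists>x y. x \<noteq> y \<and> C = {x, y} \<and> F1 = {{x, y}} \<and> F2 = {{x, y}})"

definition triple_form :: "'a set \<Rightarrow> 'a set set \<Rightarrow> 'a set set \<Rightarrow> 'a set set \<Rightarrow> bool" where
  "triple_form C F0 F1 F2 \<longleftrightarrow> (\<exists>v. C = {v} \<and> F0 = {} \<and> F1 = {} \<and> F2 = {})
     \<or> (\<exists>p q r s. distinct [p, q, r, s] \<and> C = {p, q, r, s}
          \<and> F0 = {{p, q}} \<and> F1 = {{q, r}} \<and> F2 = {{r, s}})
     \<or> (\<exists>a b c d e. distinct [a, b, c, d, e] \<and> C = {a, b, c, d, e}
          \<and> F0 = {{a, b}, {c, d}} \<and> F1 = {{a, b}, {d, e}} \<and> F2 = {{b, c}, {d, e}})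
     \<or> (\<exists>u v' w x y z. distinct [u, v', w, x, y, z] \<and> C = {u, v', w, x, y, z}
          \<and> F0 = {{v', w}, {x, y}} \<and> F1 = {{u, v'}, {y, z}} \<and> F2 = {{v', x}, {w, y}})"

lemma pair_form_single: "C = {v} \<Longrightarrow> F1 = {} \<Longrightarrow> F2 = {} \<Longrightarrow> pair_form C F1 F2"
  unfolding pair_form_def by (intro disjI1 exI[of _ v] conjI)

lemma pair_form_path:
  "distinct [x, y, z] \<Longrightarrow> C = {x, y, z} \<Longrightarrow> F1 = {{x, y}} \<Longrightarrow> F2 = {{y, z}} \<Longrightarrow> pair_form C F1 F2"
  unfolding pair_form_def by (rule disjI2, rule disjI1) (intro exI conjI)

lemma pair_form_double: "x \<noteq> y \<Longrightarrow> C = {x, y} \<Longrightarrow> F1 = {{x, y}} \<Longrightarrow> F2 = {{x, y}} \<Longrightarrow> pair_form C F1 F2"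
  unfolding pair_form_def by (rule disjI2, rule disjI2) (intro exI conjI)

lemma triple_form_single: "C = {v} \<Longrightarrow> F0 = {} \<Longrightarrow> F1 = {} \<Longrightarrow> F2 = {} \<Longrightarrow> triple_form C F0 F1 F2"
  unfolding triple_form_def by (rule disjI1) (intro exI conjI)

lemma triple_form_path:
  "distinct [p, q, r, s] \<Longrightarrow> C = {p, q, r, s} \<Longrightarrow> F0 = {{p, q}} \<Longrightarrow> F1 = {{q, r}} \<Longrightarrow> F2 = {{r, s}} \<Longrightarrow>
    triple_form C F0 F1 F2"
  unfolding triple_form_def by (rule disjI2, rule disjI1) (intro exI conjI)

lemma triple_form_five:
  "distinct [a, b, c, d, e] \<Longrightarrow> C = {a, b, c, d, e} \<Longrightarrow> F0 = {{a, b}, {c, d}} \<Longrightarrow> F1 = {{a, b}, {d, e}} \<Longrightarrow>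
    F2 = {{b, c}, {d, e}} \<Longrightarrow> triple_form C F0 F1 F2"
  unfolding triple_form_def by (rule disjI2, rule disjI2, rule disjI1) (intro exI conjI)

lemma triple_form_six:
  "distinct [u, v', w, x, y, z] \<Longrightarrow> C = {u, v', w, x, y, z} \<Longrightarrow> F0 = {{v', w}, {x, y}} \<Longrightarrow>
    F1 = {{u, v'}, {y, z}} \<Longrightarrow> F2 = {{v', x}, {w, y}} \<Longrightarrow> triple_form C F0 F1 F2"
  unfolding triple_form_def by (rule disjI2, rule disjI2, rule disjI2) (intro exI conjI)

lemma edges_insert:
  "edges {} f = {}" "edges (insert x K) f = (if f x = x then edges K f else insert {x, f x} (edges K f))"
  by (auto simp: edges_def)

lemma flips_fixed: "flips K d f j \<Longrightarrow> x \<in> K \<Longrightarrow> (j - 1 \<in> d x \<longleftrightarrow> j \<in> d x) \<Longrightarrow> f x = x"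
  unfolding flips_def by blast

text \<open>An active involution changes membership at both \<open>j - 1\<close> and
  \<open>j\<close>. If a single set of the family qualifies, injectivity of \<open>d\<close>
  determines the image.\<close>

lemma flips_value:
  assumes "flips K d f j" "inj_on d K" "d ` K = F" "x \<in> K" "y \<in> K" "(j - 1 \<in> d x) \<noteq> (j \<in> d x)"
    "\<forall>X\<in>F. (j - 1 \<in> X) \<noteq> (j - 1 \<in> d x) \<and> (j \<in> X) \<noteq> (j \<in> d x) \<longrightarrow> X = d y"
  shows "f x = y" "f y = x"
proof -
  have "d (f x) \<in> F" "(j - 1 \<in> d (f x)) \<noteq> (j - 1 \<in> d x) \<and> (j \<in> d (f x)) \<noteq> (j \<in> d x)" "f x \<in> K"
    using assms(1,3,4,6) unfolding flips_def by blast+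
  then show "f x = y" using assms(2,5,7) by (metis inj_onD)
  then show "f y = x" using assms(1,4) unfolding flips_def by metis
qed

lemma flips_values2:
  assumes "flips K d f j" "inj_on d K" "d ` K = F" "x \<in> K" "y \<in> K" "z \<in> K" "(j - 1 \<in> d x) \<noteq> (j \<in> d x)"
    "\<forall>X\<in>F. (j - 1 \<in> X) \<noteq> (j - 1 \<in> d x) \<and> (j \<in> X) \<noteq> (j \<in> d x) \<longrightarrow> X = d y \<or> X = d z"
  shows "f x = y \<or> f x = z"
proof -
  have "d (f x) \<in> F" "(j - 1 \<in> d (f x)) \<noteq> (j - 1 \<in> d x) \<and> (j \<in> d (f x)) \<noteq> (j \<in> d x)" "f x \<in> K"
    using assms(1,3,4,7) unfolding flips_def by blast+
  then show "f x = y \<or> f x = z" using assms(2,5,6,8) by (metis inj_onD)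
qed

lemma flips_invol: "flips K d f j \<Longrightarrow> x \<in> K \<Longrightarrow> f x = y \<Longrightarrow> f y = x"
  unfolding flips_def by metis

lemma image_obtain:
  assumes "d ` K = F" "X \<in> F"
  obtains x where "x \<in> K" "d x = X"
  using assms by auto

lemma flips_complement:
  assumes "flips K d f j" "\<And>x. x \<in> K \<Longrightarrow> d x \<subseteq> B" "j - 1 \<in> B" "j \<in> B"
  shows "flips K (\<lambda>x. B - d x) f j"
  using assms unfolding flips_def by blast

lemma inj_on_complement:
  assumes "inj_on d K" "\<And>x. x \<in> K \<Longrightarrow> d x \<subseteq> B"
  shows "inj_on (\<lambda>x. B - d x) K"
  using assms unfolding inj_on_def by (metis double_diff subset_refl)

text \<open>Complementing descent sets exchanges a shape with its transpose.\<close>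

lemma window_pair:
  assumes f: "flips K d f2 2" "flips K d f3 3" and inj: "inj_on d K"
    and F: "d ` K \<in> {{{}}, {{3}, {2}, {1}}, {{2}, {1, 3}}, {{2, 3}, {1, 3}, {1, 2}}, {{1, 2, 3}}}"
  shows "pair_form K (edges K f2) (edges K f3) \<and>
    (\<forall>x\<in>K. (3 \<in> d (f2 x)) \<noteq> (3 \<in> d x) \<longrightarrow> (3 \<in> d x) \<noteq> (2 \<in> d x)) \<and>
    (\<forall>x\<in>K. (1 \<in> d (f3 x)) \<noteq> (1 \<in> d x) \<longrightarrow> (1 \<in> d x) \<noteq> (2 \<in> d x))"
proof -
  have main: "pair_form K (edges K f2) (edges K f3) \<and>
    (\<forall>x\<in>K. (3 \<in> d (f2 x)) \<noteq> (3 \<in> d x) \<longrightarrow> (3 \<in> d x) \<noteq> (2 \<in> d x)) \<and>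
    (\<forall>x\<in>K. (1 \<in> d (f3 x)) \<noteq> (1 \<in> d x) \<longrightarrow> (1 \<in> d x) \<noteq> (2 \<in> d x))" if f: "flips K d f2 2" "flips K d f3 3" and inj: "inj_on d K"
    and F: "d ` K \<in> {{{}}, {{3}, {2}, {1}}, {{2}, {1, 3}}}" for d :: "'a \<Rightarrow> nat set"
  proof -
    have KI: "K = S" if S: "S \<subseteq> K" "d ` K \<subseteq> d ` S" for S
    proof
      show "K \<subseteq> S"
      proof
        fix y assume y: "y \<in> K"
        then obtain s where "s \<in> S" "d y = d s" using S(2) by blast
        then show "y \<in> S" using inj_onD[OF inj, of y s] y S(1) by blast
      qed
    qed (fact S(1))
    from F consider "d ` K = {{}}" | "d ` K = {{3}, {2}, {1}}" | "d ` K = {{2}, {1, 3}}" by atomize_elim (simp only: insert_iff empty_iff simp_thms)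
    then show ?thesis
    proof cases
      case 1
      obtain v where v: "v \<in> K" "d v = {}" by (rule image_obtain[OF 1, of "{}"]) simp_all
      have K: "K = {v}" by (rule KI) (use 1 v in auto)
      have "f2 v = v" "f3 v = v" using flips_fixed[OF f(1) v(1)] flips_fixed[OF f(2) v(1)] v by auto
      then show ?thesis unfolding K by (intro conjI pair_form_single[of _ v]) (simp_all add: edges_insert)
    next
      case 2
      obtain x where x: "x \<in> K" "d x = {1}" by (rule image_obtain[OF 2, of "{1}"]) simp_all
      obtain y where y: "y \<in> K" "d y = {2}" by (rule image_obtain[OF 2, of "{2}"]) simp_all
      obtain z where z: "z \<in> K" "d z = {3}" by (rule image_obtain[OF 2, of "{3}"]) simp_all
      have K: "K = {x, y, z}" by (rule KI) (use 2 x y z in auto)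
      have ne: "x \<noteq> y" "y \<noteq> z" "x \<noteq> z" using x y z by auto
      have "f2 z = z" "f3 x = x" using flips_fixed[OF f(1) z(1)] flips_fixed[OF f(2) x(1)] x z by auto
      moreover have "f2 x = y" "f2 y = x"
        using flips_value[OF f(1) inj 2 x(1) y(1)] x y by auto
      moreover have "f3 y = z" "f3 z = y"
        using flips_value[OF f(2) inj 2 y(1) z(1)] y z by auto
      ultimately have "edges K f2 = {{x, y}}" "edges K f3 = {{y, z}}"
        and "\<forall>x\<in>K. (3 \<in> d (f2 x)) \<noteq> (3 \<in> d x) \<longrightarrow> (3 \<in> d x) \<noteq> (2 \<in> d x)"
        "\<forall>x\<in>K. (1 \<in> d (f3 x)) \<noteq> (1 \<in> d x) \<longrightarrow> (1 \<in> d x) \<noteq> (2 \<in> d x)"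
        unfolding K using ne x y z by (auto simp: edges_insert)
      moreover have "distinct [x, y, z]" using ne by simp
      ultimately show ?thesis by (intro conjI pair_form_path[OF _ K]) (assumption | simp)+
    next
      case 3
      obtain x where x: "x \<in> K" "d x = {2}" by (rule image_obtain[OF 3, of "{2}"]) simp_all
      obtain y where y: "y \<in> K" "d y = {1, 3}" by (rule image_obtain[OF 3, of "{1, 3}"]) simp_all
      have K: "K = {x, y}" by (rule KI) (use 3 x y in auto)
      have ne: "x \<noteq> y" using x y by auto
      have "f2 x = y" "f2 y = x" "f3 x = y" "f3 y = x"
        using flips_value[OF f(1) inj 3 x(1) y(1)] flips_value[OF f(2) inj 3 x(1) y(1)] x y by auto
      then have "edges K f2 = {{x, y}}" "edges K f3 = {{x, y}}"
        and "\<forall>x\<in>K. (3 \<in> d (f2 x)) \<noteq> (3 \<in> d x) \<longrightarrow> (3 \<in> d x) \<noteq> (2 \<in> d x)"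
        "\<forall>x\<in>K. (1 \<in> d (f3 x)) \<noteq> (1 \<in> d x) \<longrightarrow> (1 \<in> d x) \<noteq> (2 \<in> d x)"
        unfolding K using ne x y by (auto simp: edges_insert)
      then show ?thesis by (intro conjI pair_form_double[OF ne K]) (assumption | simp)+
    qed
  qed
  show ?thesis
  proof (cases "d ` K \<in> {{{}}, {{3}, {2}, {1}}, {{2}, {1, 3}}}")
    case True
    show ?thesis by (rule main[OF f inj True])
  next
    case False
    let ?B = "{1, 2, 3} :: nat set"
    have "\<forall>X\<in>d ` K. X \<subseteq> ?B" using F by (elim insertE emptyE) simp_all
    then have B: "d x \<subseteq> ?B" if "x \<in> K" for x using that by blast
    let ?d = "\<lambda>x. ?B - d x"
    have im: "?d ` K = (\<lambda>X. ?B - X) ` (d ` K)" by (simp add: image_image)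
    have "d ` K = {{2, 3}, {1, 3}, {1, 2}} \<or> d ` K = {{1, 2, 3}}" using F False by (simp only: insert_iff empty_iff) argo
    moreover have "{1, 2, 3} - {2, 3} = {1::nat}" "{1, 2, 3} - {1, 3} = {2::nat}" "{1, 2, 3} - {1, 2} = {3::nat}"
      by auto
    ultimately have "?d ` K \<in> {{{}}, {{3}, {2}, {1}}, {{2}, {1, 3}}}"
      unfolding im by (elim disjE) (simp_all only: image_insert image_empty, simp_all add: insert_commute)
    then have "pair_form K (edges K f2) (edges K f3) \<and>
      (\<forall>x\<in>K. (3 \<in> ?d (f2 x)) \<noteq> (3 \<in> ?d x) \<longrightarrow> (3 \<in> ?d x) \<noteq> (2 \<in> ?d x)) \<and>
      (\<forall>x\<in>K. (1 \<in> ?d (f3 x)) \<noteq> (1 \<in> ?d x) \<longrightarrow> (1 \<in> ?d x) \<noteq> (2 \<in> ?d x))"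
      by (intro main flips_complement[OF f(1) B] flips_complement[OF f(2) B] inj_on_complement[OF inj B]) simp_all
    then show ?thesis by simp
  qed
qed

text \<open>For families of five or six sets the flips leave two candidates for some images. The
  rule for double edges, which comes from degree 4, pushes a wrong choice on until it produces a
  proper closed subset, contradicting connectedness, or a conflict with a known value.\<close>

lemma window_triple:
  assumes f: "flips K d f2 2" "flips K d f3 3" "flips K d f4 4" and inj: "inj_on d K"
    and F: "d ` K \<in> {{{}}, {{4}, {3}, {2}, {1}}, {{3}, {2, 4}, {2}, {1, 4}, {1, 3}},
       {{3, 4}, {2, 4}, {2, 3}, {1, 4}, {1, 3}, {1, 2}}, {{2, 4}, {2, 3}, {1, 3, 4}, {1, 3}, {1, 2, 4}},
       {{2, 3, 4}, {1, 3, 4}, {1, 2, 4}, {1, 2, 3}}, {{1, 2, 3, 4}}}"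
    and dbl23: "\<And>x. x \<in> K \<Longrightarrow> f2 x \<noteq> x \<Longrightarrow> f3 x \<noteq> x \<Longrightarrow> f3 (f2 x) \<noteq> f2 x \<or> f2 (f3 x) \<noteq> f3 x \<Longrightarrow> f3 x = f2 x"
    and dbl34: "\<And>x. x \<in> K \<Longrightarrow> f3 x \<noteq> x \<Longrightarrow> f4 x \<noteq> x \<Longrightarrow> f4 (f3 x) \<noteq> f3 x \<or> f3 (f4 x) \<noteq> f4 x \<Longrightarrow> f4 x = f3 x"
    and conn: "\<And>S. S \<subseteq> K \<Longrightarrow> S \<noteq> {} \<Longrightarrow> (\<And>x. x \<in> S \<Longrightarrow> f2 x \<in> S \<and> f3 x \<in> S \<and> f4 x \<in> S) \<Longrightarrow> S = K"
  shows "triple_form K (edges K f2) (edges K f3) (edges K f4) \<and>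
    (\<forall>x\<in>K. 4 \<in> d (f2 x) \<longleftrightarrow> 4 \<in> d x) \<and> (\<forall>x\<in>K. 1 \<in> d (f4 x) \<longleftrightarrow> 1 \<in> d x)"
proof -
  have main: "triple_form K (edges K f2) (edges K f3) (edges K f4) \<and>
    (\<forall>x\<in>K. 4 \<in> d (f2 x) \<longleftrightarrow> 4 \<in> d x) \<and> (\<forall>x\<in>K. 1 \<in> d (f4 x) \<longleftrightarrow> 1 \<in> d x)" if f: "flips K d f2 2" "flips K d f3 3" "flips K d f4 4" and inj: "inj_on d K"
    and F: "d ` K \<in> {{{}}, {{4}, {3}, {2}, {1}}, {{3}, {2, 4}, {2}, {1, 4}, {1, 3}},
       {{3, 4}, {2, 4}, {2, 3}, {1, 4}, {1, 3}, {1, 2}}}" for d :: "'a \<Rightarrow> nat set"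
  proof -
    have KI: "K = S" if S: "S \<subseteq> K" "d ` K \<subseteq> d ` S" for S
    proof
      show "K \<subseteq> S"
      proof
        fix y assume y: "y \<in> K"
        then obtain s where "s \<in> S" "d y = d s" using S(2) by blast
        then show "y \<in> S" using inj_onD[OF inj, of y s] y S(1) by blast
      qed
    qed (fact S(1))
    from F consider (1) "d ` K = {{}}" | (2) "d ` K = {{4}, {3}, {2}, {1}}"
      | (3) "d ` K = {{3}, {2, 4}, {2}, {1, 4}, {1, 3}}"
      | (4) "d ` K = {{3, 4}, {2, 4}, {2, 3}, {1, 4}, {1, 3}, {1, 2}}" by atomize_elim (simp only: insert_iff empty_iff simp_thms)
    then show ?thesis
    proof cases
      case 1
      obtain v where v: "v \<in> K" "d v = {}" by (rule image_obtain[OF 1, of "{}"]) simp_all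
      have K: "K = {v}" by (rule KI) (use 1 v in auto)
      have "f2 v = v" "f3 v = v" "f4 v = v"
        using flips_fixed[OF f(1) v(1)] flips_fixed[OF f(2) v(1)] flips_fixed[OF f(3) v(1)] v by auto
      then show ?thesis unfolding K by (intro conjI triple_form_single[of _ v]) (simp_all add: edges_insert)
    next
      case 2
      obtain p where p: "p \<in> K" "d p = {1}" by (rule image_obtain[OF 2, of "{1}"]) simp_all
      obtain q where q: "q \<in> K" "d q = {2}" by (rule image_obtain[OF 2, of "{2}"]) simp_all
      obtain r where r: "r \<in> K" "d r = {3}" by (rule image_obtain[OF 2, of "{3}"]) simp_all
      obtain s where s: "s \<in> K" "d s = {4}" by (rule image_obtain[OF 2, of "{4}"]) simp_all
      have K: "K = {p, q, r, s}" by (rule KI) (use 2 p q r s in auto)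
      have ne: "p \<noteq> q" "p \<noteq> r" "p \<noteq> s" "q \<noteq> r" "q \<noteq> s" "r \<noteq> s" using p q r s by auto
      have v: "f2 r = r" "f2 s = s" "f3 p = p" "f3 s = s" "f4 p = p" "f4 q = q"
        using flips_fixed[OF f(1) r(1)] flips_fixed[OF f(1) s(1)] flips_fixed[OF f(2) p(1)]
         flips_fixed[OF f(2) s(1)] flips_fixed[OF f(3) p(1)] flips_fixed[OF f(3) q(1)] p q r s by auto
      moreover have v2: "f2 p = q" "f2 q = p"
        using flips_value[OF f(1) inj 2 p(1) q(1)] p q by auto
      moreover have v3: "f3 q = r" "f3 r = q"
        using flips_value[OF f(2) inj 2 q(1) r(1)] q r by auto
      moreover have v4: "f4 r = s" "f4 s = r"
        using flips_value[OF f(3) inj 2 r(1) s(1)] r s by auto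
      have "edges K f2 = {{p, q}}" "edges K f3 = {{q, r}}" "edges K f4 = {{r, s}}"
        unfolding K using ne v v2 v3 v4 by (simp_all add: edges_insert insert_commute)
      moreover have "\<forall>x\<in>K. 4 \<in> d (f2 x) \<longleftrightarrow> 4 \<in> d x" "\<forall>x\<in>K. 1 \<in> d (f4 x) \<longleftrightarrow> 1 \<in> d x"
        unfolding K using v v2 v4 p q r s by simp_all
      moreover have "distinct [p, q, r, s]" using ne by simp
      ultimately show ?thesis by (intro conjI triple_form_path[OF _ K]) (assumption | simp)+
    next
      case 3
      obtain a where a: "a \<in> K" "d a = {2}" by (rule image_obtain[OF 3, of "{2}"]) simp_all
      obtain b where b: "b \<in> K" "d b = {1, 3}" by (rule image_obtain[OF 3, of "{1, 3}"]) simp_all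
      obtain c where c: "c \<in> K" "d c = {1, 4}" by (rule image_obtain[OF 3, of "{1, 4}"]) simp_all
      obtain e where e: "e \<in> K" "d e = {2, 4}" by (rule image_obtain[OF 3, of "{2, 4}"]) simp_all
      obtain g where g: "g \<in> K" "d g = {3}" by (rule image_obtain[OF 3, of "{3}"]) simp_all
      have K: "K = {a, b, c, e, g}" by (rule KI) (use 3 a b c e g in auto)
      have ne: "a \<noteq> b" "a \<noteq> c" "a \<noteq> e" "a \<noteq> g" "b \<noteq> c" "b \<noteq> e" "b \<noteq> g" "c \<noteq> e" "c \<noteq> g" "e \<noteq> g"
        using a b c e g by (auto simp: doubleton_eq_iff)
      have v: "f2 g = g" "f3 c = c" "f4 a = a"
        using flips_fixed[OF f(1) g(1)] flips_fixed[OF f(2) c(1)] flips_fixed[OF f(3) a(1)] a c g by auto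
      have 2: "f2 a = b \<or> f2 a = c" "f2 e = b \<or> f2 e = c"
        using flips_values2[OF f(1) inj 3 a(1) b(1) c(1)] flips_values2[OF f(1) inj 3 e(1) b(1) c(1)] a b c e by auto
      have 3: "f3 a = b \<or> f3 a = g" "f3 e = b \<or> f3 e = g"
        using flips_values2[OF f(2) inj 3 a(1) b(1) g(1)] flips_values2[OF f(2) inj 3 e(1) b(1) g(1)] a b g e by auto
      have 4: "f4 b = c \<or> f4 b = e" "f4 g = c \<or> f4 g = e"
        using flips_values2[OF f(3) inj \<open>d ` K = _\<close> b(1) c(1) e(1)]
          flips_values2[OF f(3) inj \<open>d ` K = _\<close> g(1) c(1) e(1)] b c e g by auto
      have i2: "f2 x = y \<Longrightarrow> f2 y = x" and i3: "f3 x = y \<Longrightarrow> f3 y = x" and i4: "f4 x = y \<Longrightarrow> f4 y = x" if "x \<in> K" for x y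
        using flips_invol[OF f(1) that] flips_invol[OF f(2) that] flips_invol[OF f(3) that] by blast+
      have mv: "f3 b \<noteq> b" "f4 b \<noteq> b" "f4 e \<noteq> e" "f4 g \<noteq> g" "f3 a \<noteq> a" "f3 e \<noteq> e"
        using f(2,3) a b e g unfolding flips_def by auto
      \<comment> \<open>With the other choice all three involutions exchange \<open>b\<close> and
        \<open>e\<close>, so these two would form the whole class.\<close>
      have fa: "f2 a = b"
      proof (rule ccontr)
        assume "f2 a \<noteq> b"
        then have "f2 a = c" using 2 by blast
        then have "f2 c = a" using i2 a by blast
        then have fe: "f2 e = b" using 2 i2[OF e(1)] ne by metis
        then have fb: "f2 b = e" using i2 e by blast
        have "f3 e = b" using dbl23[OF e(1)] fe mv ne by auto
        then have "f3 b = e" using i3 e by blast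
        then have "f4 b = e" using dbl34[OF b(1)] mv ne by auto
        then have "f4 e = b" using i4 b by blast
        then have "{b, e} = K" by (intro conn) (use b e fe fb \<open>f3 e = b\<close> \<open>f3 b = e\<close> \<open>f4 b = e\<close> in auto)
        then show False using a ne by blast
      qed
      then have fb: "f2 b = a" using i2 a by blast
      have fe: "f2 e = c" using 2 fb i2[OF e(1)] ne by metis
      then have fc: "f2 c = e" using i2 e by blast
      have ga: "f3 a = b" using dbl23[OF a(1)] fa mv ne by auto
      then have gb: "f3 b = a" using i3 a by blast
      have ge: "f3 e = g" using 3 gb i3[OF e(1)] ne by metis
      then have gg: "f3 g = e" using i3 e by blast
      have he: "f4 e = g" using dbl34[OF e(1)] ge mv ne by auto
      then have hg: "f4 g = e" using i4 e by blast
      have hb: "f4 b = c" using 4 he i4[OF b(1)] ne by metis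
      then have hc: "f4 c = b" using i4 b by blast
      note vals = v fa fb fc fe ga gb ge gg hb hc he hg
      have "edges K f2 = {{a, b}, {c, e}}" "edges K f3 = {{a, b}, {e, g}}" "edges K f4 = {{b, c}, {e, g}}"
        unfolding K using ne vals by (simp_all add: edges_insert insert_commute)
      moreover have "\<forall>x\<in>K. 4 \<in> d (f2 x) \<longleftrightarrow> 4 \<in> d x" "\<forall>x\<in>K. 1 \<in> d (f4 x) \<longleftrightarrow> 1 \<in> d x"
        unfolding K using vals a b c e g by simp_all
      moreover have "distinct [a, b, c, e, g]" using ne by simp
      ultimately show ?thesis by (intro conjI triple_form_five[OF _ K]) (assumption | simp)+
    next
      case 4
      obtain u where u: "u \<in> K" "d u = {1, 2}" by (rule image_obtain[OF 4, of "{1, 2}"]) simp_all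
      obtain v where v: "v \<in> K" "d v = {1, 3}" by (rule image_obtain[OF 4, of "{1, 3}"]) simp_all
      obtain w where w: "w \<in> K" "d w = {2, 3}" by (rule image_obtain[OF 4, of "{2, 3}"]) simp_all
      obtain x where x: "x \<in> K" "d x = {1, 4}" by (rule image_obtain[OF 4, of "{1, 4}"]) simp_all
      obtain y where y: "y \<in> K" "d y = {2, 4}" by (rule image_obtain[OF 4, of "{2, 4}"]) simp_all
      obtain z where z: "z \<in> K" "d z = {3, 4}" by (rule image_obtain[OF 4, of "{3, 4}"]) simp_all
      have K: "K = {u, v, w, x, y, z}" by (rule KI) (use 4 u v w x y z in auto)
      have ne: "u \<noteq> v" "u \<noteq> w" "u \<noteq> x" "u \<noteq> y" "u \<noteq> z" "v \<noteq> w" "v \<noteq> x" "v \<noteq> y" "v \<noteq> z"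
        "w \<noteq> x" "w \<noteq> y" "w \<noteq> z" "x \<noteq> y" "x \<noteq> z" "y \<noteq> z"
        using u v w x y z by (auto simp: doubleton_eq_iff)
      have fx: "f2 u = u" "f2 z = z" "f3 x = x" "f3 w = w" "f4 u = u" "f4 z = z"
        using flips_fixed[OF f(1) u(1)] flips_fixed[OF f(1) z(1)] flips_fixed[OF f(2) x(1)]
          flips_fixed[OF f(2) w(1)] flips_fixed[OF f(3) u(1)] flips_fixed[OF f(3) z(1)] u w x z by auto
      have 2: "f2 v = w \<or> f2 v = y" "f2 x = w \<or> f2 x = y"
        using flips_values2[OF f(1) inj 4 v(1) w(1) y(1)] flips_values2[OF f(1) inj 4 x(1) w(1) y(1)] v w x y by auto
      have 3: "f3 u = v \<or> f3 u = z" "f3 y = v \<or> f3 y = z"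
        using flips_values2[OF f(2) inj 4 u(1) v(1) z(1)] flips_values2[OF f(2) inj 4 y(1) v(1) z(1)] u v y z by auto
      have 5: "f4 v = x \<or> f4 v = y" "f4 w = x \<or> f4 w = y"
        using flips_values2[OF f(3) inj 4 v(1) x(1) y(1)] flips_values2[OF f(3) inj 4 w(1) x(1) y(1)] v w x y by auto
      have i2: "f2 x = y \<Longrightarrow> f2 y = x" and i3: "f3 x = y \<Longrightarrow> f3 y = x" and i4: "f4 x = y \<Longrightarrow> f4 y = x" if "x \<in> K" for x y
        using flips_invol[OF f(1) that] flips_invol[OF f(2) that] flips_invol[OF f(3) that] by blast+
      have mv: "f2 v \<noteq> v" "f2 y \<noteq> y" "f3 v \<noteq> v" "f3 y \<noteq> y" "f4 v \<noteq> v" "f4 y \<noteq> y"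
        using f v y unfolding flips_def by auto
      \<comment> \<open>With the other choice all three involutions exchange \<open>v\<close> and
        \<open>y\<close>.\<close>
      have gy: "f3 y = z"
      proof (rule ccontr)
        assume "f3 y \<noteq> z"
        then have e3: "f3 y = v" using 3 by blast
        then have e3': "f3 v = y" using i3 y by blast
        have e2: "f2 y = v" using dbl23[OF y(1)] e3 mv ne by auto
        then have e2': "f2 v = y" using i2 y by blast
        have e4: "f4 y = v" using dbl34[OF y(1)] e3 mv ne by auto
        then have e4': "f4 v = y" using i4 y by blast
        have "{v, y} = K" by (intro conn) (use v y e2 e2' e3 e3' e4 e4' in auto)
        then show False using u ne by blast
      qed
      then have gz: "f3 z = y" using i3 y by blast
      have gu: "f3 u = v" using 3 gz i3[OF u(1)] ne by metis
      then have gv: "f3 v = u" using i3 u by blast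
      have fv: "f2 v = w"
      proof (rule ccontr)
        assume "f2 v \<noteq> w"
        then have "f2 v = y" using 2 by blast
        then have "f3 v = y" using dbl23[OF v(1)] mv ne by auto
        then show False using gv ne by simp
      qed
      then have fw: "f2 w = v" using i2 v by blast
      have fxx: "f2 x = y" using 2 fw i2[OF x(1)] ne by metis
      then have fy: "f2 y = x" using i2 x by blast
      have hv: "f4 v = x"
      proof (rule ccontr)
        assume "f4 v \<noteq> x"
        then have "f4 v = y" using 5 by blast
        then have "y = f3 v" using dbl34[OF v(1)] mv ne by auto
        then show False using gv ne by simp
      qed
      then have hx: "f4 x = v" using i4 v by blast
      have hw: "f4 w = y" using 5 hx i4[OF w(1)] ne by metis
      then have hy: "f4 y = w" using i4 w by blast
      note vals = fx fv fw fxx fy gu gv gy gz hv hw hx hy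
      have "edges K f2 = {{v, w}, {x, y}}" "edges K f3 = {{u, v}, {y, z}}" "edges K f4 = {{v, x}, {w, y}}"
        unfolding K using ne vals by (simp_all add: edges_insert insert_commute)
      moreover have "\<forall>x\<in>K. 4 \<in> d (f2 x) \<longleftrightarrow> 4 \<in> d x" "\<forall>x\<in>K. 1 \<in> d (f4 x) \<longleftrightarrow> 1 \<in> d x"
        unfolding K using vals u v w x y z by simp_all
      moreover have "distinct [u, v, w, x, y, z]" using ne by simp
      ultimately show ?thesis by (intro conjI triple_form_six[OF _ K]) (assumption | simp)+
    qed
  qed
  show ?thesis
  proof (cases "d ` K \<in> {{{}}, {{4}, {3}, {2}, {1}}, {{3}, {2, 4}, {2}, {1, 4}, {1, 3}},
       {{3, 4}, {2, 4}, {2, 3}, {1, 4}, {1, 3}, {1, 2}}}")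
    case True
    show ?thesis by (rule main[OF f inj True])
  next
    case False
    let ?B = "{1, 2, 3, 4} :: nat set"
    have "\<forall>X\<in>d ` K. X \<subseteq> ?B" using F by (elim insertE emptyE) simp_all
    then have B: "d x \<subseteq> ?B" if "x \<in> K" for x using that by blast
    let ?d = "\<lambda>x. ?B - d x"
    have im: "?d ` K = (\<lambda>X. ?B - X) ` (d ` K)" by (simp add: image_image)
    have "d ` K = {{2, 4}, {2, 3}, {1, 3, 4}, {1, 3}, {1, 2, 4}} \<or>
      d ` K = {{2, 3, 4}, {1, 3, 4}, {1, 2, 4}, {1, 2, 3}} \<or> d ` K = {{1, 2, 3, 4}}" using F False by (simp only: insert_iff empty_iff) argo
    moreover have "?B - {2, 4} = {1, 3}" "?B - {2, 3} = {1, 4}" "?B - {1, 3, 4} = {2}" "?B - {1, 3} = {2, 4}"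
      "?B - {1, 2, 4} = {3}" "?B - {2, 3, 4} = {1}" "?B - {1, 2, 3} = {4}" "?B - {1, 2, 3, 4} = {}"
      by auto
    ultimately have "?d ` K \<in> {{{}}, {{4}, {3}, {2}, {1}}, {{3}, {2, 4}, {2}, {1, 4}, {1, 3}},
       {{3, 4}, {2, 4}, {2, 3}, {1, 4}, {1, 3}, {1, 2}}}"
      unfolding im by (elim disjE) (simp_all only: image_insert image_empty, simp_all add: insert_commute)
    then have "triple_form K (edges K f2) (edges K f3) (edges K f4) \<and>
      (\<forall>x\<in>K. 4 \<in> ?d (f2 x) \<longleftrightarrow> 4 \<in> ?d x) \<and> (\<forall>x\<in>K. 1 \<in> ?d (f4 x) \<longleftrightarrow> 1 \<in> ?d x)"
      by (intro main flips_complement[OF f(1) B] flips_complement[OF f(2) B] flips_complement[OF f(3) B]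
        inj_on_complement[OF inj B]) simp_all
    then show ?thesis by simp
  qed
qed

section \<open>Classes and Schur functions\<close>

definition schur_class :: "'a set \<Rightarrow> ('a \<Rightarrow> nat set) \<Rightarrow> (nat \<Rightarrow> 'a \<Rightarrow> 'a) \<Rightarrow> nat \<Rightarrow> nat \<Rightarrow> 'a \<Rightarrow> bool" where
  "schur_class A D phi h i T \<longleftrightarrow> (\<exists>lam. is_partition lam (i - h + 3) \<and>
     (\<forall>M. (\<Sum>U\<in>deq_class A phi h i T. fundQ (i - h + 3) (Des_hi D h i U) M) = schur lam M))"

lemma mem_Des_hi:
  assumes "2 \<le> h"
  shows "j \<in> Des_hi D h i U \<longleftrightarrow> 1 \<le> j \<and> j + (h - 2) \<le> i \<and> j + (h - 2) \<in> D U"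
proof
  assume "j \<in> Des_hi D h i U"
  then show "1 \<le> j \<and> j + (h - 2) \<le> i \<and> j + (h - 2) \<in> D U" using assms by (auto simp: Des_hi_def)
next
  assume *: "1 \<le> j \<and> j + (h - 2) \<le> i \<and> j + (h - 2) \<in> D U"
  then have "j = (j + (h - 2)) - (h - 2)" "j + (h - 2) \<in> D U \<inter> {h - 1..i}" using assms by auto
  then show "j \<in> Des_hi D h i U" unfolding Des_hi_def by (rule image_eqI)
qed

lemma Des_hi_subset: "2 \<le> h \<Longrightarrow> h \<le> i \<Longrightarrow> Des_hi D h i U \<subseteq> {1..<i - h + 3}"
  by (rule subsetI) (auto simp: mem_Des_hi)

lemma (in involutions) finite_class: "T \<in> A \<Longrightarrow> 1 < h \<Longrightarrow> i < n \<Longrightarrow> finite (deq_class A phi h i T)"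
  using class_sub finite_A by (meson finite_subset subsetI)

context chart_extension
begin

text \<open>A Schur function has a descent set occurring exactly once, and a labelling by words that is
  injective at one element of a class is injective on the whole class.\<close>

lemma schur_class_inj:
  assumes h: "2 \<le> h" "h \<le> i" and T: "T \<in> A" and s: "schur_class A D phi h i T"
  shows "inj_on g (deq_class A phi h i T)"
proof -
  let ?K = "deq_class A phi h i T" and ?k = "i - h + 3"
  have h1: "1 < h" using h by simp
  obtain lam where lam: "is_partition lam ?k"
    "\<And>M. (\<Sum>U\<in>?K. fundQ ?k (Des_hi D h i U) M) = schur lam M"
    using s unfolding schur_class_def by blast
  obtain w0 where w0: "lattice_word w0" "mset w0 = shape_mset lam"
    using ex_lattice_word part_shape_mset(1)[OF lam(1)] by blast
  \<comment> \<open>Among the lattice words of its content the sorted one is determined by its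
    descent set, by extremality. Hence this descent set occurs exactly once in the class.\<close>
  define s0 where "s0 = sort w0"
  have s0: "lattice_word s0" "mset s0 = shape_mset lam" "sorted s0"
    using lattice_sort lattice_part w0 by (auto simp: s0_def)
  have ls0: "length s0 = ?k" using s0(2) part_shape_mset(2)[OF lam(1)] size_mset[of s0] by simp
  have "w = s0" if w: "lattice_word w" "mset w = shape_mset lam" "word_des w = word_des s0" for w
  proof -
    have len: "length w = length s0" using w(2) s0(2) by (metis size_mset)
    have "wdes s0 j" if "1 \<le> j" "j < length s0" "wdes w j" for j
    proof -
      have "j \<in> word_des w" using that len by (simp add: word_des_def)
      then show ?thesis unfolding w(3) by (simp add: word_des_def)
    qed
    moreover have "sum_list w = sum_list s0" using w(2) s0(2) by (metis sum_mset_sum_list)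
    ultimately show ?thesis using lattice_le_sorted(2)[OF w(1) s0(3) len] by blast
  qed
  then have "{w. lattice_word w \<and> mset w = shape_mset lam \<and> word_des w = word_des s0} = {s0}"
    using s0 by blast
  moreover have "card {U \<in> ?K. Des_hi D h i U = word_des s0} =
      card {w. lattice_word w \<and> mset w = shape_mset lam \<and> word_des w = word_des s0}"
    by (rule schur_des_count[OF lam(1) finite_class[OF T h1 i_n] Des_hi_subset[OF h] lam(2)])
      (use ls0 in \<open>auto simp: word_des_def\<close>)
  ultimately have "card {U \<in> ?K. Des_hi D h i U = word_des s0} = 1" by simp
  then obtain U0 where "{U \<in> ?K. Des_hi D h i U = word_des s0} = {U0}" by (rule card_1_singletonE)
  then have U0: "U0 \<in> ?K" "Des_hi D h i U0 = word_des s0"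
    "\<And>V. V \<in> ?K \<Longrightarrow> Des_hi D h i V = word_des s0 \<Longrightarrow> V = U0" by blast+
  have KA: "V \<in> A" if "V \<in> ?K" for V using class_sub[OF T h1 i_n that] .
  have K0: "deq_class A phi h i U0 = ?K" using class_eq[OF T h1 i_n U0(1)] .
  have d: "Des_hi D h i U = Des_hi D h i V" if "U \<in> A" "V \<in> A" "g U = g V" for U V
    using g_des[OF that(1)] g_des[OF that(2)] that(3) h(1) by (auto simp: mem_Des_hi)
  \<comment> \<open>A label determines the descents in question, so \<open>U0\<close> shares its
    label with no other element of the class. Involutions act bijectively on the class and on
    labels, which carries this property from \<open>U0\<close> to every element.\<close>
  have "\<forall>V\<in>?K. g V = g U \<longrightarrow> V = U" if "U \<in> ?K" for U
    using that[folded K0] KA[OF U0(1)] h1 i_n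
  proof (induction rule: class_induct)
    case base
    then show ?case using d KA U0 by metis
  next
    case (step U j)
    have j: "1 < j" "j < n" "2 \<le> j" "j < Suc i" using step.hyps h1 i_n by auto
    show ?case
    proof (intro ballI impI)
      fix V assume V: "V \<in> ?K" "g V = g (phi j U)"
      have "g (phi j V) = g U"
        using chartD(4)[OF g_chart KA[OF V(1)] j(3,4)] chartD(4)[OF g_chart step.hyps(1) j(3,4)] V(2) by simp
      moreover have "phi j V \<in> ?K" using class_step[OF V(1) KA[OF V(1)]] step.hyps by simp
      ultimately have "phi j V = U" using step.IH by blast
      then show "V = phi j U" using phi_phi[OF j(1,2) KA[OF V(1)]] by simp
    qed
  qed
  then show ?thesis by (meson inj_onI)
qed

end

context pre_deg
begin

lemma ex_extension_letters:
  assumes f: "chart A D phi i f" "\<And>T. T \<in> A \<Longrightarrow> inj_on f (deq_class A phi 2 (i - 1) T)" and i: "1 \<le> i" "i < n"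
  obtains r where "\<And>T. T \<in> A \<Longrightarrow> lattice_word (f T @ [r T])" "\<And>T. T \<in> A \<Longrightarrow> i \<in> D T \<longleftrightarrow> last (f T) < r T"
    "\<And>T U. T \<in> A \<Longrightarrow> U \<in> deq_class A phi 2 (i - 1) T \<Longrightarrow> r U = r T"
proof -
  have i_n: "i - 1 < n" using i by auto
  define P where "P C x \<longleftrightarrow> (\<forall>U\<in>C. lattice_word (f U @ [x]) \<and> (i \<in> D U \<longleftrightarrow> last (f U) < x))" for C x
  define r where "r T = (SOME x. P (deq_class A phi 2 (i - 1) T) x)" for T
  have P: "P (deq_class A phi 2 (i - 1) T) (r T)" if "T \<in> A" for T
    unfolding r_def
    by (rule someI_ex) (use chart_extension_letter[OF f(1) i f(2) that] in \<open>simp add: P_def\<close>)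
  have "lattice_word (f T @ [r T])" "i \<in> D T \<longleftrightarrow> last (f T) < r T" if "T \<in> A" for T
    using P[OF that] unfolding P_def by (metis mem_class_self)+
  moreover have "r U = r T" if "T \<in> A" "U \<in> deq_class A phi 2 (i - 1) T" for T U
    using class_eq[OF that(1) _ i_n that(2)] by (simp add: r_def)
  ultimately show ?thesis using that by blast
qed

text \<open>Since \<open>oe\<close> is asked for labellings extended by one letter, it can be
  supplied in both directions of the equivalence: by axiom 6 outright, or by a Schur argument that
  itself works with the labels.\<close>

lemma ex_inj_chart:
  assumes oe: "\<And>i f r. chart_extension A D phi n i f r \<Longrightarrow> one_edge A phi i"
    and m: "1 \<le> m" "m \<le> n"
  shows "\<exists>f. chart A D phi m f \<and> (\<forall>T\<in>A. inj_on f (deq_class A phi 2 (m - 1) T))"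
  using m
proof (induction m rule: dec_induct)
  case base
  have "U = T" if "U \<in> deq_class A phi 2 (1 - 1) T" for U T
    using that by (auto simp: deq_class_def elim: rtrancl.cases)
  moreover have "lattice_word [0]" using lattice_snoc[of "[]" 0] by (simp add: part_def)
  ultimately show ?case
    by (intro exI[of _ "\<lambda>_. [0]"]) (auto simp: chart_def inj_on_def)
next
  case (step i)
  then obtain f where f: "chart A D phi i f" "\<And>T. T \<in> A \<Longrightarrow> inj_on f (deq_class A phi 2 (i - 1) T)" by auto
  have i_n: "i < n" "i - 1 < n" using step by auto
  obtain r where r: "\<And>T. T \<in> A \<Longrightarrow> lattice_word (f T @ [r T])" "\<And>T. T \<in> A \<Longrightarrow> i \<in> D T \<longleftrightarrow> last (f T) < r T"
    and r_const: "\<And>T U. T \<in> A \<Longrightarrow> U \<in> deq_class A phi 2 (i - 1) T \<Longrightarrow> r U = r T"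
    using ex_extension_letters[OF f step(1) i_n(1)] by blast
  show ?case
  proof (cases "i = 1")
    \<comment> \<open>There is no involution of index 1, and the extension locale starts at length
      2, so words of length 1 are extended by hand.\<close>
    case True
    have len: "length (f T) = 1" if "T \<in> A" for T using chartD(1)[OF f(1) that] True by simp
    have "chart A D phi (Suc i) (\<lambda>T. f T @ [r T])"
      unfolding chart_def
    proof (intro ballI conjI allI impI)
      fix T j assume T: "T \<in> A"
      show "length (f T @ [r T]) = Suc i" "lattice_word (f T @ [r T])" using len[OF T] r T True by simp_all
      show "j \<in> D T \<longleftrightarrow> wdes (f T @ [r T]) j" if "1 \<le> j \<and> j < Suc i"
      proof -
        have "j = 1" using that True by simp
        moreover have "last (f T) = f T ! 0" using len[OF T] by (cases "f T") auto
        ultimately show ?thesis using r(2)[OF T] True len[OF T] by (simp add: wdes_def nth_append)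
      qed
      show "f (phi j T) @ [r (phi j T)] = knuth_move j (f T @ [r T])" if "2 \<le> j \<and> j < Suc i"
      proof -
        have False using that True by linarith
        then show ?thesis ..
      qed
    qed
    moreover have "U = T" if "U \<in> deq_class A phi 2 (Suc i - 1) T" for U T
      using that True by (auto simp: deq_class_def elim: rtrancl.cases)
    ultimately show ?thesis by (intro exI[of _ "\<lambda>T. f T @ [r T]"]) (auto simp: inj_on_def)
  next
    case False
    then have "2 \<le> i" using step by simp
    interpret chart_extension A D phi n i f r
      by unfold_locales (fact f(1) \<open>2 \<le> i\<close> i_n(1) | erule f(2) | erule (1) r_const | erule r)+
    have "one_edge A phi i" by (rule oe[OF chart_extension_axioms])
    then show ?thesis using g_chart inj_of_one_edge by (intro exI[of _ g]) auto
  qed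
qed

text \<open>Moves with index at least \<open>h\<close> keep the first \<open>h - 2\<close> letters.
  Injectivity thus carries the class bijectively onto the Knuth class of a suffix of length
  \<open>i - h + 3\<close>. Such a suffix is in general not a lattice word, which is why Knuth
  classes of arbitrary words are treated.\<close>

lemma schur_class_of_chart:
  assumes f: "chart A D phi (Suc i) f" "inj_on f (deq_class A phi 2 i T)"
    and h: "2 \<le> h" "h \<le> i" "i < n" and T: "T \<in> A"
  shows "schur_class A D phi h i T"
proof -
  let ?K = "deq_class A phi h i T" and ?k = "i - h + 3"
  have h1: "1 < h" using h by simp
  have KA: "V \<in> A" if "V \<in> ?K" for V using class_sub[OF T h1 h(3) that] .
  define p where "p = take (h - 2) (f T)"
  have lp: "length p = h - 2" using chartD(1)[OF f(1) T] h by (simp add: p_def)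
  define u where "u U = drop (h - 2) (f U)" for U
  have fu: "f U = p @ u U" if "U \<in> ?K" for U
    using that T h1 h(3)
  proof (induction rule: class_induct)
    case base
    then show ?case by (simp add: p_def u_def)
  next
    case (step V j)
    have j: "2 \<le> j" "j < Suc i" using step.hyps h1 by auto
    have "j = length p + (j - (h - 2))" "2 \<le> j - (h - 2)" using step.hyps h lp by auto
    then have "knuth_move j (p @ u V) = p @ knuth_move (j - (h - 2)) (u V)" using knuth_move_prepend by metis
    then have "f (phi j V) = p @ knuth_move (j - (h - 2)) (u V)"
      using chartD(4)[OF f(1) step.hyps(1) j] step.IH by simp
    then show ?case using lp by (simp add: u_def)
  qed
  have lu: "length (u U) = ?k" if "U \<in> ?K" for U
    using chartD(1)[OF f(1) KA[OF that]] h by (simp add: u_def)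
  have u_phi: "u (phi (j + (h - 2)) U) = knuth_move j (u U)" if "U \<in> ?K" "2 \<le> j" "j < ?k" for U j
  proof -
    have j: "2 \<le> j + (h - 2)" "j + (h - 2) < Suc i" using that h by auto
    have "knuth_move (j + (h - 2)) (p @ u U) = p @ knuth_move j (u U)" using knuth_move_prepend[OF that(2), of p] lp by (simp add: add.commute)
    then have "f (phi (j + (h - 2)) U) = p @ knuth_move j (u U)"
      using chartD(4)[OF f(1) KA[OF that(1)] j] fu[OF that(1)] by simp
    then have "drop (h - 2) (f (phi (j + (h - 2)) U)) = knuth_move j (u U)" using lp by simp
    then show ?thesis by (simp only: u_def)
  qed
  have img: "u ` ?K = knuth_class (u T)"
  proof (intro equalityI subsetI)
    fix w assume "w \<in> u ` ?K"
    then obtain U where U: "U \<in> ?K" "w = u U" by blast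
    have "u U \<in> knuth_class (u T)"
      using U(1) T h1 h(3)
    proof (induction rule: class_induct)
      case base
      then show ?case by (simp add: knuth_class_def)
    next
      case (step V j)
      have "j = (j - (h - 2)) + (h - 2)" "2 \<le> j - (h - 2)" "j - (h - 2) < ?k" using step.hyps h by auto
      then have "u (phi j V) = knuth_move (j - (h - 2)) (u V)" using u_phi[OF step.hyps(2)] by metis
      then show ?case using step.IH knuth_relI unfolding knuth_class_def
        by (metis mem_Collect_eq rtrancl.rtrancl_into_rtrancl)
    qed
    then show "w \<in> knuth_class (u T)" using U by simp
  next
    fix w assume "w \<in> knuth_class (u T)"
    then have "(u T, w) \<in> knuth_rel\<^sup>*" by (simp add: knuth_class_def)
    then show "w \<in> u ` ?K"
    proof (induction rule: rtrancl_induct)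
      case (step v w)
      then obtain U j where U: "U \<in> ?K" "v = u U" "w = knuth_move j v" by (auto simp: knuth_rel_def)
      show ?case
      proof (cases "2 \<le> j \<and> j < ?k")
        case True
        then have "w = u (phi (j + (h - 2)) U)" using u_phi U by simp
        moreover have "phi (j + (h - 2)) U \<in> ?K"
          using class_step[OF U(1) KA[OF U(1)]] True h by auto
        ultimately show ?thesis by blast
      next
        case False
        then have "w = u U" using U lu[OF U(1)] by (auto simp: knuth_move_def)
        then show ?thesis using U(1) by blast
      qed
    qed simp
  qed
  have "inj_on u ?K"
  proof (rule inj_onI)
    fix x y assume xy: "x \<in> ?K" "y \<in> ?K" "u x = u y"
    have "?K \<subseteq> deq_class A phi 2 i T" using h by (intro class_mono) auto
    then show "x = y" using inj_onD[OF f(2), of x y] fu xy by auto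
  qed
  then have bij: "bij_betw u ?K (knuth_class (u T))" using img by (simp add: bij_betw_def)
  have des: "Des_hi D h i U = word_des (u U)" if U: "U \<in> ?K" for U
  proof (rule set_eqI)
    fix j
    have "j + (h - 2) \<in> D U \<longleftrightarrow> u U ! (j - 1) < u U ! j" if "1 \<le> j" "j + (h - 2) \<le> i"
    proof -
      have "j + (h - 2) - 1 = length p + (j - 1)" "j + (h - 2) = length p + j" using that lp by auto
      then have "(p @ u U) ! (j + (h - 2) - 1) = u U ! (j - 1)" "(p @ u U) ! (j + (h - 2)) = u U ! j"
        by (simp_all only: nth_append_length_plus)
      moreover have "j + (h - 2) \<in> D U \<longleftrightarrow> wdes (f U) (j + (h - 2))"
        using chartD(3)[OF f(1) KA[OF U], of "j + (h - 2)"] that by simp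
      ultimately show ?thesis unfolding wdes_def fu[OF U] by simp
    qed
    then show "j \<in> Des_hi D h i U \<longleftrightarrow> j \<in> word_des (u U)"
      unfolding mem_Des_hi[OF h(1)] word_des_def using lu[OF U] h by (auto simp: wdes_def)
  qed
  have lT: "length (u T) = ?k" using lu by simp
  obtain lam where lam: "is_partition lam ?k"
    "\<And>M. (\<Sum>v\<in>knuth_class (u T). fundQ ?k (word_des v) M) = schur lam M"
    using knuth_class_schur[of "u T"] lT by auto
  have "(\<Sum>U\<in>?K. fundQ ?k (Des_hi D h i U) M) = schur lam M" for M
  proof -
    have "(\<Sum>U\<in>?K. fundQ ?k (Des_hi D h i U) M) = (\<Sum>U\<in>?K. fundQ ?k (word_des (u U)) M)"
      by (rule sum.cong) (use des in auto)
    also have "\<dots> = (\<Sum>v\<in>knuth_class (u T). fundQ ?k (word_des v) M)"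
      by (rule sum.reindex_bij_betw[OF bij])
    finally show ?thesis using lam(2) by simp
  qed
  then show ?thesis unfolding schur_class_def using lam(1) by blast
qed

end

section \<open>Axiom 4 in terms of involutions\<close>

lemma edges_mem: "x \<in> K \<Longrightarrow> f x \<noteq> x \<Longrightarrow> {x, f x} \<in> edges K f"
  by (auto simp: edges_def)

text \<open>A component of two consecutive colours has at most one edge of each. A colour that is
  active at both ends of an edge of the other colour must therefore use that very edge.\<close>

lemma pair_form_same_edge:
  assumes "pair_form K (edges K f1) (edges K f2)" "x \<in> K" "f1 x \<in> K" "f2 x \<in> K" "f1 x \<noteq> x" "f2 x \<noteq> x"
    "f2 (f1 x) \<noteq> f1 x \<or> f1 (f2 x) \<noteq> f2 x"
  shows "f2 x = f1 x"
proof -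
  have "\<exists>e. edges K f1 \<subseteq> {e}" "\<exists>e. edges K f2 \<subseteq> {e}" using assms(1) unfolding pair_form_def by auto
  then obtain e1 e2 where e: "edges K f1 \<subseteq> {e1}" "edges K f2 \<subseteq> {e2}" by blast
  from assms(7) show ?thesis
  proof
    assume "f2 (f1 x) \<noteq> f1 x"
    then have "{f1 x, f2 (f1 x)} = {x, f2 x}"
      using edges_mem[of "f1 x" K f2] edges_mem[of x K f2] assms e(2) by (metis singletonD subsetD)
    then show ?thesis using assms(5) by (auto simp: doubleton_eq_iff)
  next
    assume "f1 (f2 x) \<noteq> f2 x"
    then have "{f2 x, f1 (f2 x)} = {x, f1 x}"
      using edges_mem[of "f2 x" K f1] edges_mem[of x K f1] assms e(1) by (metis singletonD subsetD)
    then show ?thesis using assms(6) by (auto simp: doubleton_eq_iff)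
  qed
qed

lemma edges_value:
  assumes "{x, y} \<in> edges K f" "x \<noteq> y" "\<And>z. z \<in> K \<Longrightarrow> f (f z) = z"
  shows "f x = y" "f y = x"
  using assms by (auto simp: edges_def doubleton_eq_iff)

text \<open>Only the five-vertex component has an edge that carries the middle colour together with
  an outer one.\<close>

lemma triple_form_five_cases:
  assumes form: "triple_form K F0 F1 F2"
    and e: "e \<in> F1" "e \<in> F0 \<or> e \<in> F2"
  obtains a b c d e where "distinct [a, b, c, d, e]"
    "F0 = {{a, b}, {c, d}}" "F1 = {{a, b}, {d, e}}" "F2 = {{b, c}, {d, e}}"
  using form unfolding triple_form_def
proof (elim disjE exE conjE)
  fix p q r s assume "distinct [p, q, r, s]" "F0 = {{p, q}}" "F1 = {{q, r}}" "F2 = {{r, s}}"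
  then have False using e by (auto simp: doubleton_eq_iff)
  then show thesis ..
next
  fix u v' w x y z assume "distinct [u, v', w, x, y, z]" "F0 = {{v', w}, {x, y}}" "F1 = {{u, v'}, {y, z}}"
    "F2 = {{v', x}, {w, y}}"
  then have False using e by (auto simp: doubleton_eq_iff)
  then show thesis ..
qed (use e that in simp_all)

text \<open>The double edge at \<open>x\<close> is \<open>{a, b}\<close>, left by \<open>f2\<close>
  towards \<open>c\<close>; then \<open>f0\<close> leads to \<open>d\<close>, an end of the other
  double edge \<open>{d, e}\<close>.\<close>

lemma triple_form_up:
  assumes form: "triple_form K (edges K f0) (edges K f1) (edges K f2)" and x: "x \<in> K"
    and inv: "\<And>z. z \<in> K \<Longrightarrow> f0 (f0 z) = z" "\<And>z. z \<in> K \<Longrightarrow> f1 (f1 z) = z" "\<And>z. z \<in> K \<Longrightarrow> f2 (f2 z) = z"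
    and hyp: "f1 x \<noteq> x" "f0 x = f1 x" "f2 x \<noteq> x"
  shows "f2 (f0 (f2 x)) \<noteq> f0 (f2 x) \<and> f1 (f0 (f2 x)) = f2 (f0 (f2 x))"
proof -
  have e: "{x, f1 x} \<in> edges K f1" "{x, f1 x} \<in> edges K f0" "{x, f2 x} \<in> edges K f2"
    using edges_mem[of x K f1] edges_mem[of x K f0] edges_mem[of x K f2] x hyp by auto
  obtain a b c d e where F: "distinct [a, b, c, d, e]" "edges K f0 = {{a, b}, {c, d}}"
    "edges K f1 = {{a, b}, {d, e}}" "edges K f2 = {{b, c}, {d, e}}"
    using triple_form_five_cases[OF form e(1)] e(2) by blast
  have "{x, f1 x} = {a, b}" using e(1,2) F by (auto simp: doubleton_eq_iff)
  then have "x = a \<or> x = b" by (auto simp: doubleton_eq_iff)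
  then have "f2 x = c" using e(3) F by (auto simp: doubleton_eq_iff)
  moreover have "f0 c = d" by (rule edges_value(1)[OF _ _ inv(1)]) (use F in auto)
  moreover have "f1 d = e" by (rule edges_value(1)[OF _ _ inv(2)]) (use F in auto)
  moreover have "f2 d = e" by (rule edges_value(1)[OF _ _ inv(3)]) (use F in auto)
  ultimately show ?thesis using F(1) by auto
qed

lemma triple_form_down:
  assumes form: "triple_form K (edges K f0) (edges K f1) (edges K f2)" and x: "x \<in> K" "f0 x \<in> K"
    and inv: "\<And>z. z \<in> K \<Longrightarrow> f0 (f0 z) = z" "\<And>z. z \<in> K \<Longrightarrow> f1 (f1 z) = z" "\<And>z. z \<in> K \<Longrightarrow> f2 (f2 z) = z"
    and hyp: "f0 x \<noteq> x" "f2 (f0 x) \<noteq> f0 x" "f1 (f0 x) = f2 (f0 x)"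
  shows "f0 (f2 x) = f1 (f2 x)"
proof -
  have e: "{f0 x, f1 (f0 x)} \<in> edges K f1" "{f0 x, f1 (f0 x)} \<in> edges K f2" "{x, f0 x} \<in> edges K f0"
    using edges_mem[of "f0 x" K f1] edges_mem[of x K f0] edges_mem[of "f0 x" K f2] x hyp by auto
  obtain a b c d e where F: "distinct [a, b, c, d, e]" "edges K f0 = {{a, b}, {c, d}}"
    "edges K f1 = {{a, b}, {d, e}}" "edges K f2 = {{b, c}, {d, e}}"
    using triple_form_five_cases[OF form e(1)] e(2) by blast
  have "{f0 x, f1 (f0 x)} = {d, e}" using e(1,2) F by (auto simp: doubleton_eq_iff)
  then have "f0 x = d \<or> f0 x = e" by (auto simp: doubleton_eq_iff)
  then have "x = c" using e(3) F by (auto simp: doubleton_eq_iff)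
  moreover have "f2 c = b" by (rule edges_value(2)[OF _ _ inv(3)]) (use F in auto)
  moreover have "f0 b = a" by (rule edges_value(2)[OF _ _ inv(1)]) (use F in auto)
  moreover have "f1 b = a" by (rule edges_value(2)[OF _ _ inv(2)]) (use F in auto)
  ultimately show ?thesis by simp
qed

section \<open>Graphs and involutions\<close>

lemma sigma_of_eq:
  "sigma_of D w j = - sigma_of D x k \<longleftrightarrow> (j \<in> D w) \<noteq> (k \<in> D x)"
  "sigma_of D w j = sigma_of D x k \<longleftrightarrow> (j \<in> D w) = (k \<in> D x)"
  by (auto simp: sigma_of_def)

context involutions
begin

lemma edge_iff:
  assumes "1 < i" "i < n"
  shows "{w, x} \<in> Phi_of A phi i \<longleftrightarrow> w \<in> A \<and> x = phi i w \<and> x \<noteq> w"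
proof
  assume "{w, x} \<in> Phi_of A phi i"
  then obtain T where "{w, x} = {T, phi i T}" "T \<in> A" "phi i T \<noteq> T" by (auto simp: Phi_of_def)
  then show "w \<in> A \<and> x = phi i w \<and> x \<noteq> w" using assms by (auto simp: doubleton_eq_iff)
qed (auto simp: Phi_of_def)

lemma component_eq:
  assumes v: "v \<in> A" and h: "1 < h" "i < n"
  shows "comp (\<Union>j\<in>{h..i}. Phi_of A phi j) v = deq_class A phi h i v"
proof -
  let ?F = "\<Union>j\<in>{h..i}. Phi_of A phi j"
  have j: "1 < j" "j < n" if "j \<in> {h..i}" for j using that h by auto
  show ?thesis
  proof (intro equalityI subsetI)
    fix u assume "u \<in> comp ?F v"
    then have "(v, u) \<in> (edge_rel ?F)\<^sup>*" by (simp add: comp_def)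
    then show "u \<in> deq_class A phi h i v"
    proof (induction rule: rtrancl_induct)
      case (step x y)
      then obtain j where "j \<in> {h..i}" "{x, y} \<in> Phi_of A phi j" by (auto simp: edge_rel_def)
      then show ?case using edge_iff[OF j, of j x y] step.IH class_step[of x A phi h i v j] by auto
    qed simp
  next
    fix u assume "u \<in> deq_class A phi h i v"
    then show "u \<in> comp ?F v" using v h
    proof (induction rule: class_induct)
      case (step V j)
      then have jj: "j \<in> {h..i}" by simp
      show ?case
      proof (cases "phi j V = V")
        case False
        then have "{V, phi j V} \<in> ?F" using edge_iff[OF j[OF jj], of V "phi j V"] step.hyps(1) jj by auto
        then have "(V, phi j V) \<in> edge_rel ?F" by (simp add: edge_rel_def)
        then show ?thesis using step.IH unfolding comp_def by (metis mem_Collect_eq rtrancl.rtrancl_into_rtrancl)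
      qed (use step in simp)
    qed (simp add: comp_def)
  qed
qed

lemma path_iff:
  assumes "x \<in> A" "1 < i" "i < n"
  shows "(x, y) \<in> (edge_rel (\<Union>j\<in>{2..<i}. Phi_of A phi j))\<^sup>* \<longleftrightarrow> y \<in> deq_class A phi 2 (i - 1) x"
proof -
  have e: "{2..<i} = {2..i - 1}" and n: "1 < (2::nat)" "i - 1 < n" using assms(2,3) by auto
  have "y \<in> comp (\<Union>j\<in>{2..i - 1}. Phi_of A phi j) x \<longleftrightarrow> y \<in> deq_class A phi 2 (i - 1) x"
    by (simp only: component_eq[OF assms(1) n])
  then show ?thesis unfolding e comp_def mem_Collect_eq .
qed

lemma restr_eq:
  assumes v: "v \<in> A" and h: "1 < h" "i < n" and j: "h \<le> j" "j \<le> i"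
  shows "restr (deq_class A phi h i v) (Phi_of A phi j) = edges (deq_class A phi h i v) (phi j)"
proof (intro equalityI subsetI)
  fix e assume "e \<in> restr (deq_class A phi h i v) (Phi_of A phi j)"
  then show "e \<in> edges (deq_class A phi h i v) (phi j)" by (auto simp: restr_def Phi_of_def edges_def)
next
  fix e assume "e \<in> edges (deq_class A phi h i v) (phi j)"
  then obtain x where x: "x \<in> deq_class A phi h i v" "phi j x \<noteq> x" "e = {x, phi j x}" by (auto simp: edges_def)
  have "x \<in> A" using class_sub[OF v h x(1)] .
  moreover have "phi j x \<in> deq_class A phi h i v" using class_step[OF x(1) \<open>x \<in> A\<close> j] .
  ultimately show "e \<in> restr (deq_class A phi h i v) (Phi_of A phi j)" using x by (auto simp: restr_def Phi_of_def)
qed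

lemma union_pair: "2 < i \<Longrightarrow> Phi_of A phi (i - 1) \<union> Phi_of A phi i = (\<Union>j\<in>{i - 1..i}. Phi_of A phi j)"
proof -
  assume "2 < i"
  then have "{i - 1..i} = {i - 1, i}" by auto
  then show ?thesis by simp
qed

lemma union_triple: "3 < i \<Longrightarrow> Phi_of A phi (i - 2) \<union> Phi_of A phi (i - 1) \<union> Phi_of A phi i = (\<Union>j\<in>{i - 2..i}. Phi_of A phi j)"
proof -
  assume "3 < i"
  then have "{i - 2..i} = {i - 2, i - 1, i}" by auto
  then show ?thesis by auto
qed

end

lemma pair_form_at: "v \<in> C \<Longrightarrow> pair_form C F1 F2 \<longleftrightarrow> (C = {v} \<and> F1 = {} \<and> F2 = {})
        \<or> (\<exists>x y z. distinct [x, y, z] \<and> C = {x, y, z} \<and> F1 = {{x, y}} \<and> F2 = {{y, z}})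
        \<or> (\<exists>x y. x \<noteq> y \<and> C = {x, y} \<and> F1 = {{x, y}} \<and> F2 = {{x, y}})"
proof -
  assume "v \<in> C"
  then have "(\<exists>v. C = {v} \<and> F1 = {} \<and> F2 = {}) \<longleftrightarrow> C = {v} \<and> F1 = {} \<and> F2 = {}" by auto
  then show ?thesis by (simp only: pair_form_def)
qed

lemma triple_form_at: "v \<in> C \<Longrightarrow> triple_form C F0 F1 F2 \<longleftrightarrow> (C = {v} \<and> F0 = {} \<and> F1 = {} \<and> F2 = {})
        \<or> (\<exists>p q r s. distinct [p, q, r, s] \<and> C = {p, q, r, s}
             \<and> F0 = {{p, q}} \<and> F1 = {{q, r}} \<and> F2 = {{r, s}})
        \<or> (\<exists>a b c d e. distinct [a, b, c, d, e] \<and> C = {a, b, c, d, e}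
             \<and> F0 = {{a, b}, {c, d}} \<and> F1 = {{a, b}, {d, e}} \<and> F2 = {{b, c}, {d, e}})
        \<or> (\<exists>u v' w x y z. distinct [u, v', w, x, y, z] \<and> C = {u, v', w, x, y, z}
             \<and> F0 = {{v', w}, {x, y}} \<and> F1 = {{u, v'}, {y, z}} \<and> F2 = {{v', x}, {w, y}})"
proof -
  assume "v \<in> C"
  then have "(\<exists>v. C = {v} \<and> F0 = {} \<and> F1 = {} \<and> F2 = {}) \<longleftrightarrow> C = {v} \<and> F0 = {} \<and> F1 = {} \<and> F2 = {}" by auto
  then show ?thesis by (simp only: triple_form_def)
qed

text \<open>Axiom 5 speaks of elements moved by both involutions. If one of them fixes
  \<open>T\<close>, commutation is a statement about fixed points, and these are governed by
  descents.\<close>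

lemma phi_comm_of_square:
  assumes inv: "involutions A phi n" and T: "T \<in> A" and ij: "1 < i" "i < n" "1 < j" "j < n"
    and square: "\<And>w x y. {w, x} \<in> Phi_of A phi i \<Longrightarrow> {x, y} \<in> Phi_of A phi j \<Longrightarrow>
      \<exists>v. {w, v} \<in> Phi_of A phi j \<and> {v, y} \<in> Phi_of A phi i"
    and fixed: "phi i T = T \<Longrightarrow> phi i (phi j T) = phi j T" "phi j T = T \<Longrightarrow> phi j (phi i T) = phi i T"
  shows "phi i (phi j T) = phi j (phi i T)"
proof -
  interpret involutions A phi n by (rule inv)
  consider "phi i T = T" | "phi j T = T" | "phi i T \<noteq> T" "phi j T \<noteq> T" by blast
  then show ?thesis
  proof cases
    case 3
    have iT: "phi i T \<in> A" using ij T by simp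
    have "{phi i T, T} \<in> Phi_of A phi i" using edge_iff[OF ij(1,2)] iT T 3 ij by auto
    moreover have "{T, phi j T} \<in> Phi_of A phi j" using edge_iff[OF ij(3,4)] T 3 by auto
    ultimately obtain v where "{phi i T, v} \<in> Phi_of A phi j" "{v, phi j T} \<in> Phi_of A phi i"
      using square by blast
    then have v: "v = phi j (phi i T)" "v \<in> A" "phi j T = phi i v"
      using edge_iff[OF ij(1,2)] edge_iff[OF ij(3,4)] by auto
    then show ?thesis using ij by simp
  qed (use fixed in simp_all)
qed

lemma pre_deg_of_is_deg:
  assumes inv: "involutions A phi n" and deg: "is_deg A (sigma_of D) (Phi_of A phi) n n"
  shows "pre_deg A D phi n" "\<forall>i. 1 < i \<and> i < n \<longrightarrow> one_edge A phi i"
proof -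
  interpret involutions A phi n by (rule inv)
  let ?s = "sigma_of D" and ?E = "Phi_of A phi"
  note ax = deg[unfolded is_deg_def, THEN conjunct2, THEN conjunct2]
  note ax1 = ax[THEN conjunct1]
    and ax2 = ax[THEN conjunct2, THEN conjunct1]
    and ax3 = ax[THEN conjunct2, THEN conjunct2, THEN conjunct1]
    and ax4a = ax[THEN conjunct2, THEN conjunct2, THEN conjunct2, THEN conjunct1]
    and ax4b = ax[THEN conjunct2, THEN conjunct2, THEN conjunct2, THEN conjunct2, THEN conjunct1]
    and ax5 = ax[THEN conjunct2, THEN conjunct2, THEN conjunct2, THEN conjunct2, THEN conjunct2, THEN conjunct1]
    and ax6 = ax[THEN conjunct2, THEN conjunct2, THEN conjunct2, THEN conjunct2, THEN conjunct2, THEN conjunct2]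
  have fixed_iff: "phi i T = T \<longleftrightarrow> (i - 1 \<in> D T \<longleftrightarrow> i \<in> D T)" if "1 < i" "i < n" "T \<in> A" for i T
  proof -
    have "(?s T (i - 1) = - ?s T i) \<longleftrightarrow> (\<exists>x. {T, x} \<in> ?E i)" using ax1 that by blast
    then show ?thesis unfolding sigma_of_eq edge_iff[OF that(1,2)] using that(3) by auto
  qed
  have edge: "{T, phi i T} \<in> ?E i" if "1 < i" "i < n" "T \<in> A" "phi i T \<noteq> T" for i T
    using edge_iff[OF that(1,2)] that(3,4) by simp
  have far: "j \<in> D (phi i T) \<longleftrightarrow> j \<in> D T"
    if "1 < i" "i < n" "T \<in> A" "1 \<le> j" "j < n" "j + 2 < i \<or> i + 1 < j" for i j T
  proof (cases "phi i T = T")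
    case False
    have "j \<le> n - 1" using that(5) by simp
    then have "?s T j = ?s (phi i T) j" using ax2[rule_format, of i T "phi i T"] edge[OF that(1-3) False] that by blast
    then show ?thesis unfolding sigma_of_eq by simp
  qed simp
  have pf: "pair_form (deq_class A phi (i - 1) i v) (edges (deq_class A phi (i - 1) i v) (phi (i - 1)))
      (edges (deq_class A phi (i - 1) i v) (phi i))" if i: "2 < i" "i < n" "v \<in> A" for i v
  proof -
    have c: "comp (?E (i - 1) \<union> ?E i) v = deq_class A phi (i - 1) i v"
      unfolding union_pair[OF i(1)] using component_eq[of v "i - 1" i] i by simp
    have r: "restr (deq_class A phi (i - 1) i v) (?E (i - 1)) = edges (deq_class A phi (i - 1) i v) (phi (i - 1))"
      "restr (deq_class A phi (i - 1) i v) (?E i) = edges (deq_class A phi (i - 1) i v) (phi i)"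
      using restr_eq[of v "i - 1" i] i by simp_all
    show ?thesis using ax4a[rule_format, of i v] i unfolding Let_def c r
      unfolding pair_form_at[OF mem_class_self] by blast
  qed
  have tf: "triple_form (deq_class A phi (i - 2) i v) (edges (deq_class A phi (i - 2) i v) (phi (i - 2)))
      (edges (deq_class A phi (i - 2) i v) (phi (i - 1))) (edges (deq_class A phi (i - 2) i v) (phi i))"
    if i: "3 < i" "i < n" "v \<in> A" for i v
  proof -
    have c: "comp (?E (i - 2) \<union> ?E (i - 1) \<union> ?E i) v = deq_class A phi (i - 2) i v"
      unfolding union_triple[OF i(1)] using component_eq[of v "i - 2" i] i by simp
    have r: "restr (deq_class A phi (i - 2) i v) (?E (i - 2)) = edges (deq_class A phi (i - 2) i v) (phi (i - 2))"
      "restr (deq_class A phi (i - 2) i v) (?E (i - 1)) = edges (deq_class A phi (i - 2) i v) (phi (i - 1))"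
      "restr (deq_class A phi (i - 2) i v) (?E i) = edges (deq_class A phi (i - 2) i v) (phi i)"
      using restr_eq[of v "i - 2" i] i by simp_all
    show ?thesis using ax4b[rule_format, of i v] i unfolding Let_def c r
      unfolding triple_form_at[OF mem_class_self] by blast
  qed
  have same: "phi i T = phi (i - 1) T"
    if i: "2 < i" "i < n" "T \<in> A" and m: "phi i T \<noteq> T" "phi (i - 1) T \<noteq> T"
      "phi i (phi (i - 1) T) \<noteq> phi (i - 1) T \<or> phi (i - 1) (phi i T) \<noteq> phi i T" for i T
    using pair_form_same_edge[OF pf[OF i] mem_class_self _ _ m(2,1,3)]
      class_step[of T A phi "i - 1" i T] i by simp
  show "pre_deg A D phi n"
  proof (unfold_locales)
    fix i T assume i: "1 < i" "i < n" "T \<in> A"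
    show "phi i T = T \<longleftrightarrow> (i - 1 \<in> D T \<longleftrightarrow> i \<in> D T)" by (rule fixed_iff[OF i])
    show "(i - 1 \<in> D (phi i T)) \<noteq> (i - 1 \<in> D T) \<and> (i \<in> D (phi i T)) \<noteq> (i \<in> D T)" if "phi i T \<noteq> T"
      using ax2[rule_format, of i T "phi i T"] edge[OF i that] i unfolding sigma_of_eq by blast
    show "j \<in> D (phi i T) \<longleftrightarrow> j \<in> D T" if "1 \<le> j" "j < n" "j + 2 < i \<or> i + 1 < j" for j
      by (rule far[OF i that])
    show "phi i (phi j T) = phi j (phi i T)" if j: "1 < j" "j < n" "j + 3 \<le> i" for j
    proof (rule phi_comm_of_square[OF inv i(3,1,2) j(1,2)])
      show "\<exists>v. {w, v} \<in> ?E j \<and> {v, y} \<in> ?E i" if "{w, x} \<in> ?E i" "{x, y} \<in> ?E j" for w x y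
        using ax5[rule_format, of i j w x y] i j that by blast
      have jA: "phi j T \<in> A" using j i by simp
      show "phi i (phi j T) = phi j T" if "phi i T = T"
        using that fixed_iff[OF i] fixed_iff[OF i(1,2) jA] far[OF j(1,2) i(3), of i] far[OF j(1,2) i(3), of "i - 1"]
          i j by auto
      show "phi j (phi i T) = phi i T" if "phi j T = T"
        using that fixed_iff[OF j(1,2) i(3)] fixed_iff[OF j(1,2) phi_A[OF i]] far[OF i, of j] far[OF i, of "j - 1"]
          i j by auto
    qed
  next
    fix i T assume i: "2 < i" "i < n" "T \<in> A"
    have i1: "1 < i" using i by simp
    show "(i - 2 \<in> D T) \<noteq> (i - 1 \<in> D T)" if "(i - 2 \<in> D (phi i T)) \<noteq> (i - 2 \<in> D T)"
    proof -
      have "phi i T \<noteq> T" using that by auto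
      then show ?thesis using ax3[rule_format, of i T "phi i T"] edge[OF i1 i(2,3)] i that unfolding sigma_of_eq by auto
    qed
    show "phi i T = phi (i - 1) T" if "phi i T \<noteq> T" "phi (i - 1) T \<noteq> T" "phi i (phi (i - 1) T) \<noteq> phi (i - 1) T"
      using same[OF i] that by blast
    show "phi i T = phi (i - 1) T" if "phi i T \<noteq> T" "phi (i - 1) T \<noteq> T" "phi (i - 1) (phi i T) \<noteq> phi i T"
      using same[OF i] that by blast
  next
    fix i T assume i: "1 < i" "i + 1 < n" "T \<in> A" and ne: "(i + 1 \<in> D (phi i T)) \<noteq> (i + 1 \<in> D T)"
    then have "phi i T \<noteq> T" by auto
    then show "(i + 1 \<in> D T) \<noteq> (i \<in> D T)"
      using ax3[rule_format, of i T "phi i T"] edge[of i T] i ne unfolding sigma_of_eq by auto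
  next
    fix i T d assume i: "3 < i" "i < n" "T \<in> A"
    let ?K = "deq_class A phi (i - 2) i T"
    have i': "1 < i - 2" "1 < i - 1" "1 < i" using i by auto
    have KA: "x \<in> A" if "x \<in> ?K" for x using class_sub[OF i(3) i'(1) i(2) that] .
    have inv: "phi (i - 2) (phi (i - 2) z) = z" "phi (i - 1) (phi (i - 1) z) = z" "phi i (phi i z) = z" if "z \<in> ?K" for z
      using KA[OF that] i' i by simp_all
    show "phi i d \<noteq> d \<and> phi (i - 1) d = phi i d"
      if "phi (i - 1) T \<noteq> T" "phi (i - 2) T = phi (i - 1) T" "phi i T \<noteq> T" "d = phi (i - 2) (phi i T)"
      unfolding that(4) by (rule triple_form_up[OF tf[OF i] mem_class_self inv that(1,2,3)])
    show "phi (i - 2) (phi i T) = phi (i - 1) (phi i T)"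
      if "phi i T \<noteq> T" "phi (i - 2) T \<noteq> T" "d = phi (i - 2) T" "phi i d \<noteq> d" "phi (i - 1) d = phi i d"
    proof (rule triple_form_down[OF tf[OF i] mem_class_self _ inv])
      show "phi (i - 2) T \<in> ?K" using class_step[of T A phi "i - 2" i T "i - 2"] i by simp
    qed (use that in simp_all)
  qed
  show "\<forall>i. 1 < i \<and> i < n \<longrightarrow> one_edge A phi i"
  proof (intro allI impI)
    fix i assume i: "1 < i \<and> i < n"
    have R: "(x, y) \<in> (edge_rel (\<Union>j\<in>{2..<i}. ?E j))\<^sup>* \<longleftrightarrow> y \<in> deq_class A phi 2 (i - 1) x" if "x \<in> A" for x y
      using path_iff[OF that] i by simp
    have C: "comp (\<Union>j\<in>{2..i}. ?E j) u = deq_class A phi 2 i u" if "u \<in> A" for u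
      using component_eq[OF that, of 2 i] i by simp
    show "one_edge A phi i" unfolding one_edge_def
    proof (intro ballI)
      fix u v assume u: "u \<in> A" and v: "v \<in> deq_class A phi 2 i u"
      have "(u, v) \<in> (edge_rel (\<Union>j\<in>{2..<i}. ?E j))\<^sup>* \<or> (\<exists>a b. (u, a) \<in> (edge_rel (\<Union>j\<in>{2..<i}. ?E j))\<^sup>* \<and>
          {a, b} \<in> ?E i \<and> (b, v) \<in> (edge_rel (\<Union>j\<in>{2..<i}. ?E j))\<^sup>*)"
        using ax6[rule_format, OF i u, of v] v unfolding C[OF u] Let_def by blast
      then show "v \<in> deq_class A phi 2 (i - 1) u \<or>
         (\<exists>a\<in>deq_class A phi 2 (i - 1) u. v \<in> deq_class A phi 2 (i - 1) (phi i a))"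
      proof (elim disjE exE conjE)
        fix a b assume ab: "(u, a) \<in> (edge_rel (\<Union>j\<in>{2..<i}. ?E j))\<^sup>*" "{a, b} \<in> ?E i"
          "(b, v) \<in> (edge_rel (\<Union>j\<in>{2..<i}. ?E j))\<^sup>*"
        then have "a \<in> A" "b = phi i a" using edge_iff[of i a b] i by auto
        moreover have "b \<in> A" using calculation i by simp
        ultimately show ?thesis using ab(1,3) R[OF u] R[of b v] by blast
      qed (use R[OF u] in blast)
    qed
  qed
qed

lemma is_degI:
  assumes pre: "pre_deg A D phi n"
    and pf: "\<And>i v. 2 < i \<Longrightarrow> i < n \<Longrightarrow> v \<in> A \<Longrightarrow> pair_form (deq_class A phi (i - 1) i v)
      (edges (deq_class A phi (i - 1) i v) (phi (i - 1))) (edges (deq_class A phi (i - 1) i v) (phi i))"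
    and tf: "\<And>i v. 3 < i \<Longrightarrow> i < n \<Longrightarrow> v \<in> A \<Longrightarrow> triple_form (deq_class A phi (i - 2) i v)
      (edges (deq_class A phi (i - 2) i v) (phi (i - 2))) (edges (deq_class A phi (i - 2) i v) (phi (i - 1)))
      (edges (deq_class A phi (i - 2) i v) (phi i))"
    and oe: "\<And>i. 1 < i \<Longrightarrow> i < n \<Longrightarrow> one_edge A phi i"
  shows "is_deg A (sigma_of D) (Phi_of A phi) n n"
proof -
  interpret pre_deg A D phi n by (rule pre)
  let ?s = "sigma_of D" and ?E = "Phi_of A phi"
  show ?thesis unfolding is_deg_def
  proof (intro conjI)
    show "signed_colored_graph A ?s ?E n n"
      unfolding signed_colored_graph_def
    proof (intro conjI ballI allI impI)
      fix i e assume i: "1 < i \<and> i < n" and "e \<in> ?E i"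
      then obtain T where "T \<in> A" "phi i T \<noteq> T" "e = {T, phi i T}" by (auto simp: Phi_of_def)
      then show "\<exists>x y. x \<in> A \<and> y \<in> A \<and> x \<noteq> y \<and> e = {x, y}" using i by (metis phi_A)
    qed (auto simp: finite_A sigma_of_def)
    show "n \<le> n" by simp
    show "\<forall>w\<in>A. \<forall>i. 1 < i \<and> i < n \<longrightarrow>
        ((?s w (i - 1) = - ?s w i) \<longleftrightarrow> (\<exists>x. {w, x} \<in> ?E i))
        \<and> (\<forall>x y. {w, x} \<in> ?E i \<and> {w, y} \<in> ?E i \<longrightarrow> x = y)"
    proof (intro ballI allI impI conjI)
      fix w i assume w: "w \<in> A" and i: "1 < i \<and> i < n"
      show "(?s w (i - 1) = - ?s w i) \<longleftrightarrow> (\<exists>x. {w, x} \<in> ?E i)"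
        unfolding sigma_of_eq edge_iff[OF conjunct1[OF i] conjunct2[OF i]] using fixed_iff[of i w] w i by auto
    next
      fix w i x y assume "w \<in> A" and i: "1 < i \<and> i < n" and e: "{w, x} \<in> ?E i \<and> {w, y} \<in> ?E i"
      then show "x = y" using edge_iff[of i w x] edge_iff[of i w y] by simp
    qed
    show "\<forall>i w x. 1 < i \<and> i < n \<and> {w, x} \<in> ?E i \<longrightarrow>
        ?s w (i - 1) = - ?s x (i - 1) \<and> ?s w i = - ?s x i
        \<and> (\<forall>h. 1 \<le> h \<and> h \<le> n - 1 \<and> (h + 2 < i \<or> i + 1 < h) \<longrightarrow> ?s w h = ?s x h)"
    proof (intro allI impI)
      fix i w x assume a: "1 < i \<and> i < n \<and> {w, x} \<in> ?E i"
      then have e: "w \<in> A" "x = phi i w" "x \<noteq> w" using edge_iff by blast+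
      have "(i - 1 \<in> D w) \<noteq> (i - 1 \<in> D x)" "(i \<in> D w) \<noteq> (i \<in> D x)" using flip[of i w] e a by auto
      moreover have "(h \<in> D w) = (h \<in> D x)" if "1 \<le> h \<and> h \<le> n - 1 \<and> (h + 2 < i \<or> i + 1 < h)" for h
        using far[of i w h] e a that by auto
      ultimately show "?s w (i - 1) = - ?s x (i - 1) \<and> ?s w i = - ?s x i
        \<and> (\<forall>h. 1 \<le> h \<and> h \<le> n - 1 \<and> (h + 2 < i \<or> i + 1 < h) \<longrightarrow> ?s w h = ?s x h)"
        unfolding sigma_of_eq by blast
    qed
    show "\<forall>i w x. 1 < i \<and> i < n \<and> {w, x} \<in> ?E i \<longrightarrow>
        (3 \<le> i \<and> ?s w (i - 2) = - ?s x (i - 2) \<longrightarrow> ?s w (i - 2) = - ?s w (i - 1))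
        \<and> (i + 1 \<le> n - 1 \<and> ?s w (i + 1) = - ?s x (i + 1) \<longrightarrow> ?s w (i + 1) = - ?s w i)"
      unfolding sigma_of_eq
    proof (intro allI impI conjI)
      fix i w x assume a: "1 < i \<and> i < n \<and> {w, x} \<in> ?E i"
      then have e: "w \<in> A" "x = phi i w" "x \<noteq> w" using edge_iff by blast+
      show "(i - 2 \<in> D w) \<noteq> (i - 1 \<in> D w)" if "3 \<le> i \<and> (i - 2 \<in> D w) \<noteq> (i - 2 \<in> D x)"
        using near_down[of i w] e a that by auto
      show "(i + 1 \<in> D w) \<noteq> (i \<in> D w)" if "i + 1 \<le> n - 1 \<and> (i + 1 \<in> D w) \<noteq> (i + 1 \<in> D x)"
      proof -
        have "i + 1 < n" using that a by linarith
        then show ?thesis using near_up[of i w] e a that by auto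
      qed
    qed
    show "\<forall>i. 2 < i \<and> i < n \<longrightarrow> (\<forall>v\<in>A.
        let C = comp (?E (i - 1) \<union> ?E i) v; F1 = restr C (?E (i - 1)); F2 = restr C (?E i) in
        (C = {v} \<and> F1 = {} \<and> F2 = {})
        \<or> (\<exists>x y z. distinct [x, y, z] \<and> C = {x, y, z} \<and> F1 = {{x, y}} \<and> F2 = {{y, z}})
        \<or> (\<exists>x y. x \<noteq> y \<and> C = {x, y} \<and> F1 = {{x, y}} \<and> F2 = {{x, y}}))"
    proof (intro allI impI ballI)
      fix i v assume i: "2 < i \<and> i < n" and v: "v \<in> A"
      then have i2: "2 < i" by simp
      have c: "comp (?E (i - 1) \<union> ?E i) v = deq_class A phi (i - 1) i v"
        unfolding union_pair[OF i2] using i v by (intro component_eq) linarith+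
      have r: "restr (deq_class A phi (i - 1) i v) (?E (i - 1)) = edges (deq_class A phi (i - 1) i v) (phi (i - 1))"
        "restr (deq_class A phi (i - 1) i v) (?E i) = edges (deq_class A phi (i - 1) i v) (phi i)"
        by (rule restr_eq; use i v in linarith)+
      show "let C = comp (?E (i - 1) \<union> ?E i) v; F1 = restr C (?E (i - 1)); F2 = restr C (?E i) in
        (C = {v} \<and> F1 = {} \<and> F2 = {})
        \<or> (\<exists>x y z. distinct [x, y, z] \<and> C = {x, y, z} \<and> F1 = {{x, y}} \<and> F2 = {{y, z}})
        \<or> (\<exists>x y. x \<noteq> y \<and> C = {x, y} \<and> F1 = {{x, y}} \<and> F2 = {{x, y}})"
        unfolding Let_def c r using pf[OF i2 conjunct2[OF i] v] unfolding pair_form_at[OF mem_class_self] .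
    qed
    show "\<forall>i. 3 < i \<and> i < n \<longrightarrow> (\<forall>v\<in>A.
        let C = comp (?E (i - 2) \<union> ?E (i - 1) \<union> ?E i) v;
            F0 = restr C (?E (i - 2)); F1 = restr C (?E (i - 1)); F2 = restr C (?E i) in
        (C = {v} \<and> F0 = {} \<and> F1 = {} \<and> F2 = {})
        \<or> (\<exists>p q r s. distinct [p, q, r, s] \<and> C = {p, q, r, s}
             \<and> F0 = {{p, q}} \<and> F1 = {{q, r}} \<and> F2 = {{r, s}})
        \<or> (\<exists>a b c d e. distinct [a, b, c, d, e] \<and> C = {a, b, c, d, e}
             \<and> F0 = {{a, b}, {c, d}} \<and> F1 = {{a, b}, {d, e}} \<and> F2 = {{b, c}, {d, e}})
        \<or> (\<exists>u v' w x y z. distinct [u, v', w, x, y, z] \<and> C = {u, v', w, x, y, z}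
             \<and> F0 = {{v', w}, {x, y}} \<and> F1 = {{u, v'}, {y, z}} \<and> F2 = {{v', x}, {w, y}}))"
    proof (intro allI impI ballI)
      fix i v assume i: "3 < i \<and> i < n" and v: "v \<in> A"
      then have i3: "3 < i" by simp
      have c: "comp (?E (i - 2) \<union> ?E (i - 1) \<union> ?E i) v = deq_class A phi (i - 2) i v"
        unfolding union_triple[OF i3] using i v by (intro component_eq) linarith+
      have r: "restr (deq_class A phi (i - 2) i v) (?E (i - 2)) = edges (deq_class A phi (i - 2) i v) (phi (i - 2))"
        "restr (deq_class A phi (i - 2) i v) (?E (i - 1)) = edges (deq_class A phi (i - 2) i v) (phi (i - 1))"
        "restr (deq_class A phi (i - 2) i v) (?E i) = edges (deq_class A phi (i - 2) i v) (phi i)"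
        by (rule restr_eq; use i v in linarith)+
      show "let C = comp (?E (i - 2) \<union> ?E (i - 1) \<union> ?E i) v;
            F0 = restr C (?E (i - 2)); F1 = restr C (?E (i - 1)); F2 = restr C (?E i) in
        (C = {v} \<and> F0 = {} \<and> F1 = {} \<and> F2 = {})
        \<or> (\<exists>p q r s. distinct [p, q, r, s] \<and> C = {p, q, r, s}
             \<and> F0 = {{p, q}} \<and> F1 = {{q, r}} \<and> F2 = {{r, s}})
        \<or> (\<exists>a b c d e. distinct [a, b, c, d, e] \<and> C = {a, b, c, d, e}
             \<and> F0 = {{a, b}, {c, d}} \<and> F1 = {{a, b}, {d, e}} \<and> F2 = {{b, c}, {d, e}})
        \<or> (\<exists>u v' w x y z. distinct [u, v', w, x, y, z] \<and> C = {u, v', w, x, y, z}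
             \<and> F0 = {{v', w}, {x, y}} \<and> F1 = {{u, v'}, {y, z}} \<and> F2 = {{v', x}, {w, y}})"
        unfolding Let_def c r using tf[OF i3 conjunct2[OF i] v] unfolding triple_form_at[OF mem_class_self] .
    qed
    show "\<forall>i j w x y. 1 < i \<and> i < n \<and> 1 < j \<and> j < n \<and> (i + 3 \<le> j \<or> j + 3 \<le> i)
        \<and> {w, x} \<in> ?E i \<and> {x, y} \<in> ?E j \<longrightarrow> (\<exists>v. {w, v} \<in> ?E j \<and> {v, y} \<in> ?E i)"
    proof (intro allI impI)
      fix i j w x y
      assume a: "1 < i \<and> i < n \<and> 1 < j \<and> j < n \<and> (i + 3 \<le> j \<or> j + 3 \<le> i) \<and> {w, x} \<in> ?E i \<and> {x, y} \<in> ?E j"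
      then have e: "w \<in> A" "x = phi i w" "x \<noteq> w" "y = phi j x" "y \<noteq> x" "x \<in> A"
        using edge_iff[of i w x] edge_iff[of j x y] by blast+
      have cw: "phi i (phi j w) = phi j (phi i w)" using comm[of i j w] comm[of j i w] a e(1) by metis
      have jw: "phi j w \<in> A" using a e(1) by simp
      have "phi j w \<noteq> w" using cw e by metis
      then have "{w, phi j w} \<in> ?E j" using edge_iff[of j w] a e(1) by blast
      moreover have "phi i (phi j w) \<noteq> phi j w"
      proof
        assume "phi i (phi j w) = phi j w"
        then have "phi j x = phi j w" using cw e(2) by simp
        then have "phi j (phi j x) = phi j (phi j w)" by simp
        then show False using a e by simp
      qed
      then have "{phi j w, y} \<in> ?E i" using edge_iff[of i "phi j w" y] a jw cw e by metis
      ultimately show "\<exists>v. {w, v} \<in> ?E j \<and> {v, y} \<in> ?E i" by blast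
    qed
    show "\<forall>i. 1 < i \<and> i < n \<longrightarrow> (\<forall>u\<in>A. \<forall>v\<in>comp (\<Union>j\<in>{2..i}. ?E j) u.
        let R = (edge_rel (\<Union>j\<in>{2..<i}. ?E j))\<^sup>* in
        (u, v) \<in> R \<or> (\<exists>a b. (u, a) \<in> R \<and> {a, b} \<in> ?E i \<and> (b, v) \<in> R))"
    proof (intro allI impI ballI)
      fix i u v assume i: "1 < i \<and> i < n" and u: "u \<in> A" and v: "v \<in> comp (\<Union>j\<in>{2..i}. ?E j) u"
      have R: "(x, y) \<in> (edge_rel (\<Union>j\<in>{2..<i}. ?E j))\<^sup>* \<longleftrightarrow> y \<in> deq_class A phi 2 (i - 1) x" if "x \<in> A" for x y
        using path_iff[OF that] i by simp
      have "v \<in> deq_class A phi 2 i u" using component_eq[OF u, of 2 i] i v by simp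
      then consider "v \<in> deq_class A phi 2 (i - 1) u"
        | a where "a \<in> deq_class A phi 2 (i - 1) u" "v \<in> deq_class A phi 2 (i - 1) (phi i a)"
        using oe[of i] i u unfolding one_edge_def by blast
      then show "let R = (edge_rel (\<Union>j\<in>{2..<i}. ?E j))\<^sup>* in
        (u, v) \<in> R \<or> (\<exists>a b. (u, a) \<in> R \<and> {a, b} \<in> ?E i \<and> (b, v) \<in> R)"
        unfolding Let_def
      proof cases
        case 2
        have aA: "a \<in> A" by (rule class_sub[OF u _ _ 2(1)]) (use i in linarith)+
        show "(u, v) \<in> (edge_rel (\<Union>j\<in>{2..<i}. ?E j))\<^sup>* \<or> (\<exists>a b. (u, a) \<in> (edge_rel (\<Union>j\<in>{2..<i}. ?E j))\<^sup>* \<and>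
          {a, b} \<in> ?E i \<and> (b, v) \<in> (edge_rel (\<Union>j\<in>{2..<i}. ?E j))\<^sup>*)"
        \<comment> \<open>\<open>one_edge\<close> also admits a step at which \<open>phi i\<close>
          is idle; this is no edge of the graph, but then the two classes coincide.\<close>
        proof (cases "phi i a = a")
          case True
          then have "v \<in> deq_class A phi 2 (i - 1) u" using 2 class_trans by metis
          then show ?thesis using R[OF u] by blast
        next
          case False
          then have "{a, phi i a} \<in> ?E i" using edge_iff[of i a] i aA by blast
          moreover have "phi i a \<in> A" using aA i by simp
          ultimately show ?thesis using 2 R[OF u] R by blast
        qed
      qed (use R[OF u] in blast)
    qed
  qed
qed

section \<open>From Schur functions to the graph axioms\<close>

locale schur_classes = involutions A phi n
  for A :: "'a set" and D :: "'a \<Rightarrow> nat set" and phi :: "nat \<Rightarrow> 'a \<Rightarrow> 'a" and n :: nat +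
  assumes schur: "1 < h \<Longrightarrow> h \<le> i \<Longrightarrow> i < n \<Longrightarrow> i - h \<le> 3 \<Longrightarrow> T \<in> A \<Longrightarrow> schur_class A D phi h i T"
    and commute: "1 < i \<Longrightarrow> i < n \<Longrightarrow> 1 < j \<Longrightarrow> j < n \<Longrightarrow> i + 3 \<le> j \<or> j + 3 \<le> i \<Longrightarrow> T \<in> A \<Longrightarrow>
      phi i (phi j T) = phi j (phi i T)"
begin

lemma class_families:
  assumes h: "1 < h" "h \<le> i" "i < n" "i - h \<le> 3" and T: "T \<in> A"
    and exec: "\<forall>w\<in>set (lattice_words (i - h + 3)).
       let X = map des_list (filter (\<lambda>v. sort v = sort w) (lattice_words (i - h + 3))) in distinct X \<and> X \<in> set Fs"
  shows "inj_on (Des_hi D h i) (deq_class A phi h i T)"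
    "Des_hi D h i ` deq_class A phi h i T \<in> (\<lambda>X. set ` set X) ` set Fs"
proof -
  obtain lam where lam: "is_partition lam (i - h + 3)"
    "\<And>M. (\<Sum>U\<in>deq_class A phi h i T. fundQ (i - h + 3) (Des_hi D h i U) M) = schur lam M"
    using schur[OF h T] unfolding schur_class_def by blast
  have h2: "2 \<le> h" using h by simp
  have "inj_on (Des_hi D h i) (deq_class A phi h i T) \<and>
      Des_hi D h i ` deq_class A phi h i T \<in> (\<lambda>X. set ` set X) ` set Fs"
    by (rule schur_des_families[OF lam(1) finite_class[OF T h(1,3)] Des_hi_subset[OF h2 h(2)] lam(2) exec])
  then show "inj_on (Des_hi D h i) (deq_class A phi h i T)"
    "Des_hi D h i ` deq_class A phi h i T \<in> (\<lambda>X. set ` set X) ` set Fs" by blast+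
qed

text \<open>The class under a single involution has at most two elements. By degree 3 it has one
  descent set, with positions 1 and 2 both in or both out, or the two sets {1} and {2}; injectivity
  decides which elements are fixed.\<close>

lemma fixed_and_flip:
  assumes i: "1 < i" "i < n" and T: "T \<in> A"
  shows "phi i T = T \<longleftrightarrow> (i - 1 \<in> D T \<longleftrightarrow> i \<in> D T)"
    "phi i T \<noteq> T \<Longrightarrow> (i - 1 \<in> D (phi i T)) \<noteq> (i - 1 \<in> D T) \<and> (i \<in> D (phi i T)) \<noteq> (i \<in> D T)"
proof -
  let ?K = "deq_class A phi i i T" and ?d = "Des_hi D i i"
  have K: "?K = {T, phi i T}"
  proof (intro equalityI subsetI)
    fix U assume "U \<in> ?K"
    then show "U \<in> {T, phi i T}" using T i
    proof (induction rule: class_induct)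
      case (step V j)
      then have "j = i" by simp
      then show ?case using step i T by auto
    qed simp
  qed (use class_step[of T A phi i i T i] T in auto)
  have inj: "inj_on ?d ?K" and fam: "?d ` ?K \<in> {{{}}, {{2}, {1}}, {{1, 2}}}"
    using class_families[of i i T, unfolded diff_self_eq_0 add_0, OF i(1) order_refl i(2) _ T des_families_exec(1)] by simp_all
  have d: "1 \<in> ?d U \<longleftrightarrow> i - 1 \<in> D U" "2 \<in> ?d U \<longleftrightarrow> i \<in> D U" for U
  proof -
    have "1 + (i - 2) = i - 1" "2 + (i - 2) = i" "2 \<le> i" using i by auto
    then show "1 \<in> ?d U \<longleftrightarrow> i - 1 \<in> D U" "2 \<in> ?d U \<longleftrightarrow> i \<in> D U" by (simp_all add: mem_Des_hi)
  qed
  from fam consider "?d ` ?K = {{}}" | "?d ` ?K = {{2}, {1}}" | "?d ` ?K = {{1, 2}}"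
    by atomize_elim (simp only: insert_iff empty_iff simp_thms)
  then have "(phi i T = T \<longleftrightarrow> (1 \<in> ?d T \<longleftrightarrow> 2 \<in> ?d T)) \<and> (phi i T \<noteq> T \<longrightarrow>
      (1 \<in> ?d (phi i T)) \<noteq> (1 \<in> ?d T) \<and> (2 \<in> ?d (phi i T)) \<noteq> (2 \<in> ?d T))"
  proof cases
    case 1
    then have "?d T = {}" "?d (phi i T) = {}" unfolding K by auto
    then show ?thesis using inj_onD[OF inj, of "phi i T" T] K by auto
  next
    case 2
    then have "{?d T, ?d (phi i T)} = {{2}, {1}}" unfolding K by simp
    then show ?thesis by (auto simp: doubleton_eq_iff)
  next
    case 3
    then have "?d T = {1, 2}" "?d (phi i T) = {1, 2}" unfolding K by auto
    then show ?thesis using inj_onD[OF inj, of "phi i T" T] K by auto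
  qed
  then show "phi i T = T \<longleftrightarrow> (i - 1 \<in> D T \<longleftrightarrow> i \<in> D T)"
    "phi i T \<noteq> T \<Longrightarrow> (i - 1 \<in> D (phi i T)) \<noteq> (i - 1 \<in> D T) \<and> (i \<in> D (phi i T)) \<noteq> (i \<in> D T)"
    unfolding d by blast+
qed

lemma flips_class:
  assumes h: "1 < h" "i < n" "h \<le> j" "j \<le> i" and T: "T \<in> A"
  shows "flips (deq_class A phi h i T) (Des_hi D h i) (phi j) (j - (h - 2))"
  unfolding flips_def
proof
  fix x assume x: "x \<in> deq_class A phi h i T"
  have xA: "x \<in> A" using class_sub[OF T h(1,2) x] .
  have j: "1 < j" "j < n" using h by auto
  have d: "j - (h - 2) - 1 \<in> Des_hi D h i U \<longleftrightarrow> j - 1 \<in> D U" "j - (h - 2) \<in> Des_hi D h i U \<longleftrightarrow> j \<in> D U" for U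
  proof -
    have "j - (h - 2) - 1 + (h - 2) = j - 1" "j - (h - 2) + (h - 2) = j" using h by auto
    then show "j - (h - 2) - 1 \<in> Des_hi D h i U \<longleftrightarrow> j - 1 \<in> D U" "j - (h - 2) \<in> Des_hi D h i U \<longleftrightarrow> j \<in> D U"
      using h by (auto simp: mem_Des_hi)
  qed
  show "phi j x \<in> deq_class A phi h i T \<and> phi j (phi j x) = x \<and>
      (phi j x = x \<longleftrightarrow> (j - (h - 2) - 1 \<in> Des_hi D h i x \<longleftrightarrow> j - (h - 2) \<in> Des_hi D h i x)) \<and>
      (phi j x \<noteq> x \<longrightarrow> (j - (h - 2) - 1 \<in> Des_hi D h i (phi j x)) \<noteq> (j - (h - 2) - 1 \<in> Des_hi D h i x) \<and>
        (j - (h - 2) \<in> Des_hi D h i (phi j x)) \<noteq> (j - (h - 2) \<in> Des_hi D h i x))"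
    unfolding d using class_step[OF x xA h(3,4)] fixed_and_flip[OF j xA] phi_phi[OF j xA] by blast
qed

lemma window2:
  assumes i: "2 < i" "i < n" and T: "T \<in> A"
  defines "K \<equiv> deq_class A phi (i - 1) i T"
  shows "pair_form K (edges K (phi (i - 1))) (edges K (phi i))"
    "(i \<in> D (phi (i - 1) T)) \<noteq> (i \<in> D T) \<Longrightarrow> (i \<in> D T) \<noteq> (i - 1 \<in> D T)"
    "(i - 2 \<in> D (phi i T)) \<noteq> (i - 2 \<in> D T) \<Longrightarrow> (i - 2 \<in> D T) \<noteq> (i - 1 \<in> D T)"
proof -
  let ?d = "Des_hi D (i - 1) i"
  have k: "1 < i - 1" "i - 1 \<le> i" "i - (i - 1) \<le> 3" "i - (i - 1) + 3 = 4" "i - (i - 1 - 2) = 3" "i - 1 - (i - 1 - 2) = 2"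
    using i by auto
  have inj: "inj_on ?d K" and fam: "?d ` K \<in> {{{}}, {{3}, {2}, {1}}, {{2}, {1, 3}}, {{2, 3}, {1, 3}, {1, 2}}, {{1, 2, 3}}}"
    using class_families[OF k(1,2) i(2) k(3) T, unfolded k(4), OF des_families_exec(2)] by (simp_all add: K_def)
  have f: "flips K ?d (phi (i - 1)) 2" "flips K ?d (phi i) 3"
    using flips_class[OF k(1) i(2) order_refl k(2) T] flips_class[OF k(1) i(2) k(2) order_refl T] k
    by (simp_all add: K_def)
  note w = window_pair[OF f inj fam]
  then show "pair_form K (edges K (phi (i - 1))) (edges K (phi i))" by blast
  have d: "1 \<in> ?d U \<longleftrightarrow> i - 2 \<in> D U" "2 \<in> ?d U \<longleftrightarrow> i - 1 \<in> D U" "3 \<in> ?d U \<longleftrightarrow> i \<in> D U" for U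
  proof -
    have "1 + (i - 1 - 2) = i - 2" "2 + (i - 1 - 2) = i - 1" "3 + (i - 1 - 2) = i" "2 \<le> i - 1" using i by auto
    then show "1 \<in> ?d U \<longleftrightarrow> i - 2 \<in> D U" "2 \<in> ?d U \<longleftrightarrow> i - 1 \<in> D U" "3 \<in> ?d U \<longleftrightarrow> i \<in> D U"
      using i by (simp_all add: mem_Des_hi)
  qed
  have TK: "T \<in> K" by (simp add: K_def)
  show "(i \<in> D T) \<noteq> (i - 1 \<in> D T)" if "(i \<in> D (phi (i - 1) T)) \<noteq> (i \<in> D T)"
    using w TK that unfolding d by blast
  show "(i - 2 \<in> D T) \<noteq> (i - 1 \<in> D T)" if "(i - 2 \<in> D (phi i T)) \<noteq> (i - 2 \<in> D T)"
    using w TK that unfolding d by blast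
qed

lemma same_edge:
  assumes i: "2 < i" "i < n" and T: "T \<in> A" and m: "phi (i - 1) T \<noteq> T" "phi i T \<noteq> T"
      "phi i (phi (i - 1) T) \<noteq> phi (i - 1) T \<or> phi (i - 1) (phi i T) \<noteq> phi i T"
  shows "phi i T = phi (i - 1) T"
  using pair_form_same_edge[OF window2(1)[OF i T] mem_class_self _ _ m]
    class_step[of T A phi "i - 1" i T] i T by simp

text \<open>Besides the second part of axiom 4, degree 5 shows that an involution preserves the
  descent two above and the descent three below its index: the starting points for all far
  descents.\<close>

lemma window3:
  assumes i: "3 < i" "i < n" and T: "T \<in> A"
  defines "K \<equiv> deq_class A phi (i - 2) i T"
  shows "triple_form K (edges K (phi (i - 2))) (edges K (phi (i - 1))) (edges K (phi i))"
    "i \<in> D (phi (i - 2) T) \<longleftrightarrow> i \<in> D T"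
    "i - 3 \<in> D (phi i T) \<longleftrightarrow> i - 3 \<in> D T"
proof -
  let ?d = "Des_hi D (i - 2) i"
  have k: "1 < i - 2" "i - 2 \<le> i" "i - (i - 2) \<le> 3" "i - (i - 2) + 3 = 5" "i - (i - 2 - 2) = 4"
    "i - 1 - (i - 2 - 2) = 3" "i - 2 - (i - 2 - 2) = 2" "i - 2 \<le> i - 1" "i - 1 \<le> i"
    using i by auto
  have inj: "inj_on ?d K" and fam: "?d ` K \<in> {{{}}, {{4}, {3}, {2}, {1}}, {{3}, {2, 4}, {2}, {1, 4}, {1, 3}},
       {{3, 4}, {2, 4}, {2, 3}, {1, 4}, {1, 3}, {1, 2}}, {{2, 4}, {2, 3}, {1, 3, 4}, {1, 3}, {1, 2, 4}},
       {{2, 3, 4}, {1, 3, 4}, {1, 2, 4}, {1, 2, 3}}, {{1, 2, 3, 4}}}"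
    using class_families[OF k(1,2) i(2) k(3) T, unfolded k(4), OF des_families_exec(3)] by (simp_all add: K_def)
  have f: "flips K ?d (phi (i - 2)) 2" "flips K ?d (phi (i - 1)) 3" "flips K ?d (phi i) 4"
    using flips_class[OF k(1) i(2) order_refl k(2) T] flips_class[OF k(1) i(2) k(8,9) T]
      flips_class[OF k(1) i(2) k(2) order_refl T] k by (simp_all add: K_def)
  have KA: "x \<in> A" if "x \<in> K" for x using class_sub[OF T k(1) i(2)] that by (simp add: K_def)
  have "2 < i - 1" "i - 1 < n" "i - 1 - 1 = i - 2" "2 < i" using i by auto
  note s1 = same_edge[OF this(1,2), unfolded this(3)] and s2 = same_edge[OF this(4) i(2)]
  have conn: "S = K" if S: "S \<subseteq> K" "S \<noteq> {}"
    "\<And>x. x \<in> S \<Longrightarrow> phi (i - 2) x \<in> S \<and> phi (i - 1) x \<in> S \<and> phi i x \<in> S" for S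
  proof -
    obtain x where x: "x \<in> S" using S(2) by blast
    then have xK: "x \<in> K" using S(1) by blast
    have "y \<in> S" if "y \<in> K" for y
    proof -
      have "y \<in> deq_class A phi (i - 2) i x"
        using class_eq[OF T k(1) i(2), of x] xK that by (simp add: K_def)
      then show ?thesis using KA[OF xK] k(1) i(2)
      proof (induction rule: class_induct)
        case (step V j)
        have "j = i - 2 \<or> j = i - 1 \<or> j = i" using step.hyps by linarith
        then show ?case using S(3)[OF step.IH] by blast
      qed (fact x)
    qed
    then show ?thesis using S(1) by blast
  qed
  have w: "triple_form K (edges K (phi (i - 2))) (edges K (phi (i - 1))) (edges K (phi i)) \<and>
    (\<forall>x\<in>K. 4 \<in> ?d (phi (i - 2) x) \<longleftrightarrow> 4 \<in> ?d x) \<and> (\<forall>x\<in>K. 1 \<in> ?d (phi i x) \<longleftrightarrow> 1 \<in> ?d x)"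
    by (rule window_triple[OF f inj fam s1[OF KA] s2[OF KA] conn]; assumption)
  then show "triple_form K (edges K (phi (i - 2))) (edges K (phi (i - 1))) (edges K (phi i))" by blast
  have d: "1 \<in> ?d U \<longleftrightarrow> i - 3 \<in> D U" "4 \<in> ?d U \<longleftrightarrow> i \<in> D U" for U
  proof -
    have "1 + (i - 2 - 2) = i - 3" "4 + (i - 2 - 2) = i" "2 \<le> i - 2" using i by auto
    then show "1 \<in> ?d U \<longleftrightarrow> i - 3 \<in> D U" "4 \<in> ?d U \<longleftrightarrow> i \<in> D U" by (simp_all add: mem_Des_hi)
  qed
  have TK: "T \<in> K" by (simp add: K_def)
  show "i \<in> D (phi (i - 2) T) \<longleftrightarrow> i \<in> D T" "i - 3 \<in> D (phi i T) \<longleftrightarrow> i - 3 \<in> D T"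
    using w TK unfolding d by blast+
qed

text \<open>Far descents are preserved: \<open>phi j\<close> commutes with \<open>phi i\<close>, and whether \<open>phi j\<close> moves an element
  records whether the descents at \<open>j - 1\<close> and \<open>j\<close> agree.\<close>

lemma far_agree:
  assumes i: "1 < i" "i < n" and j: "1 < j" "j < n" "i + 3 \<le> j \<or> j + 3 \<le> i" and T: "T \<in> A"
  shows "(j - 1 \<in> D (phi i T) \<longleftrightarrow> j \<in> D (phi i T)) \<longleftrightarrow> (j - 1 \<in> D T \<longleftrightarrow> j \<in> D T)"
proof -
  have iT: "phi i T \<in> A" using i T by simp
  have "phi j (phi i T) = phi i T \<longleftrightarrow> phi j T = T"
    using commute[OF i j T] phi_phi[OF i T] phi_phi[OF i, of "phi j T"] phi_A[OF j(1,2) T] by metis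
  then show ?thesis using fixed_and_flip(1)[OF j(1,2) iT] fixed_and_flip(1)[OF j(1,2) T] by simp
qed

text \<open>Degree 5 settles \<open>j = i + 2\<close>. From there on, agreement of the descents
  \<open>j - 1\<close> and \<open>j\<close> is preserved by commutation, so the descents follow one
  after another.\<close>

lemma far_up:
  assumes i: "1 < i" "i < n" and T: "T \<in> A" and j: "i + 2 \<le> j" "j < n"
  shows "j \<in> D (phi i T) \<longleftrightarrow> j \<in> D T"
  using j
proof (induction j rule: dec_induct)
  case base
  then show ?case using window3(2)[of "i + 2" T] i T by simp
next
  case (step j)
  then have "j \<in> D (phi i T) \<longleftrightarrow> j \<in> D T" "1 < Suc j" "Suc j < n" "i + 3 \<le> Suc j" using i by auto
  then show ?case using far_agree[OF i, of "Suc j" T] T by auto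
qed

lemma far_down:
  assumes i: "1 < i" "i < n" and T: "T \<in> A" and j: "1 \<le> j" "j + 3 \<le> i"
  shows "j \<in> D (phi i T) \<longleftrightarrow> j \<in> D T"
proof -
  have "j \<le> i - 3" using j by simp
  then show ?thesis using j(1)
  proof (induction j rule: inc_induct)
    case base
    then show ?case using window3(3)[of i T] i T by simp
  next
    case (step j)
    then have "Suc j \<in> D (phi i T) \<longleftrightarrow> Suc j \<in> D T" "1 < Suc j" "Suc j < n" "Suc j + 3 \<le> i" using i by auto
    then show ?case using far_agree[OF i, of "Suc j" T] T by auto
  qed
qed

lemma pre_deg_axioms: "pre_deg A D phi n"
proof unfold_locales
  fix i T assume i: "1 < i" "i < n" "T \<in> A"
  show "phi i T = T \<longleftrightarrow> (i - 1 \<in> D T \<longleftrightarrow> i \<in> D T)" by (rule fixed_and_flip(1)[OF i])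
  show "(i - 1 \<in> D (phi i T)) \<noteq> (i - 1 \<in> D T) \<and> (i \<in> D (phi i T)) \<noteq> (i \<in> D T)" if "phi i T \<noteq> T"
    by (rule fixed_and_flip(2)[OF i that])
  show "j \<in> D (phi i T) \<longleftrightarrow> j \<in> D T" if "1 \<le> j" "j < n" "j + 2 < i \<or> i + 1 < j" for j
    using that(3)
  proof
    assume "j + 2 < i"
    then show ?thesis using far_down[OF i that(1)] by simp
  next
    assume "i + 1 < j"
    then show ?thesis using far_up[OF i _ that(2)] by simp
  qed
  show "phi i (phi j T) = phi j (phi i T)" if "1 < j" "j < n" "j + 3 \<le> i" for j
    using commute[OF i(1,2) that(1,2) _ i(3)] that(3) by blast
next
  fix i T assume i: "2 < i" "i < n" "T \<in> A"
  show "(i - 2 \<in> D T) \<noteq> (i - 1 \<in> D T)" if "(i - 2 \<in> D (phi i T)) \<noteq> (i - 2 \<in> D T)"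
    by (rule window2(3)[OF i that])
  show "phi i T = phi (i - 1) T" if "phi i T \<noteq> T" "phi (i - 1) T \<noteq> T" "phi i (phi (i - 1) T) \<noteq> phi (i - 1) T"
    using same_edge[OF i that(2,1)] that(3) by blast
  show "phi i T = phi (i - 1) T" if "phi i T \<noteq> T" "phi (i - 1) T \<noteq> T" "phi (i - 1) (phi i T) \<noteq> phi i T"
    using same_edge[OF i that(2,1)] that(3) by blast
next
  fix i T assume i: "1 < i" "i + 1 < n" "T \<in> A" and ne: "(i + 1 \<in> D (phi i T)) \<noteq> (i + 1 \<in> D T)"
  then show "(i + 1 \<in> D T) \<noteq> (i \<in> D T)" using window2(2)[of "i + 1" T] by simp
next
  fix i T d assume i: "3 < i" "i < n" "T \<in> A"
  let ?K = "deq_class A phi (i - 2) i T"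
  have i': "1 < i - 2" "1 < i - 1" "1 < i" using i by auto
  have KA: "x \<in> A" if "x \<in> ?K" for x using class_sub[OF i(3) i'(1) i(2) that] .
  have inv: "phi (i - 2) (phi (i - 2) z) = z" "phi (i - 1) (phi (i - 1) z) = z" "phi i (phi i z) = z" if "z \<in> ?K" for z
    using KA[OF that] i' i by simp_all
  show "phi i d \<noteq> d \<and> phi (i - 1) d = phi i d"
    if "phi (i - 1) T \<noteq> T" "phi (i - 2) T = phi (i - 1) T" "phi i T \<noteq> T" "d = phi (i - 2) (phi i T)"
    unfolding that(4) by (rule triple_form_up[OF window3(1)[OF i] mem_class_self inv that(1,2,3)])
  show "phi (i - 2) (phi i T) = phi (i - 1) (phi i T)"
    if "phi i T \<noteq> T" "phi (i - 2) T \<noteq> T" "d = phi (i - 2) T" "phi i d \<noteq> d" "phi (i - 1) d = phi i d"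
  proof (rule triple_form_down[OF window3(1)[OF i] mem_class_self _ inv])
    show "phi (i - 2) T \<in> ?K" using class_step[of T A phi "i - 2" i T "i - 2"] i by simp
  qed (use that in simp_all)
qed

text \<open>For \<open>i \<le> 5\<close> the whole class of \<open>phi 2\<close>, ...,
  \<open>phi i\<close> has degree at most 6 and is labelled injectively. For larger \<open>i\<close>
  only the last four involutions are under control, and the closed walks take over.\<close>

lemma one_edge_of_schur:
  assumes "chart_extension A D phi n i f r"
  shows "one_edge A phi i"
proof -
  interpret chart_extension A D phi n i f r by (rule assms)
  show ?thesis
  proof (cases "6 \<le> i")
    case True
    have "inj_on g (deq_class A phi (i - 3) i T)" if "T \<in> A" for T
      using schur_class_inj[of "i - 3" T] schur[of "i - 3" i T] True i_n that by simp
    then interpret windowed_extension A D phi n i f r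
      by unfold_locales (use True in auto)
    show ?thesis by (rule one_edge_windowed)
  next
    case False
    have "inj_on g (deq_class A phi 2 i T)" if "T \<in> A" for T
      using schur_class_inj[of 2 T] schur[of 2 i T] False i2 i_n that by simp
    then show ?thesis by (rule one_edge_of_inj)
  qed
qed

theorem is_deg_of_schur: "is_deg A (sigma_of D) (Phi_of A phi) n n"
proof (rule is_degI[OF pre_deg_axioms window2(1) window3(1)])
  interpret pre_deg A D phi n by (rule pre_deg_axioms)
  fix i assume i: "1 < i" "i < n"
  obtain f where f: "chart A D phi i f" "\<And>T. T \<in> A \<Longrightarrow> inj_on f (deq_class A phi 2 (i - 1) T)"
  proof -
    have "\<exists>f. chart A D phi i f \<and> (\<forall>T\<in>A. inj_on f (deq_class A phi 2 (i - 1) T))"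
    proof (rule ex_inj_chart)
      fix k f r assume "chart_extension A D phi n k f r"
      then show "one_edge A phi k" by (rule one_edge_of_schur)
    qed (use i in simp_all)
    then show ?thesis using that by blast
  qed
  have i': "1 \<le> i" "2 \<le> i" using i by auto
  obtain r where r: "\<And>T. T \<in> A \<Longrightarrow> lattice_word (f T @ [r T])" "\<And>T. T \<in> A \<Longrightarrow> i \<in> D T \<longleftrightarrow> last (f T) < r T"
    and r_const: "\<And>T U. T \<in> A \<Longrightarrow> U \<in> deq_class A phi 2 (i - 1) T \<Longrightarrow> r U = r T"
    using ex_extension_letters[OF f i'(1) i(2)] by blast
  show "one_edge A phi i"
  proof (rule one_edge_of_schur)
    show "chart_extension A D phi n i f r"
      by unfold_locales (fact f(1) i'(2) i(2) | erule f(2) | erule (1) r_const | erule r)+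
  qed
qed

end

theorem theorem4p2:
  fixes A :: "'a set" and Des :: "'a \<Rightarrow> nat set" and phi :: "nat \<Rightarrow> 'a \<Rightarrow> 'a" and n :: nat
  assumes "finite A"
    and "\<forall>T\<in>A. Des T \<subseteq> {1..n - 1}"
    and "\<forall>i. 1 < i \<and> i < n \<longrightarrow> (\<forall>T\<in>A. phi i T \<in> A \<and> phi i (phi i T) = T)"
  shows "is_dual_equivalence A Des phi n \<longleftrightarrow> is_deg A (sigma_of Des) (Phi_of A phi) n n"
proof
  have inv: "involutions A phi n" by unfold_locales (use assms in auto)
  show "is_deg A (sigma_of Des) (Phi_of A phi) n n" if dual: "is_dual_equivalence A Des phi n"
  proof -
    interpret involutions A phi n by (rule inv)
    interpret schur_classes A Des phi n
      by unfold_locales (use dual in \<open>auto simp: is_dual_equivalence_def schur_class_def\<close>)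
    show ?thesis by (rule is_deg_of_schur)
  qed
  show "is_dual_equivalence A Des phi n" if deg: "is_deg A (sigma_of Des) (Phi_of A phi) n n"
  proof -
    interpret pre_deg A Des phi n by (rule pre_deg_of_is_deg(1)[OF inv deg])
    \<comment> \<open>In this direction the single edge is axiom 6 itself.\<close>
    have oe: "one_edge A phi i" if "chart_extension A Des phi n i f r" for i f r
    proof -
      interpret chart_extension A Des phi n i f r by (rule that)
      show ?thesis using pre_deg_of_is_deg(2)[OF inv deg] one_less_i(1) i_n by blast
    qed
    show ?thesis
      unfolding is_dual_equivalence_def schur_class_def[symmetric]
    proof (intro conjI allI impI ballI)
      fix h i T assume a: "1 < h \<and> h \<le> i \<and> i < n \<and> i - h \<le> 3 \<and> T \<in> A"
      have "\<exists>f. chart A Des phi (Suc i) f \<and> (\<forall>T\<in>A. inj_on f (deq_class A phi 2 (Suc i - 1) T))"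
      proof (rule ex_inj_chart)
        fix k f r assume "chart_extension A Des phi n k f r"
        then show "one_edge A phi k" by (rule oe)
      qed (use a in simp_all)
      then obtain f where "chart A Des phi (Suc i) f" "\<forall>T\<in>A. inj_on f (deq_class A phi 2 (Suc i - 1) T)"
        by blast
      then show "schur_class A Des phi h i T" using schur_class_of_chart[of i f T h] a by simp
    next
      fix i j T assume "1 < i \<and> i < n \<and> 1 < j \<and> j < n \<and> (i + 3 \<le> j \<or> j + 3 \<le> i)" "T \<in> A"
      then show "phi i (phi j T) = phi j (phi i T)" using comm[of i j T] comm[of j i T] by auto
    qed
  qed
qed

end
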